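(* There is an algorithm which, given a nonempty $S\subseteq\{A,B,C,D\}$ and a twin-free, inseparable poset $P$ with $n$ elements, determines whether $P$ is an $S$-order, outputting an $S$-representation of $P$ if it is and otherwise a certificate (either a forcing cycle of $P$ with value greater than $0$, or a forcing cycle of value $0$ whose elements induce a subposet with no $S$-representation), and which runs in $O(n^5)$ time.
   Context: Interval types: every interval $I_v$ has left endpoint $L(v)$, right endpoint $R(v)$, center $c(v)=(L(v)+R(v))/2$, and one of four types: $A$ (endpoints closed, center closed), $B$ (endpoints open, center open), $C$ (endpoints closed, center open), $D$ (endpoints open, center closed); the center always belongs to the interval. For nonempty $S\subseteq\{A,B,C,D\}$, an $S$-representation of a poset $(X,\prec)$ assigns to each $x\in X$ an interval $I_x$, all of the same positive length, each of type in $S$, such that $x\prec y$ iff (i) $R(x)<c(y)$, or (ii) $R(x)=c(y)$, at least one of $R(x),c(y)$ is open, and at least one of $L(y),c(x)$ is open. An $S$-order is a poset with an $S$-representation. Twins are two elements with the same comparabilities; twin-free means no twins. A poset $(X,\prec)$ is separable if $X$ can be partitioned into nonempty sets $V,W$ with $v\prec w$ for all $v\in V$, $w\in W$; otherwise inseparable. For distinct elements, $x\parallel y$ means incomparable. A forcing cycle is a sequence $x_0,\dots,x_t$ with $t\ge1$, $x_t=x_0$, and $x_i\prec x_{i+1}$ or $x_i\parallel x_{i+1}$ for each $0\le i\le t-1$; its value is the number of indices with $x_i\prec x_{i+1}$ minus the number with $x_i\parallel x_{i+1}$. Running time counts bit operations on the numbers manipulated. *)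

theory Defs
  imports Complex_Main "HOL-Library.Landau_Symbols" "HOL-Library.Log_Nat"
begin

section \<open>Posets\<close>

text \<open>A poset is given by its carrier and its strict order relation.\<close>

definition strict_poset :: "'a set \<Rightarrow> ('a \<Rightarrow> 'a \<Rightarrow> bool) \<Rightarrow> bool" where
  "strict_poset X r \<longleftrightarrow> irreflp_on X r \<and> transp_on X r"

definition incomparable :: "('a \<Rightarrow> 'a \<Rightarrow> bool) \<Rightarrow> 'a \<Rightarrow> 'a \<Rightarrow> bool" where
  "incomparable r x y \<longleftrightarrow> x \<noteq> y \<and> \<not> r x y \<and> \<not> r y x"

definition twins :: "'a set \<Rightarrow> ('a \<Rightarrow> 'a \<Rightarrow> bool) \<Rightarrow> 'a \<Rightarrow> 'a \<Rightarrow> bool" where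
  "twins X r x y \<longleftrightarrow> x \<noteq> y \<and> (\<forall>z\<in>X. (r x z \<longleftrightarrow> r y z) \<and> (r z x \<longleftrightarrow> r z y))"

definition twin_free :: "'a set \<Rightarrow> ('a \<Rightarrow> 'a \<Rightarrow> bool) \<Rightarrow> bool" where
  "twin_free X r \<longleftrightarrow> (\<forall>x\<in>X. \<forall>y\<in>X. \<not> twins X r x y)"

definition separable :: "'a set \<Rightarrow> ('a \<Rightarrow> 'a \<Rightarrow> bool) \<Rightarrow> bool" where
  "separable X r \<longleftrightarrow>
     (\<exists>V W. V \<noteq> {} \<and> W \<noteq> {} \<and> V \<union> W = X \<and> V \<inter> W = {} \<and> (\<forall>v\<in>V. \<forall>w\<in>W. r v w))"


section \<open>Interval representations\<close>

datatype itype = TA | TB | TC | TD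

record interval =
  lend :: real
  rend :: real
  itype :: itype

definition center :: "interval \<Rightarrow> real" where
  "center I = (lend I + rend I) / 2"

definition open_ends :: "interval \<Rightarrow> bool" where
  "open_ends I \<longleftrightarrow> itype I \<in> {TB, TD}"

definition open_center :: "interval \<Rightarrow> bool" where
  "open_center I \<longleftrightarrow> itype I \<in> {TB, TC}"

definition interval_prec :: "interval \<Rightarrow> interval \<Rightarrow> bool" where
  "interval_prec I J \<longleftrightarrow>
     rend I < center J \<or>
     rend I = center J \<and> (open_ends I \<or> open_center J) \<and> (open_ends J \<or> open_center I)"

definition S_representation ::
    "itype set \<Rightarrow> 'a set \<Rightarrow> ('a \<Rightarrow> 'a \<Rightarrow> bool) \<Rightarrow> ('a \<Rightarrow> interval) \<Rightarrow> bool" where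
  "S_representation S X r I \<longleftrightarrow>
     (\<exists>len>0. \<forall>x\<in>X. rend (I x) - lend (I x) = len) \<and>
     (\<forall>x\<in>X. itype (I x) \<in> S) \<and>
     (\<forall>x\<in>X. \<forall>y\<in>X. r x y \<longleftrightarrow> interval_prec (I x) (I y))"

definition S_order :: "itype set \<Rightarrow> 'a set \<Rightarrow> ('a \<Rightarrow> 'a \<Rightarrow> bool) \<Rightarrow> bool" where
  "S_order S X r \<longleftrightarrow> (\<exists>I. S_representation S X r I)"


section \<open>Forcing cycles\<close>

text \<open>The list \<open>[x\<^sub>0, \<dots>, x\<^sub>t]\<close> has length \<open>t + 1\<close>, so \<open>t \<ge> 1\<close> means length at least 2.\<close>

definition forcing_cycle :: "'a set \<Rightarrow> ('a \<Rightarrow> 'a \<Rightarrow> bool) \<Rightarrow> 'a list \<Rightarrow> bool" where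
  "forcing_cycle X r xs \<longleftrightarrow>
     length xs \<ge> 2 \<and> set xs \<subseteq> X \<and> last xs = hd xs \<and>
     (\<forall>i<length xs - 1. r (xs ! i) (xs ! Suc i) \<or> incomparable r (xs ! i) (xs ! Suc i))"

definition cycle_value :: "('a \<Rightarrow> 'a \<Rightarrow> bool) \<Rightarrow> 'a list \<Rightarrow> int" where
  "cycle_value r xs =
     int (card {i. i < length xs - 1 \<and> r (xs ! i) (xs ! Suc i)}) -
     int (card {i. i < length xs - 1 \<and> incomparable r (xs ! i) (xs ! Suc i)})"

definition certificate ::
    "itype set \<Rightarrow> 'a set \<Rightarrow> ('a \<Rightarrow> 'a \<Rightarrow> bool) \<Rightarrow> 'a list \<Rightarrow> bool" where
  "certificate S X r xs \<longleftrightarrow>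
     forcing_cycle X r xs \<and>
     (cycle_value r xs > 0 \<or> cycle_value r xs = 0 \<and> \<not> S_order S (set xs) r)"


section \<open>Algorithms and their bit cost\<close>

text \<open>
  Algorithms are programs of a random access machine with structured control flow, with finitely
  many integer variables and integer arrays. Time is measured by the logarithmic cost criterion:
  every operation is charged according to the binary lengths of all numbers involved, including
  array indices. Addition, subtraction and comparison have linear cost, multiplication has the
  cost of the schoolbook algorithm.
\<close>

datatype aexp =
    Const int
  | Var string
  | Elem string aexp
  | Plus aexp aexp
  | Minus aexp aexp
  | Times aexp aexp

datatype bexp =
    Less aexp aexp
  | Equal aexp aexp
  | Neg bexp
  | And bexp bexp

datatype com =
    Skip
  | Assign string aexp
  | Update string aexp aexp
  | Seq com com
  | Cond bexp com com
  | While bexp com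

record state =
  vars :: "string \<Rightarrow> int"
  arrs :: "string \<Rightarrow> int \<Rightarrow> int"

text \<open>Number of binary digits of the absolute value, plus one bit for the sign.\<close>

definition bits :: "int \<Rightarrow> nat" where
  "bits k = floorlog 2 (nat \<bar>k\<bar>) + 1"

fun aval :: "aexp \<Rightarrow> state \<Rightarrow> int" where
  "aval (Const k) s = k"
| "aval (Var x) s = vars s x"
| "aval (Elem a e) s = arrs s a (aval e s)"
| "aval (Plus e f) s = aval e s + aval f s"
| "aval (Minus e f) s = aval e s - aval f s"
| "aval (Times e f) s = aval e s * aval f s"

fun acost :: "aexp \<Rightarrow> state \<Rightarrow> nat" where
  "acost (Const k) s = bits k"
| "acost (Var x) s = bits (vars s x)"
| "acost (Elem a e) s = acost e s + bits (aval e s) + bits (arrs s a (aval e s))"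
| "acost (Plus e f) s = acost e s + acost f s + bits (aval e s) + bits (aval f s)"
| "acost (Minus e f) s = acost e s + acost f s + bits (aval e s) + bits (aval f s)"
| "acost (Times e f) s = acost e s + acost f s + bits (aval e s) * bits (aval f s)"

fun bval :: "bexp \<Rightarrow> state \<Rightarrow> bool" where
  "bval (Less e f) s \<longleftrightarrow> aval e s < aval f s"
| "bval (Equal e f) s \<longleftrightarrow> aval e s = aval f s"
| "bval (Neg b) s \<longleftrightarrow> \<not> bval b s"
| "bval (And b c) s \<longleftrightarrow> bval b s \<and> bval c s"

fun bcost :: "bexp \<Rightarrow> state \<Rightarrow> nat" where
  "bcost (Less e f) s = acost e s + acost f s + bits (aval e s) + bits (aval f s)"
| "bcost (Equal e f) s = acost e s + acost f s + bits (aval e s) + bits (aval f s)"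
| "bcost (Neg b) s = bcost b s + 1"
| "bcost (And b c) s = bcost b s + bcost c s + 1"

text \<open>\<open>exec c s t s'\<close>: started in \<open>s\<close>, the program \<open>c\<close> halts in \<open>s'\<close> after \<open>t\<close> bit operations.\<close>

inductive exec :: "com \<Rightarrow> state \<Rightarrow> nat \<Rightarrow> state \<Rightarrow> bool" where
  Skip: "exec Skip s 1 s"
| Assign: "exec (Assign x e) s (acost e s + bits (aval e s))
     (s\<lparr>vars := (vars s)(x := aval e s)\<rparr>)"
| Update: "exec (Update a i e) s
     (acost i s + acost e s + bits (aval i s) + bits (aval e s))
     (s\<lparr>arrs := (arrs s)(a := (arrs s a)(aval i s := aval e s))\<rparr>)"
| Seq: "exec c s t s' \<Longrightarrow> exec d s' u s'' \<Longrightarrow> exec (Seq c d) s (t + u) s''"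
| CondTrue: "bval b s \<Longrightarrow> exec c s t s' \<Longrightarrow> exec (Cond b c d) s (bcost b s + 1 + t) s'"
| CondFalse: "\<not> bval b s \<Longrightarrow> exec d s t s' \<Longrightarrow> exec (Cond b c d) s (bcost b s + 1 + t) s'"
| WhileFalse: "\<not> bval b s \<Longrightarrow> exec (While b c) s (bcost b s + 1) s"
| WhileTrue: "bval b s \<Longrightarrow> exec c s t s' \<Longrightarrow> exec (While b c) s' u s'' \<Longrightarrow>
     exec (While b c) s (bcost b s + 1 + t + u) s''"

inductive_cases exec_elims:
  "exec Skip s t s'"
  "exec (Assign x e) s t s'"
  "exec (Update a i e) s t s'"
  "exec (Seq c d) s t s'"
  "exec (Cond b c d) s t s'"

inductive_cases exec_WhileE: "exec (While b c) s t s'"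

lemma exec_deterministic:
  "exec c s t s' \<Longrightarrow> exec c s u s'' \<Longrightarrow> u = t \<and> s'' = s'"
proof (induction arbitrary: u s'' rule: exec.induct)
  case (WhileFalse b s c)
  from WhileFalse.prems WhileFalse.hyps show ?case
    by (auto elim: exec_WhileE)
next
  case (WhileTrue b s c t s1 v s2)
  from WhileTrue.prems \<open>bval b s\<close> obtain t' s1' v' where
    "exec c s t' s1'" "exec (While b c) s1' v' s''" "u = bcost b s + 1 + t' + v'"
    by (auto elim: exec_WhileE)
  then show ?case using WhileTrue.IH by blast
qed (fastforce elim!: exec_elims)+


section \<open>Input and output\<close>

fun type_code :: "itype \<Rightarrow> int" where
  "type_code TA = 0"
| "type_code TB = 1"
| "type_code TC = 2"
| "type_code TD = 3"

text \<open>
  The elements of an input poset with \<open>n\<close> elements are numbered \<open>0, \<dots>, n - 1\<close>. Its order relation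
  is stored row by row as a 0-1 matrix, and \<open>S\<close> as a 0-1 vector indexed by the type codes.
  All other memory is initially 0.
\<close>

definition input_state :: "itype set \<Rightarrow> nat \<Rightarrow> (nat \<Rightarrow> nat \<Rightarrow> bool) \<Rightarrow> state" where
  "input_state S n r = \<lparr>
     vars = (\<lambda>_. 0)(''n'' := int n),
     arrs = (\<lambda>_ _. 0)(
       ''S'' := (\<lambda>k. of_bool (\<exists>\<tau>\<in>S. k = type_code \<tau>)),
       ''P'' := (\<lambda>k. of_bool (\<exists>x<n. \<exists>y<n. k = int (x * n + y) \<and> r x y)))\<rparr>"

text \<open>Endpoints are output as fractions with positive denominators.\<close>

definition outputs_intervals :: "state \<Rightarrow> nat \<Rightarrow> (nat \<Rightarrow> interval) \<Rightarrow> bool" where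
  "outputs_intervals s n I \<longleftrightarrow>
     (\<forall>x<n.
        arrs s ''Lden'' (int x) > 0 \<and>
        lend (I x) = of_int (arrs s ''Lnum'' (int x)) / of_int (arrs s ''Lden'' (int x)) \<and>
        arrs s ''Rden'' (int x) > 0 \<and>
        rend (I x) = of_int (arrs s ''Rnum'' (int x)) / of_int (arrs s ''Rden'' (int x)) \<and>
        arrs s ''type'' (int x) = type_code (itype (I x)))"

definition outputs_sequence :: "state \<Rightarrow> nat list \<Rightarrow> bool" where
  "outputs_sequence s xs \<longleftrightarrow>
     vars s ''length'' = int (length xs) \<and>
     (\<forall>i<length xs. arrs s ''cycle'' (int i) = int (xs ! i))"

definition correct_output ::
    "itype set \<Rightarrow> nat \<Rightarrow> (nat \<Rightarrow> nat \<Rightarrow> bool) \<Rightarrow> state \<Rightarrow> bool" where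
  "correct_output S n r s \<longleftrightarrow>
     (if S_order S {..<n} r
      then vars s ''verdict'' = 1 \<and>
           (\<exists>I. outputs_intervals s n I \<and> S_representation S {..<n} r I)
      else vars s ''verdict'' = 0 \<and>
           (\<exists>xs. outputs_sequence s xs \<and> certificate S {..<n} r xs))"

end

theory Submission
  imports Defs
begin

text \<open>
  With half length 1, a representation is an assignment of centers and types such that
  \<open>c y \<ge> c x + 1\<close> if \<open>x \<prec> y\<close> and \<open>c y \<ge> c x - 1\<close> if \<open>x \<parallel> y\<close>; for a pair at distance exactly 1, a
  symmetric relation on the types decides whether the pair is comparable. So forcing cycles are the
  closed walks of a weighted digraph. Positive ones exclude a representation, and the arcs on
  closed walks of weight 0 are exactly those that are tight in every representation. If there is no
  positive closed walk, the average over all targets \<open>y\<close> of the potentials \<open>x \<mapsto> - D x y\<close>, where \<open>D\<close>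
  is the longest-walk distance, is tight on these arcs and on no others. What is left is to choose
  types subject to constraints on pairs in the same class of the zero closed walks; this
  reduces to a two-colouring problem. An unsolvable class is certified by a closed walk of weight 0
  through all of its elements.

  The distances are computed by dynamic programming over the number of arcs. This takes \<open>O(n^4)\<close>
  operations on numbers of \<open>O(log n)\<close> bits.
\<close>

section \<open>Longest walks in the forcing graph\<close>

text \<open>A tight pair that is not forced would impose a type constraint that other
  representations need not meet. The centers must therefore avoid every accidental tightness; then
  solvability of the type constraints depends on the poset alone and not on the chosen centers.
  Whether an element may take type B or A depends on all its constrained partners, so a conflict at
  one pair may be caused by elements elsewhere in its class. The certificate has to reach the whole
  class, and it does so along longest walks in both directions, so that the subposet induced by its
  own elements already forces the relative positions of the centers. The gap between
  \<open>n^4\<close> and \<open>n^5\<close> absorbs the squared number length: a product of numbers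
  with \<open>O(log n)\<close> bits costs \<open>O(log^2 n)\<close> bit operations, which is at most
  linear in \<open>n\<close>.\<close>

definition arc :: "('a \<Rightarrow> 'a \<Rightarrow> bool) \<Rightarrow> 'a \<Rightarrow> 'a \<Rightarrow> bool" where
  "arc r x y \<longleftrightarrow> r x y \<or> incomparable r x y"

definition wgt :: "('a \<Rightarrow> 'a \<Rightarrow> bool) \<Rightarrow> 'a \<Rightarrow> 'a \<Rightarrow> int" where
  "wgt r x y = (if r x y then 1 else -1)"

fun walk_weight :: "('a \<Rightarrow> 'a \<Rightarrow> bool) \<Rightarrow> 'a list \<Rightarrow> int" where
  "walk_weight r (x # y # zs) = wgt r x y + walk_weight r (y # zs)"
| "walk_weight r _ = 0"

lemma walk_weight_append:
  "walk_weight r (xs @ y # zs) = walk_weight r (xs @ [y]) + walk_weight r (y # zs)"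
  by (induction r xs rule: walk_weight.induct) auto

lemma walk_weight_le: "walk_weight r xs \<le> int (length xs - 1)"
  by (induction r xs rule: walk_weight.induct) (auto simp: wgt_def)

text \<open>Splitting off index 0 and shifting the others by \<open>Suc\<close> turns the set counts
  of \<open>cycle_value\<close> into the recursion of \<open>walk_weight\<close>.\<close>

lemma card_steps_Cons:
  "card {i. i < length (x # y # zs) - 1 \<and> P ((x # y # zs) ! i) ((x # y # zs) ! Suc i)} =
   of_bool (P x y) + card {i. i < length (y # zs) - 1 \<and> P ((y # zs) ! i) ((y # zs) ! Suc i)}"
  (is "card ?A = _ + card ?B")
proof -
  have "?A = (if P x y then {0} else {}) \<union> Suc ` ?B" (is "_ = ?C")
  proof (intro set_eqI)
    fix i show "i \<in> ?A \<longleftrightarrow> i \<in> ?C"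
      by (cases i) (auto simp: image_iff)
  qed
  moreover have "card (Suc ` ?B) = card ?B" by (rule card_image) simp
  moreover have "finite ?B" by simp
  ultimately show ?thesis by (auto simp: card_insert_if)
qed

lemma cycle_value_eq_walk_weight:
  assumes "successively (arc r) xs"
  shows "cycle_value r xs = walk_weight r xs"
  using assms
proof (induction r xs rule: walk_weight.induct)
  case (1 r x y zs)
  have "cycle_value r (x # y # zs) =
      of_bool (r x y) - of_bool (incomparable r x y) + cycle_value r (y # zs)"
    unfolding cycle_value_def
      card_steps_Cons[of x y zs r] card_steps_Cons[of x y zs "incomparable r"] by simp
  with 1 show ?case by (auto simp: arc_def wgt_def incomparable_def)
qed (auto simp: cycle_value_def)

lemma forcing_cycle_iff:
  "forcing_cycle X r xs \<longleftrightarrow>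
     length xs \<ge> 2 \<and> set xs \<subseteq> X \<and> last xs = hd xs \<and> successively (arc r) xs"
  by (auto simp: forcing_cycle_def successively_conv_nth arc_def less_diff_conv)

lemma successively_append_Cons:
  "successively P (xs @ y # zs) \<longleftrightarrow> successively P (xs @ [y]) \<and> successively P (y # zs)"
  by (auto simp: successively_append_iff)

text \<open>A walk may end with a jump to the target at the price \<open>2n + 1\<close>, which replaces the value
  minus infinity: a closed walk that uses the jump has negative weight.\<close>

definition longest_base :: "nat \<Rightarrow> nat \<Rightarrow> nat \<Rightarrow> int" where
  "longest_base n x y = (if x = y then 0 else - 1 - int n - int n)"

fun longest :: "nat \<Rightarrow> (nat \<Rightarrow> nat \<Rightarrow> bool) \<Rightarrow> nat \<Rightarrow> nat \<Rightarrow> nat \<Rightarrow> int" where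
  "longest n r 0 x y = longest_base n x y"
| "longest n r (Suc k) x y =
     Max (insert (longest n r k x y) ((\<lambda>z. wgt r x z + longest n r k z y) ` {z. z < n \<and> arc r x z}))"

lemma longest_Suc_ge: "longest n r k x y \<le> longest n r (Suc k) x y"
  by simp

lemma longest_Suc_ge_arc:
  "z < n \<Longrightarrow> arc r x z \<Longrightarrow> wgt r x z + longest n r k z y \<le> longest n r (Suc k) x y"
  by simp

lemma longest_mono: "k \<le> l \<Longrightarrow> longest n r k x y \<le> longest n r l x y"
  by (rule lift_Suc_mono_le[of "\<lambda>k. longest n r k x y"]) (rule longest_Suc_ge)

lemma longest_Suc_cases:
  obtains "longest n r (Suc k) x y = longest n r k x y"
  | z where "z < n" "arc r x z" "longest n r (Suc k) x y = wgt r x z + longest n r k z y"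
proof -
  have "longest n r (Suc k) x y \<in>
      insert (longest n r k x y) ((\<lambda>z. wgt r x z + longest n r k z y) ` {z. z < n \<and> arc r x z})"
    unfolding longest.simps by (rule Max_in) auto
  then show ?thesis using that by auto
qed

declare longest.simps(2)[simp del]

definition walk :: "nat \<Rightarrow> (nat \<Rightarrow> nat \<Rightarrow> bool) \<Rightarrow> nat list \<Rightarrow> bool" where
  "walk n r xs \<longleftrightarrow> xs \<noteq> [] \<and> set xs \<subseteq> {..<n} \<and> successively (arc r) xs"

text \<open>Together with \<open>longest_attained\<close> this identifies
  \<open>longest n r k x y\<close> as a maximum over the walks from \<open>x\<close> with at most
  \<open>k\<close> arcs, each charged for the jump from its end to \<open>y\<close>. List length
  counts vertices, hence \<open>Suc k\<close>.\<close>

lemma walk_weight_le_longest: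
  "walk n r xs \<Longrightarrow> length xs \<le> Suc k \<Longrightarrow>
   walk_weight r xs + longest_base n (last xs) y \<le> longest n r k (hd xs) y"
proof (induction k arbitrary: xs)
  case 0
  then obtain x where "xs = [x]" by (cases xs) (auto simp: walk_def)
  then show ?case by simp
next
  case (Suc k)
  show ?case
  proof (cases "length xs \<le> Suc k")
    case True
    show ?thesis using Suc.IH[OF Suc.prems(1) True] longest_Suc_ge[of n r k "hd xs" y] by linarith
  next
    case False
    then obtain x z zs where xs: "xs = x # z # zs"
      by (cases xs; cases "tl xs") auto
    then have "walk n r (z # zs)" "arc r x z" "z < n"
      using Suc.prems by (auto simp: walk_def)
    then have "walk_weight r (z # zs) + longest_base n (last (z # zs)) y \<le> longest n r k z y"
      using Suc.IH[of "z # zs"] Suc.prems xs by auto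
    with longest_Suc_ge_arc[OF \<open>z < n\<close> \<open>arc r x z\<close>, of k y] xs show ?thesis
      by simp
  qed
qed

lemma longest_attained:
  "x < n \<Longrightarrow> \<exists>xs. walk n r xs \<and> hd xs = x \<and> length xs \<le> Suc k \<and>
     walk_weight r xs + longest_base n (last xs) y = longest n r k x y"
proof (induction k arbitrary: x)
  case 0
  then show ?case by (intro exI[of _ "[x]"]) (auto simp: walk_def)
next
  case (Suc k)
  show ?case
  proof (cases rule: longest_Suc_cases[of n r k x y])
    case 1
    then show ?thesis using Suc.IH[OF Suc.prems] by (metis le_SucI)
  next
    case (2 z)
    obtain xs where "walk n r xs" "hd xs = z" "length xs \<le> Suc k"
      "walk_weight r xs + longest_base n (last xs) y = longest n r k z y"
      using Suc.IH[OF 2(1)] by blast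
    moreover obtain zs where "xs = z # zs" using calculation by (cases xs) (auto simp: walk_def)
    ultimately show ?thesis using 2 Suc.prems
      by (intro exI[of _ "x # xs"]) (auto simp: walk_def)
  qed
qed

text \<open>Layer \<open>n\<close> decides: if its diagonal has no positive entry, then by
  \<open>longest_stable\<close> one more arc improves no entry.\<close>

definition no_positive :: "nat \<Rightarrow> (nat \<Rightarrow> nat \<Rightarrow> bool) \<Rightarrow> bool" where
  "no_positive n r \<longleftrightarrow> (\<forall>x<n. longest n r n x x \<le> 0)"

text \<open>Pigeonhole: a walk with more than \<open>n\<close> arcs contains a closed walk with at most \<open>n\<close>
  arcs; cutting it out does not decrease the weight.\<close>

lemma longest_stable:
  assumes "no_positive n r" "x < n"
  shows "longest n r (Suc n) x y \<le> longest n r n x y"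
proof -
  obtain xs where xs: "walk n r xs" "hd xs = x" "length xs \<le> Suc (Suc n)"
      "walk_weight r xs + longest_base n (last xs) y = longest n r (Suc n) x y"
    using longest_attained[OF assms(2)] by blast
  show ?thesis
  proof (cases "length xs \<le> Suc n")
    case True
    with walk_weight_le_longest[OF xs(1) True, of y] xs show ?thesis by simp
  next
    case False
    \<comment> \<open>Only the first \<open>n + 1\<close> vertices are searched for a repetition.
      This caps the excised closed walk at \<open>n\<close> arcs, the range that
      \<open>no_positive\<close> controls.\<close>
    define qs where "qs = take (Suc n) xs"
    have len: "length qs = Suc n" using False by (auto simp: qs_def)
    have "set qs \<subseteq> {..<n}" using xs(1) set_take_subset unfolding qs_def walk_def by fastforce
    then have "card (set qs) \<le> n" using card_mono[of "{..<n}" "set qs"] by simp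
    then have "\<not> distinct qs" using len distinct_card[of qs] by auto
    then obtain as v bs cs where q: "qs = as @ [v] @ bs @ [v] @ cs"
      using not_distinct_decomp by blast
    define ds where "ds = cs @ drop (Suc n) xs"
    have e: "xs = as @ v # (bs @ v # ds)"
      using append_take_drop_id[of "Suc n" xs] q unfolding qs_def ds_def by (metis append.assoc append_Cons append_Nil)
    have w1: "walk n r (v # bs @ [v])" and w2: "walk n r (as @ v # ds)"
      using xs(1) successively_append_Cons[of "arc r" as v "bs @ v # ds"]
        successively_append_Cons[of "arc r" "v # bs" v ds]
        successively_append_Cons[of "arc r" as v ds]
      by (auto simp: walk_def e)
    have v: "v < n" using w1 by (auto simp: walk_def)
    have "walk_weight r (v # bs @ [v]) \<le> longest n r n v v"
      using walk_weight_le_longest[OF w1, of n v] len q by (simp add: longest_base_def)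
    then have c: "walk_weight r (v # bs @ [v]) \<le> 0" using assms(1) v by (force simp: no_positive_def)
    have "walk_weight r xs = walk_weight r (as @ [v]) + walk_weight r (v # bs @ [v]) + walk_weight r (v # ds)"
      using walk_weight_append[of r as v "bs @ v # ds"] walk_weight_append[of r "v # bs" v ds] e by simp
    then have "walk_weight r xs \<le> walk_weight r (as @ v # ds)"
      using c walk_weight_append[of r as v ds] by simp
    moreover have "last (as @ v # ds) = last xs" using e by simp
    moreover have "hd (as @ v # ds) = x" using e xs(2) by (cases as) auto
    moreover have "length (as @ v # ds) \<le> Suc n" using e xs(3) by simp
    ultimately show ?thesis
      using walk_weight_le_longest[OF w2, of n y] xs(4) by simp
  qed
qed

lemma longest_arc:
  assumes "no_positive n r" "x < n" "z < n" "arc r x z"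
  shows "wgt r x z + longest n r n z y \<le> longest n r n x y"
  using longest_stable[OF assms(1,2), of y] longest_Suc_ge_arc[OF assms(3,4), of n y] by linarith

text \<open>Iterating \<open>longest_arc\<close> removes the bound on the number of arcs: walks of
  every length are covered.\<close>

lemma longest_walk:
  "no_positive n r \<Longrightarrow> walk n r xs \<Longrightarrow>
   walk_weight r xs + longest n r n (last xs) y \<le> longest n r n (hd xs) y"
proof (induction r xs rule: walk_weight.induct)
  case (1 r x z zs)
  then have "walk n r (z # zs)" "arc r x z" "x < n" "z < n" by (auto simp: walk_def)
  then show ?case using 1 longest_arc[of n r x z y] by auto
qed (auto simp: walk_def)

lemma longest_upper: "x < n \<Longrightarrow> longest n r n x y \<le> int n"
proof -
  assume "x < n"
  from longest_attained[OF this, of r n y] obtain xs where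
    "length xs \<le> Suc n" "walk_weight r xs + longest_base n (last xs) y = longest n r n x y" by blast
  then show ?thesis using walk_weight_le[of r xs] by (auto simp: longest_base_def split: if_splits)
qed

lemma longest_lower: "x < n \<Longrightarrow> - 1 - int n - int n \<le> longest n r n x y"
  using longest_mono[of 0 n n r x y] by (auto simp: longest_base_def split: if_splits)

lemma longest_refl_nonneg: "0 \<le> longest n r n x x"
  using longest_mono[of 0 n n r x x] by (simp add: longest_base_def)

text \<open>A walk with at most \<open>n\<close> arcs that ends with the jump is worth at most
  \<open>n - (2n + 1)\<close>, so a larger entry stems from a genuine walk to
  \<open>y\<close>.\<close>

lemma longest_real_walk:
  assumes "x < n" "longest n r n x y > - 1 - int n"
  obtains xs where "walk n r xs" "hd xs = x" "last xs = y" "walk_weight r xs = longest n r n x y"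
proof -
  from longest_attained[OF assms(1), of r n y] obtain xs where
    xs: "walk n r xs" "hd xs = x" "length xs \<le> Suc n"
      "walk_weight r xs + longest_base n (last xs) y = longest n r n x y" by blast
  have "last xs = y" using xs assms(2) walk_weight_le[of r xs]
    by (auto simp: longest_base_def split: if_splits)
  then show ?thesis using xs that by (auto simp: longest_base_def)
qed

text \<open>The lower bound on the first entry is there because only a genuine walk to
  \<open>y\<close> can be continued towards \<open>z\<close>.\<close>

lemma longest_triangle:
  assumes "no_positive n r" "x < n" "longest n r n x y > - 1 - int n"
  shows "longest n r n x y + longest n r n y z \<le> longest n r n x z"
proof -
  obtain xs where "walk n r xs" "hd xs = x" "last xs = y" "walk_weight r xs = longest n r n x y"
    using longest_real_walk[OF assms(2,3)] by blast
  then show ?thesis using longest_walk[OF assms(1), of xs z] by simp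
qed

lemma longest_refl: "no_positive n r \<Longrightarrow> x < n \<Longrightarrow> longest n r n x x = 0"
  using longest_refl_nonneg[of n r x] by (simp add: no_positive_def order_antisym)

section \<open>Representations and type constraints\<close>

text \<open>At distance exactly half a length, comparability depends on the types only, symmetrically.\<close>

definition compatible :: "itype \<Rightarrow> itype \<Rightarrow> bool" where
  "compatible \<sigma> \<tau> \<longleftrightarrow> \<sigma> = TB \<or> \<tau> = TB \<or> \<sigma> = \<tau> \<and> \<sigma> \<noteq> TA"

lemma compatible_commute: "compatible \<sigma> \<tau> \<longleftrightarrow> compatible \<tau> \<sigma>"
  by (auto simp: compatible_def)

lemma interval_prec_iff:
  assumes "rend I = center I + h"
  shows "interval_prec I J \<longleftrightarrow>
    center I + h < center J \<or> center I + h = center J \<and> compatible (itype I) (itype J)"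
  using assms
  by (cases "itype I"; cases "itype J")
    (auto simp: interval_prec_def open_ends_def open_center_def compatible_def)

lemma S_representation_half_length:
  assumes "S_representation S X r I"
  obtains h where "h > 0" "\<And>x. x \<in> X \<Longrightarrow> rend (I x) = center (I x) + h"
proof -
  from assms obtain len where "len > 0" "\<forall>x\<in>X. rend (I x) - lend (I x) = len"
    by (auto simp: S_representation_def)
  then show ?thesis
    by (intro that[of "len / 2"]) (auto simp: center_def field_simps)
qed

lemma S_order_subset:
  assumes "S_order S X r" "Y \<subseteq> X"
  shows "S_order S Y r"
proof -
  obtain I where "S_representation S X r I" using assms(1) by (auto simp: S_order_def)
  then have "S_representation S Y r I"
    using subsetD[OF assms(2)] unfolding S_representation_def by blast
  then show ?thesis by (auto simp: S_order_def)
qed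

text \<open>Each arc bounds a difference of centers from below: \<open>r x y\<close> by
  \<open>h\<close>, and the failure of \<open>r y x\<close> by \<open>- h\<close>. The bounds add up
  along the walk. The carrier is arbitrary because it will later be the set of elements of a
  cycle.\<close>

lemma S_representation_walk:
  assumes rep: "S_representation S X r I"
    and h: "\<And>x. x \<in> X \<Longrightarrow> rend (I x) = center (I x) + h"
  shows "xs \<noteq> [] \<Longrightarrow> set xs \<subseteq> X \<Longrightarrow> successively (arc r) xs \<Longrightarrow>
    center (I (hd xs)) + h * real_of_int (walk_weight r xs) \<le> center (I (last xs))"
proof (induction xs rule: induct_list012)
  case (3 x y zs)
  have "center (I x) + h * real_of_int (wgt r x y) \<le> center (I y)"
  proof (cases "r x y")
    case True
    then have "interval_prec (I x) (I y)"
      using rep 3 by (auto simp: S_representation_def)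
    then show ?thesis using interval_prec_iff[OF h, of x "I y"] 3 True by (auto simp: wgt_def)
  next
    case False
    then have "\<not> r y x" using 3 by (auto simp: arc_def incomparable_def)
    then have "\<not> interval_prec (I y) (I x)"
      using rep 3 by (auto simp: S_representation_def)
    then show ?thesis using interval_prec_iff[OF h, of y "I x"] 3 False by (auto simp: wgt_def)
  qed
  with 3 show ?case by (auto simp: distrib_left)
qed auto

lemma positive_cycle_not_S_order:
  assumes "forcing_cycle X r xs" "cycle_value r xs > 0"
  shows "\<not> S_order S X r"
proof
  assume "S_order S X r"
  then obtain I where I: "S_representation S X r I" by (auto simp: S_order_def)
  obtain h where h: "h > 0" "\<And>x. x \<in> X \<Longrightarrow> rend (I x) = center (I x) + h"
    using S_representation_half_length[OF I] by blast
  have xs: "xs \<noteq> []" "set xs \<subseteq> X" "successively (arc r) xs" "last xs = hd xs"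
    using assms(1) by (auto simp: forcing_cycle_iff)
  have "h * real_of_int (walk_weight r xs) \<le> 0"
    using S_representation_walk[OF I h(2) xs(1-3)] xs(4) by simp
  then show False using h(1) assms(2) cycle_value_eq_walk_weight[OF xs(3)]
    by (simp add: mult_le_0_iff)
qed

lemma certificate_not_S_order:
  "certificate S X r xs \<Longrightarrow> \<not> S_order S X r"
  using positive_cycle_not_S_order[of X r xs S] S_order_subset[of S X r "set xs"]
  by (auto simp: certificate_def forcing_cycle_def)

text \<open>The two distances sum to 0, so both elements lie on a closed walk of weight 0, and every
  representation puts the center of \<open>y\<close> exactly one half length to the right of that of
  \<open>x\<close>.\<close>

definition adj :: "nat \<Rightarrow> (nat \<Rightarrow> nat \<Rightarrow> bool) \<Rightarrow> nat \<Rightarrow> nat \<Rightarrow> bool" where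
  "adj n r x y \<longleftrightarrow> longest n r n x y = 1 \<and> longest n r n y x = -1"

text \<open>The type constraint on a pair: 1 means compatible, 2 incompatible, 0 unconstrained.\<close>

definition tcon :: "nat \<Rightarrow> (nat \<Rightarrow> nat \<Rightarrow> bool) \<Rightarrow> nat \<Rightarrow> nat \<Rightarrow> int" where
  "tcon n r x y =
     (if adj n r x y then (if r x y then 1 else 2)
      else if adj n r y x then (if r y x then 1 else 2) else 0)"

lemma tcon_commute: "tcon n r x y = tcon n r y x"
  by (auto simp: tcon_def adj_def)

definition types_ok :: "nat \<Rightarrow> (nat \<Rightarrow> nat \<Rightarrow> bool) \<Rightarrow> nat set \<Rightarrow> (nat \<Rightarrow> itype) \<Rightarrow> bool" where
  "types_ok n r K ty \<longleftrightarrow> (\<forall>x\<in>K. \<forall>y\<in>K.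
     (tcon n r x y = 1 \<longrightarrow> compatible (ty x) (ty y)) \<and>
     (tcon n r x y = 2 \<longrightarrow> \<not> compatible (ty x) (ty y)))"

lemma types_okD:
  assumes "types_ok n r K ty" "x \<in> K" "y \<in> K"
  shows "tcon n r x y = 1 \<Longrightarrow> compatible (ty x) (ty y)"
    and "tcon n r x y = 2 \<Longrightarrow> \<not> compatible (ty x) (ty y)"
  using assms by (simp_all add: types_ok_def)

section \<open>A representation that is tight only where forced\<close>

text \<open>This is \<open>n\<close> times the average potential; division is avoided by giving the
  intervals half length \<open>n\<close>. The offset \<open>int n\<close> makes the summands
  nonnegative for \<open>x < n\<close> (\<open>longest_upper\<close>), so that a program can count
  them up.\<close>

definition centre :: "nat \<Rightarrow> (nat \<Rightarrow> nat \<Rightarrow> bool) \<Rightarrow> nat \<Rightarrow> int" where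
  "centre n r x = (\<Sum>y<n. int n - longest n r n x y)"

text \<open>Every summand of \<^const>\<open>centre\<close> respects the arc, and the summand with index \<open>x\<close> does so
  strictly unless the arc lies on a closed walk of weight 0.\<close>

lemma centre_arc:
  assumes np: "no_positive n r" and x: "x < n" and z: "z < n" and a: "arc r x z"
  shows "centre n r x + int n * wgt r x z \<le> centre n r z"
    and "centre n r x + int n * wgt r x z = centre n r z \<longleftrightarrow> longest n r n z x = - wgt r x z"
proof -
  let ?f = "\<lambda>y. int n - longest n r n x y + wgt r x z" and ?g = "\<lambda>y. int n - longest n r n z y"
  have le: "?f y \<le> ?g y" for y using longest_arc[OF np x z a, of y] by simp
  have s: "centre n r x + int n * wgt r x z = (\<Sum>y<n. ?f y)"
    by (simp add: centre_def sum.distrib)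
  show "centre n r x + int n * wgt r x z \<le> centre n r z"
    unfolding s centre_def[of n r z] by (intro sum_mono le)
  show "centre n r x + int n * wgt r x z = centre n r z \<longleftrightarrow> longest n r n z x = - wgt r x z"
  proof
    assume t: "longest n r n z x = - wgt r x z"
    have "longest n r n z x > - 1 - int n" using t x by (auto simp: wgt_def)
    \<comment> \<open>A return walk of weight \<open>- wgt r x z\<close> yields the converse of
      \<open>le\<close> for every target \<open>y\<close>.\<close>
    then have "?f y = ?g y" for y
      using longest_triangle[OF np z, of x y] t le[of y] by linarith
    then show "centre n r x + int n * wgt r x z = centre n r z"
      unfolding s centre_def[of n r z] by (intro sum.cong) auto
  next
    assume e: "centre n r x + int n * wgt r x z = centre n r z"
    show "longest n r n z x = - wgt r x z"
    proof (rule ccontr)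
      assume "longest n r n z x \<noteq> - wgt r x z"
      then have "?f x < ?g x" using le[of x] longest_refl[OF np x] by linarith
      then have "(\<Sum>y<n. ?f y) < (\<Sum>y<n. ?g y)"
        using x le by (intro sum_strict_mono_ex1) auto
      with e s show False by (simp add: centre_def)
    qed
  qed
qed

text \<open>The arc bounds the forward distance from below, the absence of positive closed walks
  from above, and the two bounds meet.\<close>

lemma adj_if_back:
  assumes np: "no_positive n r" and x: "x < n" and z: "z < n" and a: "arc r x z"
    and t: "longest n r n z x = - wgt r x z"
  shows "longest n r n x z = wgt r x z"
proof -
  have "longest n r n x z \<ge> wgt r x z"
    using longest_arc[OF np x z a, of z] longest_refl[OF np z] by simp
  moreover have "longest n r n z x + longest n r n x z \<le> 0"
    using longest_triangle[OF np z, of x z] longest_refl[OF np z] t x by (auto simp: wgt_def)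
  ultimately show ?thesis using t by linarith
qed

definition canonical_rep :: "nat \<Rightarrow> (nat \<Rightarrow> nat \<Rightarrow> bool) \<Rightarrow> (nat \<Rightarrow> itype) \<Rightarrow> nat \<Rightarrow> interval" where
  "canonical_rep n r ty x = \<lparr>lend = real_of_int (centre n r x - int n),
     rend = real_of_int (centre n r x + int n), itype = ty x\<rparr>"

text \<open>The arc inequalities settle every pair unless the center of \<open>y\<close> is exactly
  \<open>n\<close> to the right of that of \<open>x\<close>. Then the arc joining them is tight, so
  \<open>centre_arc\<close> and \<open>adj_if_back\<close> give \<open>adj n r x y\<close>, and
  \<open>tcon\<close> demands just the compatibility that matches \<open>r x y\<close>.\<close>

lemma canonical_rep_correct:
  assumes po: "strict_poset {..<n} r" and np: "no_positive n r"
    and S: "\<And>x. x < n \<Longrightarrow> ty x \<in> S" and ok: "types_ok n r {..<n} ty"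
  shows "S_representation S {..<n} r (canonical_rep n r ty)"
proof -
  let ?C = "centre n r"
  have prec: "interval_prec (canonical_rep n r ty x) (canonical_rep n r ty y) \<longleftrightarrow>
      ?C x + int n < ?C y \<or> ?C x + int n = ?C y \<and> compatible (ty x) (ty y)" for x y
  proof -
    have "center (canonical_rep n r ty x) = real_of_int (?C x)" for x
      by (simp add: canonical_rep_def center_def)
    moreover have "rend (canonical_rep n r ty x) = center (canonical_rep n r ty x) + real n"
      by (simp add: canonical_rep_def center_def)
    ultimately have "interval_prec (canonical_rep n r ty x) (canonical_rep n r ty y) \<longleftrightarrow>
      real_of_int (?C x + int n) < real_of_int (?C y) \<or>
      real_of_int (?C x + int n) = real_of_int (?C y) \<and> compatible (ty x) (ty y)"
      by (subst interval_prec_iff) (auto simp: canonical_rep_def)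
    then show ?thesis by (simp only: of_int_less_iff of_int_eq_iff)
  qed
  have main: "r x y \<longleftrightarrow> ?C x + int n < ?C y \<or> ?C x + int n = ?C y \<and> compatible (ty x) (ty y)"
    if x: "x < n" and y: "y < n" for x y
  proof -
    consider "r x y" | "r y x" "\<not> r x y" | "x = y" "\<not> r x y" | "incomparable r x y"
      by (auto simp: incomparable_def)
    then show ?thesis
    proof cases
      case 1
      then have a: "arc r x y" "wgt r x y = 1" by (auto simp: arc_def wgt_def)
      have "compatible (ty x) (ty y)" if "?C x + int n = ?C y"
      proof -
        have "longest n r n y x = -1" using centre_arc(2)[OF np x y a(1)] a that by simp
        then have "adj n r x y" using adj_if_back[OF np x y a(1)] a by (simp add: adj_def)
        then show ?thesis using ok 1 x y by (auto simp: types_ok_def tcon_def)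
      qed
      then show ?thesis using 1 centre_arc(1)[OF np x y a(1)] a by auto
    next
      case 2
      then have "arc r y x" "wgt r y x = 1" by (auto simp: arc_def wgt_def)
      then show ?thesis using centre_arc(1)[OF np y x] 2 x by auto
    next
      case 3 then show ?thesis using x by auto
    next
      case 4
      then have a: "arc r y x" "wgt r y x = -1" and nr: "\<not> r x y"
        by (auto simp: arc_def wgt_def incomparable_def)
      have "\<not> compatible (ty x) (ty y)" if "?C x + int n = ?C y"
      proof -
        have "longest n r n x y = 1" using centre_arc(2)[OF np y x a(1)] a that by simp
        then have "adj n r x y" using adj_if_back[OF np y x a(1)] a by (simp add: adj_def)
        then show ?thesis using ok nr x y by (auto simp: types_ok_def tcon_def)
      qed
      then show ?thesis using nr centre_arc(1)[OF np y x a(1)] a by auto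
    qed
  qed
  \<comment> \<open>On the empty carrier every length fits, but a positive one must still be
    named.\<close>
  have "\<exists>len>0. \<forall>x\<in>{..<n}. rend (canonical_rep n r ty x) - lend (canonical_rep n r ty x) = len"
    by (intro exI[of _ "if n = 0 then 1 else 2 * real n"]) (auto simp: canonical_rep_def)
  then show ?thesis
    unfolding S_representation_def using S main prec by (auto simp: canonical_rep_def)
qed

section \<open>Classes with forced relative positions\<close>

definition tight_class :: "nat \<Rightarrow> (nat \<Rightarrow> nat \<Rightarrow> bool) \<Rightarrow> nat \<Rightarrow> nat set" where
  "tight_class n r x = {y. y < n \<and> longest n r n x y + longest n r n y x \<ge> 0}"

text \<open>Both entries are at most \<open>n\<close>, so a nonnegative sum keeps each of them at
  \<open>- n\<close> or above, where entries stem from genuine walks. The class asks for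
  \<open>\<ge> 0\<close> instead of \<open>= 0\<close> so that the same class also yields a cycle
  when \<open>x\<close> lies on a positive closed walk.\<close>

lemma longest_gt_if_sum_nonneg:
  assumes "x < n" "y < n" "longest n r n x y + longest n r n y x \<ge> 0"
  shows "longest n r n x y > - 1 - int n" "longest n r n y x > - 1 - int n"
  using longest_upper[OF assms(1), of r y] longest_upper[OF assms(2), of r x] assms(3) by auto

lemma tight_class_sum:
  assumes "no_positive n r" "x < n" "y \<in> tight_class n r x"
  shows "longest n r n x y + longest n r n y x = 0"
proof -
  have y: "y < n" "longest n r n x y + longest n r n y x \<ge> 0"
    using assms(3) by (auto simp: tight_class_def)
  show ?thesis
    using longest_triangle[OF assms(1,2) longest_gt_if_sum_nonneg(1)[OF assms(2) y], of x]
      longest_refl[OF assms(1,2)] y(2) by linarith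
qed

text \<open>Within the class the distances there and back cancel, so the two triangle inequalities
  through \<open>u\<close> become equalities: distances from \<open>x\<close> add up exactly, and
  the class is closed under constraints.\<close>

lemma tight_class_adj:
  assumes np: "no_positive n r" and x: "x < n" and u: "u \<in> tight_class n r x" and v: "v < n"
    and a: "adj n r u v \<or> adj n r v u"
  shows "v \<in> tight_class n r x"
    and "longest n r n x v = longest n r n x u + longest n r n u v"
proof -
  have un: "u < n" and s: "longest n r n x u + longest n r n u x = 0"
    using u tight_class_sum[OF np x u] by (auto simp: tight_class_def)
  note g = longest_gt_if_sum_nonneg[OF x un] s
  have b: "longest n r n u v + longest n r n v u = 0" "longest n r n u v > -1 - int n"
    "longest n r n v u > -1 - int n"
    using a x by (auto simp: adj_def)
  have 1: "longest n r n x u + longest n r n u v \<le> longest n r n x v"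
    using longest_triangle[OF np x, of u v] g by auto
  have 2: "longest n r n v u + longest n r n u x \<le> longest n r n v x"
    using longest_triangle[OF np v, of u x] b by auto
  show v': "v \<in> tight_class n r x" using 1 2 b s v by (auto simp: tight_class_def)
  have "longest n r n x v + longest n r n v x = 0" using tight_class_sum[OF np x v'] .
  then show "longest n r n x v = longest n r n x u + longest n r n u v"
    using 1 2 b s by linarith
qed

lemma tight_class_tcon:
  assumes "no_positive n r" "x < n" "u \<in> tight_class n r x" "v < n" "tcon n r u v \<noteq> 0"
  shows "v \<in> tight_class n r x"
  using tight_class_adj(1)[OF assms(1-4)] assms(5) by (auto simp: tcon_def split: if_splits)

text \<open>The walks realizing the distances inside the class of \<open>x\<close> force all its centers.\<close>

lemma representation_types_ok:
  assumes np: "no_positive n r" and x: "x < n" and rep: "S_representation S X r I"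
    and sub: "tight_class n r x \<subseteq> X"
    and w: "\<And>y. y \<in> tight_class n r x \<Longrightarrow>
      (\<exists>xs. xs \<noteq> [] \<and> set xs \<subseteq> X \<and> successively (arc r) xs \<and> hd xs = x \<and> last xs = y \<and>
         walk_weight r xs = longest n r n x y) \<and>
      (\<exists>xs. xs \<noteq> [] \<and> set xs \<subseteq> X \<and> successively (arc r) xs \<and> hd xs = y \<and> last xs = x \<and>
         walk_weight r xs = longest n r n y x)"
  shows "types_ok n r (tight_class n r x) (\<lambda>y. itype (I y))"
proof -
  let ?K = "tight_class n r x"
  obtain h where h: "h > 0" "\<And>x. x \<in> X \<Longrightarrow> rend (I x) = center (I x) + h"
    using S_representation_half_length[OF rep] by blast
  note walk = S_representation_walk[OF rep h(2)]
  have pos: "center (I y) = center (I x) + h * real_of_int (longest n r n x y)" if y: "y \<in> ?K" for y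
  proof -
    have "center (I x) + h * real_of_int (longest n r n x y) \<le> center (I y)"
      using w[OF y] walk by fastforce
    moreover have "center (I y) + h * real_of_int (longest n r n y x) \<le> center (I x)"
      using w[OF y] walk by fastforce
    moreover have "longest n r n y x = - longest n r n x y" using tight_class_sum[OF np x y] by simp
    ultimately show ?thesis by simp
  qed
  have adj: "compatible (itype (I u)) (itype (I v)) \<longleftrightarrow> r u v"
    if u: "u \<in> ?K" and v: "v \<in> ?K" and a: "adj n r u v" for u v
  proof -
    have "v < n" using v by (auto simp: tight_class_def)
    then have "longest n r n x v = longest n r n x u + 1"
      using tight_class_adj(2)[OF np x u] a by (auto simp: adj_def)
    then have "center (I u) + h = center (I v)" using pos[OF u] pos[OF v] by (simp add: distrib_left)
    moreover have "r u v \<longleftrightarrow> interval_prec (I u) (I v)"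
      using rep subsetD[OF sub u] subsetD[OF sub v] by (auto simp: S_representation_def)
    ultimately show ?thesis using interval_prec_iff[OF h(2), of u "I v"] u sub by auto
  qed
  have "(tcon n r u v = 1 \<longrightarrow> compatible (itype (I u)) (itype (I v))) \<and>
      (tcon n r u v = 2 \<longrightarrow> \<not> compatible (itype (I u)) (itype (I v)))" if "u \<in> ?K" "v \<in> ?K" for u v
    using adj[OF that] adj[OF that(2,1)] compatible_commute[of "itype (I u)" "itype (I v)"]
    by (simp add: tcon_def)
  then show ?thesis unfolding types_ok_def by blast
qed

text \<open>Type B can be given to every element without incompatibility constraints, then type A to
  every element all of whose compatibility constraints are with B elements. Only C and D are
  possible for the remaining elements, where compatibility means equality.\<close>

definition beta :: "nat \<Rightarrow> (nat \<Rightarrow> nat \<Rightarrow> bool) \<Rightarrow> itype set \<Rightarrow> nat \<Rightarrow> bool" where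
  "beta n r S x \<longleftrightarrow> TB \<in> S \<and> (\<forall>y<n. tcon n r x y \<noteq> 2)"

definition alpha :: "nat \<Rightarrow> (nat \<Rightarrow> nat \<Rightarrow> bool) \<Rightarrow> itype set \<Rightarrow> nat \<Rightarrow> bool" where
  "alpha n r S x \<longleftrightarrow> TA \<in> S \<and> \<not> beta n r S x \<and> (\<forall>y<n. \<not> beta n r S y \<longrightarrow> tcon n r x y \<noteq> 1)"

definition rest :: "nat \<Rightarrow> (nat \<Rightarrow> nat \<Rightarrow> bool) \<Rightarrow> itype set \<Rightarrow> nat \<Rightarrow> bool" where
  "rest n r S x \<longleftrightarrow> \<not> beta n r S x \<and> \<not> alpha n r S x"

text \<open>The two colours stand for C and D. This is the balance condition of a signed graph:
  edges with \<open>tcon\<close> 1 demand equal colours, edges with \<open>tcon\<close> 2 different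
  ones.\<close>

definition valid_colouring ::
    "nat \<Rightarrow> (nat \<Rightarrow> nat \<Rightarrow> bool) \<Rightarrow> itype set \<Rightarrow> nat set \<Rightarrow> (nat \<Rightarrow> bool) \<Rightarrow> bool" where
  "valid_colouring n r S K f \<longleftrightarrow> (\<forall>x\<in>K. \<forall>y\<in>K.
     rest n r S x \<longrightarrow> rest n r S y \<longrightarrow> tcon n r x y \<noteq> 0 \<longrightarrow> (f x = f y) = (tcon n r x y = 1))"

text \<open>The last two branches concern remaining elements when \<open>S\<close> contains neither
  C nor D. No solution exists for such an element; the values given there only keep the result in
  \<open>S\<close>.\<close>

definition greedy :: "nat \<Rightarrow> (nat \<Rightarrow> nat \<Rightarrow> bool) \<Rightarrow> itype set \<Rightarrow> (nat \<Rightarrow> bool) \<Rightarrow> nat \<Rightarrow> itype" where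
  "greedy n r S col x =
     (if beta n r S x then TB else if alpha n r S x then TA
      else if TC \<in> S then (if TD \<in> S \<and> col x then TD else TC)
      else if TD \<in> S then TD else if TA \<in> S then TA else TB)"

lemma greedy_in:
  assumes "S \<noteq> {}"
  shows "greedy n r S col x \<in> S"
proof -
  obtain \<tau> where "\<tau> \<in> S" using assms by blast
  then have "TA \<in> S \<or> TB \<in> S \<or> TC \<in> S \<or> TD \<in> S" by (cases \<tau>) auto
  then show ?thesis by (auto simp: greedy_def beta_def alpha_def)
qed

text \<open>Exchange argument against an arbitrary solution \<open>f\<close>. Outside
  \<open>beta\<close>, either B is not in \<open>S\<close> or an incompatibility forbids it to
  \<open>f\<close>; on \<open>rest\<close>, A is likewise excluded by a compatibility with a partner
  that is not of type B. So \<open>f\<close> uses only C and D on \<open>rest\<close>, its D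
  elements form a valid colouring, and \<open>col\<close> agrees with that colouring on each
  constrained pair up to a swap, under which C and D behave alike.\<close>

lemma greedy_types_ok:
  assumes K: "K \<subseteq> {..<n}" "\<And>u v. u \<in> K \<Longrightarrow> v < n \<Longrightarrow> tcon n r u v \<noteq> 0 \<Longrightarrow> v \<in> K"
    and ok: "types_ok n r K f" and S: "\<And>x. x \<in> K \<Longrightarrow> f x \<in> S"
    and col: "\<And>g x y. valid_colouring n r S K g \<Longrightarrow> x \<in> K \<Longrightarrow> y \<in> K \<Longrightarrow> rest n r S x \<Longrightarrow>
      rest n r S y \<Longrightarrow> tcon n r x y \<noteq> 0 \<Longrightarrow> (col x = col y) = (g x = g y)"
  shows "types_ok n r K (greedy n r S col)"
proof -
  have nB: "f x \<noteq> TB" if x: "x \<in> K" "\<not> beta n r S x" for x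
  proof
    assume fB: "f x = TB"
    have "TB \<in> S" using S x(1) fB by metis
    then obtain y where y: "y < n" "tcon n r x y = 2" using x(2) by (auto simp: beta_def)
    then have "y \<in> K" using K(2)[OF x(1)] by auto
    then show False using types_okD(2)[OF ok x(1)] y fB by (auto simp: compatible_def)
  qed
  have CD: "f x = TC \<or> f x = TD" if x: "x \<in> K" "rest n r S x" for x
  proof -
    have "f x \<noteq> TA"
    proof
      assume fA: "f x = TA"
      have "TA \<in> S" using S x(1) fA by metis
      then obtain y where y: "y < n" "tcon n r x y = 1" "\<not> beta n r S y"
        using x(2) by (auto simp: rest_def alpha_def)
      then have "y \<in> K" using K(2)[OF x(1)] by auto
      then show False using types_okD(1)[OF ok x(1)] fA nB[of y] y by (auto simp: compatible_def)
    qed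
    then show ?thesis using nB[OF x(1)] x(2) by (cases "f x") (auto simp: rest_def)
  qed
  have g: "greedy n r S col x = (if TC \<in> S then if TD \<in> S \<and> col x then TD else TC else TD)"
    if x: "x \<in> K" "rest n r S x" for x
    using CD[OF x] S[OF x(1)] x(2) by (auto simp: greedy_def rest_def)
  have valid: "valid_colouring n r S K (\<lambda>x. f x = TD)"
    unfolding valid_colouring_def
  proof (intro ballI impI)
    fix x y assume xy: "x \<in> K" "y \<in> K" "rest n r S x" "rest n r S y" "tcon n r x y \<noteq> 0"
    have "tcon n r x y = 1 \<or> tcon n r x y = 2" using xy(5) by (auto simp: tcon_def split: if_splits)
    then show "((f x = TD) = (f y = TD)) = (tcon n r x y = 1)"
      using types_okD[OF ok xy(1,2)] CD[OF xy(1,3)] CD[OF xy(2,4)] by (auto simp: compatible_def)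
  qed
  note col' = col[OF valid]
  have "compatible (greedy n r S col x) (greedy n r S col y)"
    if xy: "x \<in> K" "y \<in> K" "tcon n r x y = 1" for x y
  proof (cases "beta n r S x \<or> beta n r S y")
    case True then show ?thesis by (auto simp: greedy_def compatible_def)
  next
    case False
    moreover have "x < n" "y < n" "tcon n r y x = 1"
      using xy K(1) tcon_commute[of n r x y] by auto
    ultimately have rest: "rest n r S x" "rest n r S y"
      using xy(3) unfolding rest_def alpha_def by blast+
    have c: "compatible (f x) (f y)" using types_okD[OF ok xy(1,2)] xy(3) by blast
    then have "f x = f y" using CD[OF xy(1) rest(1)] CD[OF xy(2) rest(2)] by (auto simp: compatible_def)
    then have "col x = col y" using col'[OF xy(1,2) rest] xy(3) by auto
    then show ?thesis using g[OF xy(1) rest(1)] g[OF xy(2) rest(2)]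
      by (auto simp: compatible_def split: if_splits)
  qed
  moreover have "\<not> compatible (greedy n r S col x) (greedy n r S col y)"
    if xy: "x \<in> K" "y \<in> K" "tcon n r x y = 2" for x y
  proof -
    have "x < n" "y < n" "tcon n r y x = 2"
      using xy K(1) tcon_commute[of n r x y] by auto
    then have nb: "\<not> beta n r S x" "\<not> beta n r S y"
      using xy(3) unfolding beta_def by blast+
    \<comment> \<open>The fallback to \<open>TB\<close> needs \<open>S\<close> without C and D,
      which \<open>g\<close> excludes: \<open>f\<close> already places C or D on every remaining
      element.\<close>
    have nB': "greedy n r S col z \<noteq> TB" if "z \<in> K" "\<not> beta n r S z" for z
      using g[of z] that by (cases "rest n r S z") (auto simp: rest_def greedy_def split: if_splits)
    show ?thesis
    proof (cases "alpha n r S x \<or> alpha n r S y")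
      case True
      then have "greedy n r S col x = TA \<or> greedy n r S col y = TA" using nb by (auto simp: greedy_def)
      then show ?thesis using nB'[of x] nB'[of y] xy nb by (auto simp: compatible_def)
    next
      case False
      then have rest: "rest n r S x" "rest n r S y" using nb by (auto simp: rest_def)
      have "\<not> compatible (f x) (f y)" using types_okD[OF ok xy(1,2)] xy(3) by blast
      then have f: "(f x = TC \<and> f y = TD) \<or> (f x = TD \<and> f y = TC)"
        using CD[OF xy(1) rest(1)] CD[OF xy(2) rest(2)] by (auto simp: compatible_def)
      then have "col x \<noteq> col y" using col'[OF xy(1,2) rest] xy(3) by auto
      moreover have "TC \<in> S" "TD \<in> S" using f S[OF xy(1)] S[OF xy(2)] by auto
      moreover have "greedy n r S col x = (if col x then TD else TC)"
        "greedy n r S col y = (if col y then TD else TC)"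
        unfolding g[OF xy(1) rest(1)] g[OF xy(2) rest(2)] using \<open>TC \<in> S\<close> \<open>TD \<in> S\<close> by simp_all
      ultimately show ?thesis by (cases "col x") (simp_all add: compatible_def)
    qed
  qed
  ultimately show ?thesis unfolding types_ok_def by blast
qed

section \<open>Loop programs and their cost\<close>

lemma bits_pos: "1 \<le> bits k"
  by (simp add: bits_def)

lemma bits_le_iff: "bits k \<le> Suc w \<longleftrightarrow> nat \<bar>k\<bar> < 2 ^ w"
  by (simp add: bits_def floorlog_le_iff)

lemma abs_less_bits: "nat \<bar>k\<bar> < 2 ^ (bits k - 1)"
  using bits_le_iff[of k "bits k - 1"] bits_pos[of k] by simp

lemma bits_mono: "\<bar>a\<bar> \<le> \<bar>b\<bar> \<Longrightarrow> bits a \<le> bits b"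
  by (simp add: bits_def floorlog_mono nat_mono)

lemma bits_uminus: "bits (- k) = bits k"
  by (simp add: bits_def)

lemma bits_add: "bits (a + b) \<le> bits a + bits b"
proof -
  obtain u v where u: "bits a = Suc u" and v: "bits b = Suc v"
    using bits_pos[of a] bits_pos[of b] by (metis Suc_le_D One_nat_def)
  have "nat \<bar>a + b\<bar> \<le> nat \<bar>a\<bar> + nat \<bar>b\<bar>" by linarith
  also have "\<dots> < 2 ^ u + 2 ^ v"
    by (rule add_strict_mono) (metis abs_less_bits u diff_Suc_1, metis abs_less_bits v diff_Suc_1)
  also have "\<dots> \<le> 2 ^ Suc (u + v)"
  proof -
    have "(2::nat) ^ u \<le> 2 ^ (u + v)" "(2::nat) ^ v \<le> 2 ^ (u + v)"
      by (rule power_increasing; simp)+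
    then show ?thesis unfolding power_Suc by linarith
  qed
  finally show ?thesis using bits_le_iff[of "a + b" "Suc (u + v)"] u v by simp
qed

lemma bits_diff: "bits (a - b) \<le> bits a + bits b"
  using bits_add[of a "- b"] by (simp add: bits_uminus)

lemma bits_mult: "bits (a * b) \<le> bits a + bits b"
proof -
  obtain u v where u: "bits a = Suc u" and v: "bits b = Suc v"
    using bits_pos[of a] bits_pos[of b] by (metis Suc_le_D One_nat_def)
  have "nat \<bar>a * b\<bar> = nat \<bar>a\<bar> * nat \<bar>b\<bar>" by (simp add: abs_mult nat_mult_distrib)
  also have "\<dots> < 2 ^ u * 2 ^ v"
    by (rule mult_strict_mono)
      (metis abs_less_bits u diff_Suc_1, metis abs_less_bits v diff_Suc_1, simp_all)
  finally have "nat \<bar>a * b\<bar> < 2 ^ (u + v)" by (simp add: power_add)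
  then have "bits (a * b) \<le> Suc (u + v)" by (simp add: bits_le_iff)
  then show ?thesis using u v by simp
qed

section \<open>Cost of expressions in bounded states\<close>

definition bounded_state :: "nat \<Rightarrow> state \<Rightarrow> bool" where
  "bounded_state M s \<longleftrightarrow> (\<forall>x. \<bar>vars s x\<bar> \<le> int M) \<and> (\<forall>a i. \<bar>arrs s a i\<bar> \<le> int M)"

lemma bounded_state_mono: "bounded_state M s \<Longrightarrow> M \<le> M' \<Longrightarrow> bounded_state M' s"
  unfolding bounded_state_def by (meson of_nat_mono order_trans)

text \<open>Length of a value in multiples of \<open>bits (int B)\<close>, when \<open>B\<close>
  bounds the memory. A loaded array entry counts once, however long its index expression is.\<close>

fun bits_factor :: "aexp \<Rightarrow> nat" where
  "bits_factor (Const k) = bits k"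
| "bits_factor (Var x) = 1"
| "bits_factor (Elem a e) = 1"
| "bits_factor (Plus e f) = bits_factor e + bits_factor f"
| "bits_factor (Minus e f) = bits_factor e + bits_factor f"
| "bits_factor (Times e f) = bits_factor e + bits_factor f"

text \<open>Cost in multiples of the squared length \<open>(bits (int B))^2\<close>. Schoolbook
  multiplication forces the square; linear costs are rounded up to it.\<close>

fun acost_factor :: "aexp \<Rightarrow> nat" where
  "acost_factor (Const k) = bits k"
| "acost_factor (Var x) = 1"
| "acost_factor (Elem a e) = acost_factor e + bits_factor e + 1"
| "acost_factor (Plus e f) = acost_factor e + acost_factor f + bits_factor e + bits_factor f"
| "acost_factor (Minus e f) = acost_factor e + acost_factor f + bits_factor e + bits_factor f"
| "acost_factor (Times e f) = acost_factor e + acost_factor f + bits_factor e * bits_factor f"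

fun bcost_factor :: "bexp \<Rightarrow> nat" where
  "bcost_factor (Less e f) = acost_factor e + acost_factor f + bits_factor e + bits_factor f"
| "bcost_factor (Equal e f) = acost_factor e + acost_factor f + bits_factor e + bits_factor f"
| "bcost_factor (Neg b) = bcost_factor b + 1"
| "bcost_factor (And b c) = bcost_factor b + bcost_factor c + 1"

lemma bits_var: "bounded_state B s \<Longrightarrow> bits (vars s x) \<le> bits (int B)"
  by (rule bits_mono) (auto simp: bounded_state_def)

lemma bits_arr: "bounded_state B s \<Longrightarrow> bits (arrs s a i) \<le> bits (int B)"
  by (rule bits_mono) (auto simp: bounded_state_def)

lemma bits_aval: "bounded_state B s \<Longrightarrow> bits (aval e s) \<le> bits_factor e * bits (int B)"
proof (induction e)
  case (Const k)
  show ?case using bits_pos[of "int B"] by simp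
next
  case (Plus e f)
  then show ?case using bits_add[of "aval e s" "aval f s"] by (simp add: add_mult_distrib)
next
  case (Minus e f)
  then show ?case using bits_diff[of "aval e s" "aval f s"] by (simp add: add_mult_distrib)
next
  case (Times e f)
  then show ?case using bits_mult[of "aval e s" "aval f s"] by (simp add: add_mult_distrib)
qed (auto intro: bits_var bits_arr)

lemma le_mult_bits_sq: "x \<le> c * bits (int B) \<Longrightarrow> x \<le> c * (bits (int B))\<^sup>2"
proof -
  assume "x \<le> c * bits (int B)"
  also have "\<dots> \<le> c * (bits (int B))\<^sup>2"
    using bits_pos[of "int B"] by (simp add: power2_eq_square)
  finally show ?thesis .
qed

lemma bits_sq_pos: "1 \<le> (bits (int B))\<^sup>2"
  using le_mult_bits_sq[of 1 1 B] bits_pos[of "int B"] by simp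

lemma bits_aval_sq: "bounded_state B s \<Longrightarrow> bits (aval e s) \<le> bits_factor e * (bits (int B))\<^sup>2"
  by (intro le_mult_bits_sq bits_aval)

lemma acost_le: "bounded_state B s \<Longrightarrow> acost e s \<le> acost_factor e * (bits (int B))\<^sup>2"
proof (induction e)
  case (Const k)
  show ?case using bits_pos[of "int B"] by (simp add: power2_eq_square)
next
  case (Var x)
  then show ?case using le_mult_bits_sq[of _ 1 B] bits_var[of B s x] by simp
next
  case (Elem a e)
  then show ?case
    using le_mult_bits_sq[of _ 1 B] bits_arr[of B s a "aval e s"] bits_aval_sq[of B s e]
    by (fastforce simp: add_mult_distrib)
next
  case (Plus e f)
  then show ?case using bits_aval_sq[of B s e] bits_aval_sq[of B s f] by (simp add: add_mult_distrib)
next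
  case (Minus e f)
  then show ?case using bits_aval_sq[of B s e] bits_aval_sq[of B s f] by (simp add: add_mult_distrib)
next
  case (Times e f)
  have "bits (aval e s) * bits (aval f s) \<le>
      (bits_factor e * bits (int B)) * (bits_factor f * bits (int B))"
    using Times.prems by (intro mult_le_mono bits_aval)
  also have "\<dots> = bits_factor e * bits_factor f * (bits (int B))\<^sup>2"
    by (simp add: power2_eq_square mult_ac)
  finally show ?case using Times by (simp add: add_mult_distrib)
qed

lemma bcost_le: "bounded_state B s \<Longrightarrow> bcost b s \<le> bcost_factor b * (bits (int B))\<^sup>2"
proof (induction b)
  case (Less e f)
  then show ?case
    using bits_aval_sq[of B s e] bits_aval_sq[of B s f] acost_le[of B s e] acost_le[of B s f]
    by (simp add: add_mult_distrib)
next
  case (Equal e f)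
  then show ?case
    using bits_aval_sq[of B s e] bits_aval_sq[of B s f] acost_le[of B s e] acost_le[of B s f]
    by (simp add: add_mult_distrib)
next
  case (Neg b)
  then show ?case using bits_sq_pos[of B] by (simp add: add_mult_distrib)
next
  case (And b c)
  then show ?case using bits_sq_pos[of B] by (simp add: add_mult_distrib)
qed

text \<open>Programs with counted loops only have a total semantics, and the exponent of their running
  time is the nesting depth of the loops.\<close>

datatype lprog =
    LSkip
  | LAssign string aexp
  | LUpdate string aexp aexp
  | LSeq lprog lprog
  | LCond bexp lprog lprog
  | LFor string string lprog

fun compile :: "lprog \<Rightarrow> com" where
  "compile LSkip = Skip"
| "compile (LAssign x e) = Assign x e"
| "compile (LUpdate a i e) = Update a i e"
| "compile (LSeq p q) = Seq (compile p) (compile q)"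
| "compile (LCond b p q) = Cond b (compile p) (compile q)"
| "compile (LFor i v p) = Seq (Assign i (Const 0))
     (While (Less (Var i) (Var v)) (Seq (compile p) (Assign i (Plus (Var i) (Const 1)))))"

section \<open>Functional semantics of loop programs\<close>

definition set_var :: "string \<Rightarrow> int \<Rightarrow> state \<Rightarrow> state" where
  "set_var x k s = s\<lparr>vars := (vars s)(x := k)\<rparr>"

definition set_arr :: "string \<Rightarrow> int \<Rightarrow> int \<Rightarrow> state \<Rightarrow> state" where
  "set_arr a i k s = s\<lparr>arrs := (arrs s)(a := (arrs s a)(i := k))\<rparr>"

lemma set_var_simps [simp]:
  "vars (set_var x k s) y = (if y = x then k else vars s y)"
  "arrs (set_var x k s) = arrs s"
  by (auto simp: set_var_def)

lemma set_arr_simps [simp]: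
  "vars (set_arr a i k s) = vars s"
  "arrs (set_arr a i k s) b j = (if b = a \<and> j = i then k else arrs s b j)"
  by (auto simp: set_arr_def)

lemma arrs_set_arr_other [simp]: "b \<noteq> a \<Longrightarrow> arrs (set_arr a i k s) b = arrs s b"
  by (simp add: set_arr_def)

text \<open>A loop fixes its number of rounds on entry. For the compiled \<open>While\<close> to
  agree, the body must change neither the bound nor the counter, which \<open>well_formed\<close>
  ensures.\<close>

fun sem :: "lprog \<Rightarrow> state \<Rightarrow> state" where
  "sem LSkip s = s"
| "sem (LAssign x e) s = set_var x (aval e s) s"
| "sem (LUpdate a i e) s = set_arr a (aval i s) (aval e s) s"
| "sem (LSeq p q) s = sem q (sem p s)"
| "sem (LCond b p q) s = (if bval b s then sem p s else sem q s)"
| "sem (LFor i v p) s =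
     ((\<lambda>s. set_var i (vars (sem p s) i + 1) (sem p s)) ^^ nat (vars s v)) (set_var i 0 s)"

fun wvars :: "lprog \<Rightarrow> string set" where
  "wvars LSkip = {}"
| "wvars (LAssign x e) = {x}"
| "wvars (LUpdate a i e) = {}"
| "wvars (LSeq p q) = wvars p \<union> wvars q"
| "wvars (LCond b p q) = wvars p \<union> wvars q"
| "wvars (LFor i v p) = insert i (wvars p)"

fun warrs :: "lprog \<Rightarrow> string set" where
  "warrs LSkip = {}"
| "warrs (LAssign x e) = {}"
| "warrs (LUpdate a i e) = {a}"
| "warrs (LSeq p q) = warrs p \<union> warrs q"
| "warrs (LCond b p q) = warrs p \<union> warrs q"
| "warrs (LFor i v p) = warrs p"

lemma vars_sem: "x \<notin> wvars p \<Longrightarrow> vars (sem p s) x = vars s x"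
proof (induction p arbitrary: s)
  case (LFor i v p)
  have "vars (((\<lambda>s. set_var i (vars (sem p s) i + 1) (sem p s)) ^^ k) t) x = vars t x" for k t
    by (induction k) (use LFor in auto)
  with LFor.prems show ?case by simp
qed auto

lemma arrs_sem: "a \<notin> warrs p \<Longrightarrow> arrs (sem p s) a = arrs s a"
proof (induction p arbitrary: s)
  case (LFor i v p)
  have "arrs (((\<lambda>s. set_var i (vars (sem p s) i + 1) (sem p s)) ^^ k) t) a = arrs t a" for k t
    by (induction k) (use LFor in auto)
  with LFor.prems show ?case by simp
qed auto

text \<open>Right-hand sides whose value exceeds the largest stored number only by a multiple of \<open>n\<close>.
  This keeps the stored numbers polynomially bounded by the number of steps.\<close>

fun additive :: "aexp \<Rightarrow> bool" where
  "additive (Plus e (Const k)) = additive e"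
| "additive (Minus e (Const k)) = additive e"
| "additive (Plus e (Var x)) = (x = ''n'' \<and> additive e)"
| "additive (Minus e (Var x)) = (x = ''n'' \<and> additive e)"
| "additive (Const k) = True"
| "additive (Var x) = True"
| "additive (Elem a e) = True"
| "additive _ = False"

text \<open>Coefficient of a bound \<open>N \<ge> 1\<close> on the absolute value of
  \<open>n\<close>: every occurrence of \<open>n\<close> counts 1, and a constant \<open>k\<close>
  counts its absolute value, as it is at most that many times \<open>N\<close>.\<close>

fun growth :: "aexp \<Rightarrow> nat" where
  "growth (Plus e (Const k)) = growth e + nat \<bar>k\<bar>"
| "growth (Minus e (Const k)) = growth e + nat \<bar>k\<bar>"
| "growth (Plus e (Var x)) = growth e + 1"
| "growth (Minus e (Var x)) = growth e + 1"
| "growth (Const k) = nat \<bar>k\<bar>"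
| "growth _ = 0"

lemma additive_bound:
  assumes "additive e" "bounded_state M s" "\<bar>vars s ''n''\<bar> \<le> int N" "1 \<le> N"
  shows "\<bar>aval e s\<bar> \<le> int (M + growth e * N)"
  using assms
proof (induction e rule: growth.induct)
  case (1 e k)
  have "\<bar>k\<bar> \<le> \<bar>k\<bar> * int N" using 1 by (simp add: mult_le_cancel_left1)
  then show ?case using 1 by (simp add: distrib_right)
next
  case (2 e k)
  have "\<bar>k\<bar> \<le> \<bar>k\<bar> * int N" using 2 by (simp add: mult_le_cancel_left1)
  then show ?case using 2 by (simp add: distrib_right)
next
  case (5 k)
  have "\<bar>k\<bar> \<le> \<bar>k\<bar> * int N" using 5 by (simp add: mult_le_cancel_left1)
  then show ?case by simp
qed (auto simp: bounded_state_def distrib_right)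

fun growth_bound :: "lprog \<Rightarrow> nat" where
  "growth_bound LSkip = 0"
| "growth_bound (LAssign x e) = growth e"
| "growth_bound (LUpdate a i e) = growth e"
| "growth_bound (LSeq p q) = max (growth_bound p) (growth_bound q)"
| "growth_bound (LCond b p q) = max (growth_bound p) (growth_bound q)"
| "growth_bound (LFor i v p) = max 1 (growth_bound p)"

text \<open>Both possible loop bounds, \<open>n\<close> and \<open>m\<close>, are read-only, so a
  single number \<open>N\<close> bounds the rounds of all loops.\<close>

fun well_formed :: "lprog \<Rightarrow> bool" where
  "well_formed LSkip = True"
| "well_formed (LAssign x e) = (x \<noteq> ''n'' \<and> x \<noteq> ''m'' \<and> additive e)"
| "well_formed (LUpdate a i e) = additive e"
| "well_formed (LSeq p q) = (well_formed p \<and> well_formed q)"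
| "well_formed (LCond b p q) = (well_formed p \<and> well_formed q)"
| "well_formed (LFor i v p) = ((v = ''n'' \<or> v = ''m'') \<and> i \<noteq> ''n'' \<and> i \<noteq> ''m'' \<and>
     i \<notin> wvars p \<and> well_formed p)"

lemma well_formed_wvars: "well_formed p \<Longrightarrow> ''n'' \<notin> wvars p \<and> ''m'' \<notin> wvars p"
  by (induction p) auto

text \<open>Time in units of the squared number length. The constant 20 leaves room for the test and
  the increment of each round, and the extra round in \<open>N + 1\<close> pays for the
  initialisation and the last test.\<close>

fun steps :: "nat \<Rightarrow> lprog \<Rightarrow> nat" where
  "steps N LSkip = 1"
| "steps N (LAssign x e) = acost_factor e + bits_factor e"
| "steps N (LUpdate a i e) = acost_factor i + acost_factor e + bits_factor i + bits_factor e"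
| "steps N (LSeq p q) = steps N p + steps N q"
| "steps N (LCond b p q) = bcost_factor b + 1 + steps N p + steps N q"
| "steps N (LFor i v p) = (N + 1) * (steps N p + 20)"

section \<open>Growth of the stored numbers and execution cost\<close>

lemma bits_factor_pos: "1 \<le> bits_factor e"
proof (induction e)
  case (Const k)
  show ?case using bits_pos[of k] by simp
qed auto

lemma bounded_state_set_var:
  "bounded_state M s \<Longrightarrow> \<bar>k\<bar> \<le> int M \<Longrightarrow> bounded_state M (set_var x k s)"
  by (auto simp: bounded_state_def)

lemma bounded_state_set_arr:
  "bounded_state M s \<Longrightarrow> \<bar>k\<bar> \<le> int M \<Longrightarrow> bounded_state M (set_arr a i k s)"
  by (auto simp: bounded_state_def)

lemma for_vars:
  assumes "well_formed (LFor i v p)"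
  defines "g \<equiv> \<lambda>s. set_var i (vars (sem p s) i + 1) (sem p s)"
  shows "vars ((g ^^ k) (set_var i 0 s)) i = int k"
    and "x \<notin> wvars (LFor i v p) \<Longrightarrow> vars ((g ^^ k) (set_var i 0 s)) x = vars s x"
proof -
  show "vars ((g ^^ k) (set_var i 0 s)) i = int k"
    by (induction k) (use assms(1) in \<open>auto simp: g_def vars_sem\<close>)
  show "x \<notin> wvars (LFor i v p) \<Longrightarrow> vars ((g ^^ k) (set_var i 0 s)) x = vars s x"
    by (induction k) (auto simp: g_def vars_sem)
qed

text \<open>Stated for every number \<open>k\<close> of rounds, since the cost analysis needs the
  bound in the middle of a loop and not only at its end.\<close>

lemma bounded_for:
  assumes wf: "well_formed (LFor i v p)"
    and body: "\<And>M s. bounded_state M s \<Longrightarrow> \<bar>vars s ''n''\<bar> \<le> int N \<Longrightarrow> \<bar>vars s ''m''\<bar> \<le> int N \<Longrightarrow>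
      bounded_state (M + G * steps N p) (sem p s)"
    and N: "1 \<le> N" "N \<le> G" and s: "bounded_state M s"
      "\<bar>vars s ''n''\<bar> \<le> int N" "\<bar>vars s ''m''\<bar> \<le> int N"
  shows "bounded_state (M + G * (k * (steps N p + 1)))
    (((\<lambda>s. set_var i (vars (sem p s) i + 1) (sem p s)) ^^ k) (set_var i 0 s))"
    (is "bounded_state _ ((?g ^^ k) _)")
proof (induction k)
  case 0
  then show ?case using s(1) by (auto intro: bounded_state_set_var)
next
  case (Suc k)
  let ?s = "(?g ^^ k) (set_var i 0 s)"
  have nm: "vars ?s ''n'' = vars s ''n''" "vars ?s ''m'' = vars s ''m''"
    using well_formed_wvars[OF wf] by (auto simp: for_vars[OF wf])
  have b: "bounded_state (M + G * (k * (steps N p + 1)) + G * steps N p) (sem p ?s)"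
    using s Suc nm by (intro body) auto
  have "\<bar>vars (sem p ?s) i\<bar> \<le> int (M + G * (k * (steps N p + 1)) + G * steps N p)"
    using b by (simp add: bounded_state_def)
  then have "\<bar>vars (sem p ?s) i + 1\<bar> \<le> int (M + G * (Suc k * (steps N p + 1)))"
    using N by (simp add: algebra_simps)
  moreover have "bounded_state (M + G * (Suc k * (steps N p + 1))) (sem p ?s)"
    by (rule bounded_state_mono[OF b]) (simp add: algebra_simps)
  ultimately show ?case by (simp del: mult_Suc add: bounded_state_set_var)
qed

text \<open>One assignment raises the largest stored number by at most \<open>G\<close>, and
  \<open>steps\<close> also bounds the number of assignments.\<close>

lemma bounded_sem:
  assumes "well_formed p" "bounded_state M s" "1 \<le> N" "growth_bound p * N \<le> G"
    "\<bar>vars s ''n''\<bar> \<le> int N" "\<bar>vars s ''m''\<bar> \<le> int N"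
  shows "bounded_state (M + G * steps N p) (sem p s)"
  using assms
proof (induction p arbitrary: s M)
  case LSkip
  then show ?case by (auto intro: bounded_state_mono)
next
  case (LAssign x e)
  have "G * 1 \<le> G * steps N (LAssign x e)"
    using bits_factor_pos[of e] by (intro mult_le_mono) auto
  moreover have "\<bar>aval e s\<bar> \<le> int (M + growth e * N)" using LAssign by (intro additive_bound) auto
  moreover have "growth e * N \<le> G" using LAssign by simp
  ultimately have le: "\<bar>aval e s\<bar> \<le> int (M + G * steps N (LAssign x e))" by linarith
  show ?case unfolding sem.simps
    by (rule bounded_state_set_var[OF bounded_state_mono[OF LAssign.prems(2)] le]) simp
next
  case (LUpdate a i e)
  have "G * 1 \<le> G * steps N (LUpdate a i e)"
    using bits_factor_pos[of e] by (intro mult_le_mono) auto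
  moreover have "\<bar>aval e s\<bar> \<le> int (M + growth e * N)" using LUpdate by (intro additive_bound) auto
  moreover have "growth e * N \<le> G" using LUpdate by simp
  ultimately have le: "\<bar>aval e s\<bar> \<le> int (M + G * steps N (LUpdate a i e))" by linarith
  show ?case unfolding sem.simps
    by (rule bounded_state_set_arr[OF bounded_state_mono[OF LUpdate.prems(2)] le]) simp
next
  case (LSeq p q)
  have g: "growth_bound p * N \<le> G" "growth_bound q * N \<le> G"
    using order_trans[OF mult_le_mono1[OF max.cobounded1] LSeq.prems(4)[unfolded growth_bound.simps]]
      order_trans[OF mult_le_mono1[OF max.cobounded2] LSeq.prems(4)[unfolded growth_bound.simps]] .
  have "bounded_state (M + G * steps N p) (sem p s)"
    using LSeq.prems g by (intro LSeq.IH(1)) auto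
  moreover have "vars (sem p s) ''n'' = vars s ''n''" "vars (sem p s) ''m'' = vars s ''m''"
    using LSeq.prems(1) well_formed_wvars[of p] by (auto simp: vars_sem)
  ultimately have "bounded_state (M + G * steps N p + G * steps N q) (sem q (sem p s))"
    using LSeq.prems g by (intro LSeq.IH(2)) auto
  then show ?case by (simp add: distrib_left add.assoc)
next
  case (LCond b p q)
  have g: "growth_bound p * N \<le> G" "growth_bound q * N \<le> G"
    using order_trans[OF mult_le_mono1[OF max.cobounded1] LCond.prems(4)[unfolded growth_bound.simps]]
      order_trans[OF mult_le_mono1[OF max.cobounded2] LCond.prems(4)[unfolded growth_bound.simps]] .
  have "bounded_state (M + G * steps N p) (sem p s)" "bounded_state (M + G * steps N q) (sem q s)"
    using LCond.prems g LCond.IH by auto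
  then show ?case by (auto elim!: bounded_state_mono simp: distrib_left)
next
  case (LFor i v p)
  have g: "growth_bound p * N \<le> G" "N \<le> G"
    using order_trans[OF mult_le_mono1[OF max.cobounded2] LFor.prems(4)[unfolded growth_bound.simps]]
      order_trans[OF mult_le_mono1[OF max.cobounded1] LFor.prems(4)[unfolded growth_bound.simps]]
    by simp_all
  have *: "bounded_state (M + G * (k * (steps N p + 1)))
      (((\<lambda>s. set_var i (vars (sem p s) i + 1) (sem p s)) ^^ k) (set_var i 0 s))" for k
    using LFor g by (intro bounded_for) auto
  have "nat (vars s v) \<le> N" using LFor.prems by auto
  then have "nat (vars s v) * (steps N p + 1) \<le> (N + 1) * (steps N p + 20)"
    by (intro mult_le_mono) auto
  then have "M + G * (nat (vars s v) * (steps N p + 1)) \<le> M + G * steps N (LFor i v p)"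
    by simp
  with * show ?case unfolding sem.simps by (rule bounded_state_mono)
qed

lemma bits_0_1: "bits 0 = 1" "bits 1 = 2"
  by (simp_all add: bits_def floorlog_def)

text \<open>The bound \<open>B\<close> dominates the numbers in all intermediate states, so every
  operation is charged at the length of \<open>B\<close> and the cost no longer depends on the
  state.\<close>

lemma exec_compile:
  assumes "well_formed p" "bounded_state M s" "1 \<le> N" "growth_bound p * N \<le> G"
    "\<bar>vars s ''n''\<bar> \<le> int N" "\<bar>vars s ''m''\<bar> \<le> int N" "M + G * steps N p \<le> B"
  shows "\<exists>t. exec (compile p) s t (sem p s) \<and> t \<le> steps N p * (bits (int B))\<^sup>2"
  using assms
proof (induction p arbitrary: s M)
  case LSkip
  then show ?case using exec.Skip bits_sq_pos[of B] by fastforce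
next
  case (LAssign x e)
  have b: "bounded_state B s" using LAssign.prems by (auto elim: bounded_state_mono)
  have "acost e s + bits (aval e s) \<le> steps N (LAssign x e) * (bits (int B))\<^sup>2"
    using acost_le[OF b, of e] bits_aval_sq[OF b, of e] by (simp add: add_mult_distrib)
  then show ?case using exec.Assign[of x e s] by (auto simp: set_var_def)
next
  case (LUpdate a i e)
  have b: "bounded_state B s" using LUpdate.prems by (auto elim: bounded_state_mono)
  have "acost i s + acost e s + bits (aval i s) + bits (aval e s)
      \<le> steps N (LUpdate a i e) * (bits (int B))\<^sup>2"
    using acost_le[OF b, of e] bits_aval_sq[OF b, of e] acost_le[OF b, of i] bits_aval_sq[OF b, of i]
    by (simp add: add_mult_distrib)
  then show ?case using exec.Update[of a i e s] by (auto simp: set_arr_def)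
next
  case (LSeq p q)
  have g: "growth_bound p * N \<le> G" "growth_bound q * N \<le> G"
    using order_trans[OF mult_le_mono1[OF max.cobounded1] LSeq.prems(4)[unfolded growth_bound.simps]]
      order_trans[OF mult_le_mono1[OF max.cobounded2] LSeq.prems(4)[unfolded growth_bound.simps]] .
  have B: "M + G * steps N p + G * steps N q \<le> B"
    using LSeq.prems(7) by (simp add: distrib_left)
  obtain t where t: "exec (compile p) s t (sem p s)" "t \<le> steps N p * (bits (int B))\<^sup>2"
    using LSeq.IH(1)[of M s] LSeq.prems g B by auto
  have "bounded_state (M + G * steps N p) (sem p s)"
    using LSeq.prems g by (intro bounded_sem) auto
  moreover have "vars (sem p s) ''n'' = vars s ''n''" "vars (sem p s) ''m'' = vars s ''m''"
    using LSeq.prems(1) well_formed_wvars[of p] by (auto simp: vars_sem)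
  ultimately obtain u where "exec (compile q) (sem p s) u (sem q (sem p s))"
      "u \<le> steps N q * (bits (int B))\<^sup>2"
    using LSeq.IH(2)[of "M + G * steps N p" "sem p s"] LSeq.prems g B by auto
  then show ?case using exec.Seq[OF t(1)] t(2)
    by (intro exI[of _ "t + u"]) (auto simp: add_mult_distrib)
next
  case (LCond b p q)
  have g: "growth_bound p * N \<le> G" "growth_bound q * N \<le> G"
    using order_trans[OF mult_le_mono1[OF max.cobounded1] LCond.prems(4)[unfolded growth_bound.simps]]
      order_trans[OF mult_le_mono1[OF max.cobounded2] LCond.prems(4)[unfolded growth_bound.simps]] .
  have B: "M + G * steps N p \<le> B" "M + G * steps N q \<le> B" "M \<le> B"
    using LCond.prems(7) by (simp_all add: distrib_left)
  have b: "bcost b s \<le> bcost_factor b * (bits (int B))\<^sup>2"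
    using LCond.prems B by (intro bcost_le) (auto elim: bounded_state_mono)
  obtain t where t: "exec (compile p) s t (sem p s)" "t \<le> steps N p * (bits (int B))\<^sup>2"
    using LCond.IH(1)[of M s] LCond.prems g B by auto
  obtain u where u: "exec (compile q) s u (sem q s)" "u \<le> steps N q * (bits (int B))\<^sup>2"
    using LCond.IH(2)[of M s] LCond.prems g B by auto
  show ?case
  proof (cases "bval b s")
    case True
    then show ?thesis using exec.CondTrue[OF True t(1)] b t(2) bits_sq_pos[of B]
      by (intro exI[of _ "bcost b s + 1 + t"]) (auto simp: add_mult_distrib)
  next
    case False
    then show ?thesis using exec.CondFalse[OF False u(1)] b u(2) bits_sq_pos[of B]
      by (intro exI[of _ "bcost b s + 1 + u"]) (auto simp: add_mult_distrib)
  qed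
next
  case (LFor i v p)
  let ?g = "\<lambda>s. set_var i (vars (sem p s) i + 1) (sem p s)"
  let ?Q = "(bits (int B))\<^sup>2" and ?T = "steps N p"
  let ?test = "Less (Var i) (Var v)" and ?incr = "Plus (Var i) (Const 1)"
  let ?while = "While ?test (Seq (compile p) (Assign i ?incr))"
  define m where "m = nat (vars s v)"
  define st where "st k = (?g ^^ k) (set_var i 0 s)" for k
  have g: "growth_bound p * N \<le> G" "N \<le> G"
    using order_trans[OF mult_le_mono1[OF max.cobounded2] LFor.prems(4)[unfolded growth_bound.simps]]
      order_trans[OF mult_le_mono1[OF max.cobounded1] LFor.prems(4)[unfolded growth_bound.simps]]
    by simp_all
  have mN: "m \<le> N" using LFor.prems by (auto simp: m_def)
  have bst: "bounded_state (M + G * (k * (?T + 1))) (st k)" for k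
    using LFor.prems g unfolding st_def by (intro bounded_for bounded_sem) auto
  have le: "M + G * (k * (?T + 1)) + G * ?T \<le> B" if "k \<le> m" for k
  proof -
    have "k * (?T + 1) + ?T \<le> N * (?T + 1) + ?T" using that mN by (intro add_mono mult_le_mono) auto
    also have "\<dots> \<le> steps N (LFor i v p)" by (simp add: algebra_simps)
    finally have "G * (k * (?T + 1) + ?T) \<le> G * steps N (LFor i v p)" by (rule mult_le_mono2)
    then show ?thesis using LFor.prems(7) by (simp add: distrib_left)
  qed
  have bB: "bounded_state B (st k)" if "k \<le> m" for k
    using bounded_state_mono[OF bst[of k]] le[OF that] by simp
  have sti: "vars (st k) i = int k" for k unfolding st_def by (rule for_vars[OF LFor.prems(1)])
  have stx: "vars (st k) x = vars s x" if "x \<in> {''n'', ''m''}" for x k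
    unfolding st_def using well_formed_wvars[OF LFor.prems(1)] that
    by (intro for_vars[OF LFor.prems(1)]) auto
  have stv: "vars (st k) v = vars s v" for k using LFor.prems(1) stx by auto
  have test: "bcost ?test (st k) \<le> 4 * ?Q" if "k \<le> m" for k
    using bcost_le[OF bB[OF that], of ?test] by simp
  \<comment> \<open>Induction on the number \<open>d\<close> of remaining rounds. A round costs the
    body and 14 units: 4 for the test, 1 for branching, 9 for the increment. The failing test at the
    end accounts for the 5.\<close>
  have loop: "\<exists>t. exec ?while (st k) t (st m) \<and> t \<le> (d * (?T + 14) + 5) * ?Q"
    if "k \<le> m" "d = m - k" for d k
    using that
  proof (induction d arbitrary: k)
    case 0
    then have k: "k = m" by simp
    have "\<not> bval ?test (st m)" using sti[of m] stv[of m] by (simp add: m_def)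
    from exec.WhileFalse[OF this] show ?case
      using test[of m] bits_sq_pos[of B] k by (intro exI[of _ "bcost ?test (st m) + 1"]) auto
  next
    case (Suc d)
    then have k: "k < m" by simp
    then have bv: "bval ?test (st k)" using sti[of k] stv[of k] by (auto simp: m_def)
    obtain t where t: "exec (compile p) (st k) t (sem p (st k))" "t \<le> ?T * ?Q"
      using LFor.IH[OF _ bst[of k]] LFor.prems g le[of k] stx k by fastforce
    have "bounded_state (M + G * (k * (?T + 1)) + G * ?T) (sem p (st k))"
      using LFor.prems g bst stx by (intro bounded_sem) auto
    then have b: "bounded_state B (sem p (st k))"
      by (rule bounded_state_mono) (use le[of k] k in simp)
    have "st (Suc k) = (sem p (st k))\<lparr>vars := (vars (sem p (st k)))(i := aval ?incr (sem p (st k)))\<rparr>"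
      by (simp add: st_def set_var_def)
    then have inc: "exec (Assign i ?incr) (sem p (st k))
        (acost ?incr (sem p (st k)) + bits (aval ?incr (sem p (st k)))) (st (Suc k))"
      using exec.Assign[of i ?incr "sem p (st k)"] by metis
    have inc_le: "acost ?incr (sem p (st k)) + bits (aval ?incr (sem p (st k))) \<le> 9 * ?Q"
      using acost_le[OF b, of ?incr] bits_aval_sq[OF b, of ?incr] by (simp add: bits_0_1)
    obtain u where u: "exec ?while (st (Suc k)) u (st m)" "u \<le> (d * (?T + 14) + 5) * ?Q"
    proof -
      have "Suc k \<le> m" "d = m - Suc k" using Suc.prems k by auto
      from Suc.IH[OF this] show ?thesis using that by blast
    qed
    have "exec ?while (st k) (bcost ?test (st k) + 1 + (t + (acost ?incr (sem p (st k)) +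
        bits (aval ?incr (sem p (st k))))) + u) (st m)"
      by (rule exec.WhileTrue[OF bv exec.Seq[OF t(1) inc] u(1)])
    moreover have "bcost ?test (st k) + 1 + (t + (acost ?incr (sem p (st k)) +
        bits (aval ?incr (sem p (st k))))) + u \<le> 4 * ?Q + ?Q + (?T * ?Q + 9 * ?Q) + (d * (?T + 14) + 5) * ?Q"
      using test[of k] k bits_sq_pos[of B] t(2) inc_le u(2) by linarith
    moreover have "\<dots> = (Suc d * (?T + 14) + 5) * ?Q" by (simp add: algebra_simps)
    ultimately show ?case by metis
  qed
  obtain t where t: "exec ?while (st 0) t (st m)" "t \<le> (m * (?T + 14) + 5) * ?Q"
    using loop[of 0 m] by auto
  have "exec (Assign i (Const 0)) s (bits 0 + bits 0) (st 0)"
    using exec.Assign[of i "Const 0" s] by (simp add: st_def set_var_def)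
  from exec.Seq[OF this t(1)] have "exec (compile (LFor i v p)) s (2 + t) (sem (LFor i v p) s)"
    by (simp add: bits_0_1 st_def m_def)
  moreover have "2 + t \<le> steps N (LFor i v p) * ?Q"
  proof -
    have "2 + t \<le> (2 + (m * (?T + 14) + 5)) * ?Q" using t(2) bits_sq_pos[of B] by (simp add: add_mult_distrib)
    also have "\<dots> \<le> (2 + (N * (?T + 14) + 5)) * ?Q" using mN by (intro mult_le_mono add_mono) auto
    also have "\<dots> \<le> steps N (LFor i v p) * ?Q" by (intro mult_le_mono) (auto simp: algebra_simps)
    finally show ?thesis .
  qed
  ultimately show ?case by blast
qed

section \<open>From step counts to a polynomial bound\<close>

fun depth :: "lprog \<Rightarrow> nat" where
  "depth (LSeq p q) = max (depth p) (depth q)"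
| "depth (LCond b p q) = max (depth p) (depth q)"
| "depth (LFor i v p) = Suc (depth p)"
| "depth _ = 0"

fun weight :: "lprog \<Rightarrow> nat" where
  "weight (LSeq p q) = weight p + weight q"
| "weight (LCond b p q) = bcost_factor b + 1 + weight p + weight q"
| "weight (LFor i v p) = weight p + 20"
| "weight p = steps 0 p"

lemma steps_le: "steps N p \<le> weight p * (N + 1) ^ depth p"
proof (induction p)
  case (LSeq p q)
  have "(N + 1) ^ depth p \<le> (N + 1) ^ depth (LSeq p q)" "(N + 1) ^ depth q \<le> (N + 1) ^ depth (LSeq p q)"
    by (auto intro: power_increasing)
  then have "weight p * (N + 1) ^ depth p \<le> weight p * (N + 1) ^ depth (LSeq p q)"
    "weight q * (N + 1) ^ depth q \<le> weight q * (N + 1) ^ depth (LSeq p q)"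
    by (auto intro: mult_le_mono2)
  with LSeq show ?case unfolding steps.simps weight.simps add_mult_distrib by linarith
next
  case (LCond b p q)
  have "(N + 1) ^ depth p \<le> (N + 1) ^ depth (LCond b p q)"
    "(N + 1) ^ depth q \<le> (N + 1) ^ depth (LCond b p q)"
    by (auto intro: power_increasing)
  then have "weight p * (N + 1) ^ depth p \<le> weight p * (N + 1) ^ depth (LCond b p q)"
    "weight q * (N + 1) ^ depth q \<le> weight q * (N + 1) ^ depth (LCond b p q)"
    by (auto intro: mult_le_mono2)
  moreover have "(bcost_factor b + 1) * 1 \<le> (bcost_factor b + 1) * (N + 1) ^ depth (LCond b p q)"
    by (intro mult_le_mono2) simp
  ultimately show ?case using LCond unfolding steps.simps weight.simps add_mult_distrib by linarith
next
  case (LFor i v p)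
  have "20 * 1 \<le> 20 * (N + 1) ^ depth p" by (intro mult_le_mono2) simp
  then have "steps N p + 20 \<le> weight (LFor i v p) * (N + 1) ^ depth p"
    using LFor unfolding weight.simps add_mult_distrib by linarith
  then have "(N + 1) * (steps N p + 20) \<le> (N + 1) * (weight (LFor i v p) * (N + 1) ^ depth p)"
    by (rule mult_le_mono2)
  then show ?case unfolding steps.simps depth.simps power_Suc by (simp only: mult_ac)
qed auto

lemma square_le_power2: "k\<^sup>2 \<le> 4 * 2 ^ k" for k :: nat
proof (induction k rule: nat_less_induct)
  case (1 k)
  show ?case
  proof (cases "k \<le> 3")
    case True
    then have "k \<in> {0, 1, 2, 3}" by auto
    then show ?thesis by auto
  next
    case False
    then obtain j where j: "k = Suc j" "3 \<le> j" by (cases k) auto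
    \<comment> \<open>The inequality \<open>(j + 1)^2 \<le> 2 * j^2\<close> holds from
      \<open>j = 3\<close> on; after substituting \<open>3 + i\<close> it compares polynomials with
      natural coefficients.\<close>
    obtain i where "j = 3 + i" using j(2) le_Suc_ex by blast
    then have "(Suc j)\<^sup>2 \<le> 2 * j\<^sup>2" by (simp add: power2_eq_square algebra_simps)
    also have "\<dots> \<le> 2 * (4 * 2 ^ j)" using 1 j(1) by (intro mult_le_mono2) auto
    finally show ?thesis using j(1) by simp
  qed
qed

text \<open>If the length is \<open>j + 2\<close>, then \<open>2 ^ j \<le> x\<close>, and
  \<open>square_le_power2\<close> at \<open>j + 2\<close> produces the constant
  \<open>16 = 4 * 2 ^ 2\<close>.\<close>

lemma bits_sq_le: "1 \<le> x \<Longrightarrow> (bits (int x))\<^sup>2 \<le> 16 * x"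
proof -
  assume x: "1 \<le> x"
  let ?f = "floorlog 2 x"
  have "?f \<noteq> 0" using x by (simp add: floorlog_eq_zero_iff)
  then obtain j where j: "?f = Suc j" by (cases ?f) auto
  have "(bits (int x))\<^sup>2 = (Suc (Suc j))\<^sup>2" using j by (simp add: bits_def)
  also have "\<dots> \<le> 4 * 2 ^ Suc (Suc j)" by (rule square_le_power2)
  also have "\<dots> = 16 * 2 ^ j" by simp
  also have "\<dots> \<le> 16 * x" using floorlog_bounds[of x 2] x j by simp
  finally show ?thesis .
qed

lemma bits_power_le: "bits (k ^ e) \<le> 2 + e * bits k"
proof (induction e)
  case (Suc e)
  then show ?case using bits_mult[of k "k ^ e"] by simp
qed (simp add: bits_0_1)

lemma bits_poly_sq_le:
  assumes "1 \<le> x" "B \<le> c * x ^ e"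
  shows "(bits (int B))\<^sup>2 \<le> (bits (int c) + 2 + e)\<^sup>2 * 16 * x"
proof -
  have "bits (int B) \<le> bits (int c * int x ^ e)"
    using assms(2) by (intro bits_mono) (simp flip: of_nat_power of_nat_mult)
  also have "\<dots> \<le> bits (int c) + (2 + e * bits (int x))"
    using bits_mult[of "int c" "int x ^ e"] bits_power_le[of "int x" e] by linarith
  also have "\<dots> \<le> (bits (int c) + 2 + e) * bits (int x)"
    using mult_le_mono2[OF bits_pos[of "int x"], of "bits (int c) + 2"] by (simp add: add_mult_distrib)
  finally have "(bits (int B))\<^sup>2 \<le> ((bits (int c) + 2 + e) * bits (int x))\<^sup>2"
    by (simp add: power_mono)
  also have "\<dots> \<le> (bits (int c) + 2 + e)\<^sup>2 * (16 * x)"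
    unfolding power_mult_distrib by (intro mult_le_mono2 bits_sq_le assms)
  finally show ?thesis by (simp add: mult.assoc)
qed

text \<open>The second loop bound \<open>m = 4n + 4\<close> exceeds every value
  \<open>n - longest n r n x y\<close>, which is at most \<open>3n + 1\<close>, and stays positive
  for \<open>n = 0\<close>. It is set outside the loop language, whose programs must not write to
  \<open>m\<close>.\<close>

definition loop_program :: "lprog \<Rightarrow> com" where
  "loop_program p = Seq (Assign ''m'' (Plus (Plus (Plus (Plus (Var ''n'') (Var ''n'')) (Var ''n'')) (Var ''n'')) (Const 4))) (compile p)"

text \<open>Depth 4 gives a multiple of \<open>x^4\<close> steps for \<open>x = 4n + 5\<close>, and
  the squared length adds one factor \<open>x\<close>. All coefficients come from the program text,
  so \<open>C\<close> can be fixed before \<open>n\<close> and \<open>s\<close>.\<close>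

lemma exec_loop_program:
  assumes p: "well_formed p" "depth p \<le> 4"
  obtains C where "\<And>n s. bounded_state (n + 1) s \<Longrightarrow> vars s ''n'' = int n \<Longrightarrow>
    \<exists>t. exec (loop_program p) s t (sem p (set_var ''m'' (4 * int n + 4) s)) \<and> t \<le> C * (4 * n + 5) ^ 5"
proof -
  let ?e = "Plus (Plus (Plus (Plus (Var ''n'') (Var ''n'')) (Var ''n'')) (Var ''n'')) (Const 4)"
  define w g where "w = weight p" and "g = growth_bound p"
  define c a where "c = 1 + g * w" and "a = acost_factor ?e + bits_factor ?e"
  define D where "D = (bits (int c) + 2 + 5)\<^sup>2 * 16"
  show ?thesis
  proof (rule that[of "(a + w) * D"])
    fix n s
    assume s: "bounded_state (n + 1) s" "vars s ''n'' = int n"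
    define x N where "x = 4 * n + 5" and "N = 4 * n + 4"
    define B where "B = N + g * N * steps N p"
    let ?s = "set_var ''m'' (4 * int n + 4) s"
    have x5: "x ^ 5 = x * x ^ 4" by (simp add: eval_nat_numeral)
    have x: "1 \<le> x" "x = N + 1" by (auto simp: x_def N_def)
    have st: "steps N p \<le> w * x ^ 4"
    proof -
      have "steps N p \<le> w * (N + 1) ^ depth p" unfolding w_def by (rule steps_le)
      also have "\<dots> \<le> w * (N + 1) ^ 4" using p(2) by (intro mult_le_mono2 power_increasing) auto
      finally show ?thesis by (simp only: x(2))
    qed
    have "N \<le> x ^ 5" using self_le_power[of x 5] x by simp
    then have "B \<le> x ^ 5 + g * x * (w * x ^ 4)"
      using st x unfolding B_def by (intro add_mono mult_le_mono) auto
    also have "\<dots> = c * x ^ 5" unfolding c_def x5 by (simp add: algebra_simps)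
    finally have B: "(bits (int B))\<^sup>2 \<le> D * x" unfolding D_def using x(1) by (intro bits_poly_sq_le)
    have b: "bounded_state B s"
      using s(1) by (rule bounded_state_mono) (simp add: B_def N_def)
    have bN: "bounded_state N ?s"
      by (rule bounded_state_set_var[OF bounded_state_mono[OF s(1)]]) (auto simp: N_def)
    have "\<exists>t. exec (compile p) ?s t (sem p ?s) \<and> t \<le> steps N p * (bits (int B))\<^sup>2"
      by (rule exec_compile[OF p(1) bN, of N "g * N" B]) (use s(2) in \<open>auto simp: N_def g_def B_def\<close>)
    then obtain t where t: "exec (compile p) ?s t (sem p ?s)" "t \<le> steps N p * (bits (int B))\<^sup>2"
      by blast
    have "aval ?e s = 4 * int n + 4" using s(2) by simp
    then have "exec (Assign ''m'' ?e) s (acost ?e s + bits (aval ?e s)) ?s"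
      using exec.Assign[of "''m''" ?e s] unfolding set_var_def by metis
    from exec.Seq[OF this t(1)]
    have "exec (loop_program p) s (acost ?e s + bits (aval ?e s) + t) (sem p ?s)"
      unfolding loop_program_def .
    moreover have "acost ?e s + bits (aval ?e s) + t \<le> (a + w) * D * x ^ 5"
    proof -
      have "acost ?e s + bits (aval ?e s) + t \<le> (a + steps N p) * (bits (int B))\<^sup>2"
        using acost_le[OF b, of ?e] bits_aval_sq[OF b, of ?e] t(2)
        unfolding a_def add_mult_distrib by linarith
      also have "\<dots> \<le> (a * x ^ 4 + w * x ^ 4) * (D * x)"
        using st B x(1) by (intro mult_le_mono add_mono) auto
      also have "\<dots> = (a + w) * D * x ^ 5" unfolding x5 by (simp only: add_mult_distrib mult_ac)
      finally show ?thesis .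
    qed
    ultimately show "\<exists>t. exec (loop_program p) s t (sem p ?s) \<and> t \<le> (a + w) * D * (4 * n + 5) ^ 5"
      unfolding x_def by blast
  qed
qed

lemma poly_bigo: "(\<lambda>n. real (C * (4 * n + 5) ^ 5)) \<in> O(\<lambda>n. real n ^ 5)"
proof (rule bigoI)
  show "\<forall>\<^sub>F n in sequentially. norm (real (C * (4 * n + 5) ^ 5)) \<le> real (C * 9 ^ 5) * norm (real n ^ 5)"
    using eventually_ge_at_top[of 1]
  proof eventually_elim
    case (elim n)
    have "(4 * n + 5) ^ 5 \<le> (9 * n) ^ 5" using elim by (intro power_mono) auto
    then have "C * (4 * n + 5) ^ 5 \<le> C * 9 ^ 5 * n ^ 5" by (simp add: power_mult_distrib)
    then have "real (C * (4 * n + 5) ^ 5) \<le> real (C * 9 ^ 5 * n ^ 5)" by (rule of_nat_mono)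
    then show ?case by simp
  qed
qed

section \<open>Proof rules for counted loops\<close>

text \<open>The frame conditions compare with the state at loop entry, so that invariants need not
  mention memory that the body leaves alone.\<close>

lemma sem_for:
  assumes "well_formed (LFor i v p)"
    and "P 0 (set_var i 0 s)"
    and "\<And>k t. k < nat (vars s v) \<Longrightarrow> vars t i = int k \<Longrightarrow>
      (\<And>x. x \<notin> insert i (wvars p) \<Longrightarrow> vars t x = vars s x) \<Longrightarrow>
      (\<And>a. a \<notin> warrs p \<Longrightarrow> arrs t a = arrs s a) \<Longrightarrow> P k t \<Longrightarrow>
      P (Suc k) (set_var i (int (Suc k)) (sem p t))"
  shows "P (nat (vars s v)) (sem (LFor i v p) s)"
proof -
  let ?g = "\<lambda>s. set_var i (vars (sem p s) i + 1) (sem p s)"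
  have "P k ((?g ^^ k) (set_var i 0 s))" if "k \<le> nat (vars s v)" for k
    using that
  proof (induction k)
    case (Suc k)
    let ?t = "(?g ^^ k) (set_var i 0 s)"
    have i: "vars ?t i = int k" by (rule for_vars[OF assms(1)])
    have a: "arrs ?t a = arrs s a" if "a \<notin> warrs p" for a
      by (induction k) (auto simp: arrs_sem that)
    have "vars ?t x = vars s x" if "x \<notin> insert i (wvars p)" for x
      using that by (intro for_vars[OF assms(1)]) auto
    with Suc i a have "P (Suc k) (set_var i (int (Suc k)) (sem p ?t))"
      by (intro assms(3)) auto
    moreover have "vars (sem p ?t) i = int k" using assms(1) i by (simp add: vars_sem)
    ultimately show ?case by (simp add: add.commute)
  qed (use assms(2) in simp)
  then show ?thesis by simp
qed

text \<open>For loops that fill one entry per round: \<open>Q x\<close> specifies entry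
  \<open>x\<close>, \<open>J\<close> holds throughout, and round \<open>x\<close> must preserve the
  specifications of the other entries.\<close>

lemma sem_for_fill:
  assumes wf: "well_formed (LFor i v p)" and v: "vars s v = int n" and J: "J s"
    and indep: "\<And>k t. J (set_var i k t) = J t" "\<And>x k t. Q x (set_var i k t) = Q x t"
    and step: "\<And>x t. x < n \<Longrightarrow> vars t i = int x \<Longrightarrow>
      (\<And>z. z \<notin> insert i (wvars p) \<Longrightarrow> vars t z = vars s z) \<Longrightarrow>
      (\<And>a. a \<notin> warrs p \<Longrightarrow> arrs t a = arrs s a) \<Longrightarrow> J t \<Longrightarrow>
      J (sem p t) \<and> Q x (sem p t) \<and> (\<forall>x'<n. x' \<noteq> x \<longrightarrow> Q x' t \<longrightarrow> Q x' (sem p t))"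
  shows "J (sem (LFor i v p) s) \<and> (\<forall>x<n. Q x (sem (LFor i v p) s))"
proof -
  have "J (sem (LFor i v p) s) \<and> (\<forall>x<nat (vars s v). Q x (sem (LFor i v p) s))"
  proof (rule sem_for[where P = "\<lambda>k t. J t \<and> (\<forall>x<k. Q x t)", OF wf])
    show "J (set_var i 0 s) \<and> (\<forall>x<0. Q x (set_var i 0 s))" using J indep by simp
    fix k t
    assume k: "k < nat (vars s v)" and i: "vars t i = int k"
      and f: "\<And>x. x \<notin> insert i (wvars p) \<Longrightarrow> vars t x = vars s x"
      "\<And>a. a \<notin> warrs p \<Longrightarrow> arrs t a = arrs s a" and P: "J t \<and> (\<forall>x<k. Q x t)"
    have kn: "k < n" using k v by simp
    have st: "J (sem p t) \<and> Q k (sem p t) \<and> (\<forall>x'<n. x' \<noteq> k \<longrightarrow> Q x' t \<longrightarrow> Q x' (sem p t))"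
      using P by (intro step[OF kn i f]) auto
    have "Q x (sem p t)" if "x < Suc k" for x
      using st P that kn by (cases "x = k") auto
    with st show "J (set_var i (int (Suc k)) (sem p t)) \<and>
        (\<forall>x<Suc k. Q x (set_var i (int (Suc k)) (sem p t)))"
      unfolding indep by blast
  qed
  then show ?thesis using v by simp
qed

lemma sem_for_fill2:
  assumes wf: "well_formed (LFor i v (LFor j w p))" and vw: "vars s v = int n" "vars s w = int n"
    and J: "J s"
    and indep: "\<And>z k t. z = i \<or> z = j \<Longrightarrow> J (set_var z k t) = J t"
      "\<And>x y z k t. z = i \<or> z = j \<Longrightarrow> Q x y (set_var z k t) = Q x y t"
    and step: "\<And>x y t. x < n \<Longrightarrow> y < n \<Longrightarrow> vars t i = int x \<Longrightarrow> vars t j = int y \<Longrightarrow>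
      (\<And>z. z \<notin> insert i (insert j (wvars p)) \<Longrightarrow> vars t z = vars s z) \<Longrightarrow>
      (\<And>a. a \<notin> warrs p \<Longrightarrow> arrs t a = arrs s a) \<Longrightarrow> J t \<Longrightarrow>
      J (sem p t) \<and> Q x y (sem p t) \<and>
      (\<forall>x'<n. \<forall>y'<n. x' \<noteq> x \<or> y' \<noteq> y \<longrightarrow> Q x' y' t \<longrightarrow> Q x' y' (sem p t))"
  shows "J (sem (LFor i v (LFor j w p)) s) \<and>
    (\<forall>x<n. \<forall>y<n. Q x y (sem (LFor i v (LFor j w p)) s))"
proof (rule sem_for_fill[where J = J and Q = "\<lambda>x t. \<forall>y<n. Q x y t", OF wf vw(1) J])
  fix x t
  assume x: "x < n" and i: "vars t i = int x"
    and f: "\<And>z. z \<notin> insert i (wvars (LFor j w p)) \<Longrightarrow> vars t z = vars s z"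
      "\<And>a. a \<notin> warrs (LFor j w p) \<Longrightarrow> arrs t a = arrs s a" and Jt: "J t"
  have wf': "well_formed (LFor j w p)" using wf by simp
  have ij: "i \<noteq> j" "i \<notin> wvars p" using wf by auto
  have w: "w \<notin> insert i (wvars (LFor j w p))"
    using wf well_formed_wvars[OF wf'] by auto
  have tw: "vars t w = int n" using f(1)[OF w] vw(2) by simp
  \<comment> \<open>While row \<open>x\<close> is being filled, the inner invariant also remembers
    that the other rows completed so far stay intact.\<close>
  let ?J = "\<lambda>u. J u \<and> (\<forall>x'<n. x' \<noteq> x \<longrightarrow> (\<forall>y<n. Q x' y t) \<longrightarrow> (\<forall>y<n. Q x' y u))"
  have "?J (sem (LFor j w p) t) \<and> (\<forall>y<n. Q x y (sem (LFor j w p) t))"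
  proof (rule sem_for_fill[where J = ?J and Q = "Q x", OF wf' tw])
    show "?J t" using Jt by simp
    fix y u
    assume y: "y < n" and j: "vars u j = int y"
      and g: "\<And>z. z \<notin> insert j (wvars p) \<Longrightarrow> vars u z = vars t z"
        "\<And>a. a \<notin> warrs p \<Longrightarrow> arrs u a = arrs t a" and Ju: "?J u"
    have "J (sem p u) \<and> Q x y (sem p u) \<and>
      (\<forall>x'<n. \<forall>y'<n. x' \<noteq> x \<or> y' \<noteq> y \<longrightarrow> Q x' y' u \<longrightarrow> Q x' y' (sem p u))"
    proof (rule step[OF x y])
      show "vars u i = int x" using g(1)[of i] ij i by simp
    qed (use j g f Ju in auto)
    then show "?J (sem p u) \<and> Q x y (sem p u) \<and> (\<forall>y'<n. y' \<noteq> y \<longrightarrow> Q x y' u \<longrightarrow> Q x y' (sem p u))"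
      using Ju x by blast
  qed (use indep in simp_all)
  then show "J (sem (LFor j w p) t) \<and> (\<forall>y<n. Q x y (sem (LFor j w p) t)) \<and>
      (\<forall>x'<n. x' \<noteq> x \<longrightarrow> (\<forall>y<n. Q x' y t) \<longrightarrow> (\<forall>y<n. Q x' y (sem (LFor j w p) t)))"
    by blast
qed (use indep in simp_all)

section \<open>The program\<close>

definition idx :: "nat \<Rightarrow> nat \<Rightarrow> nat \<Rightarrow> int" where
  "idx n x y = int x * int n + int y"

definition idx3 :: "nat \<Rightarrow> nat \<Rightarrow> nat \<Rightarrow> nat \<Rightarrow> int" where
  "idx3 n k x y = idx n k x * int n + int y"

lemma idx_inject: "y < n \<Longrightarrow> y' < n \<Longrightarrow> idx n x y = idx n x' y' \<longleftrightarrow> x = x' \<and> y = y'"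
proof -
  assume y: "y < n" "y' < n"
  have "x = x' \<and> y = y'" if "x * n + y = x' * n + y'"
  proof -
    have "(x * n + y) div n = x" "(x' * n + y') div n = x'" using y by auto
    then show ?thesis using that by simp
  qed
  moreover have "idx n x y = int (x * n + y)" "idx n x' y' = int (x' * n + y')"
    by (simp_all add: idx_def)
  ultimately show ?thesis by (auto simp: of_nat_eq_iff simp del: of_nat_add of_nat_mult)
qed

lemma idx3_inject:
  assumes "x < n" "y < n" "x' < n" "y' < n"
  shows "idx3 n k x y = idx3 n k' x' y' \<longleftrightarrow> k = k' \<and> x = x' \<and> y = y'"
proof -
  have "idx3 n k x y = idx n (k * n + x) y" for k x y by (simp add: idx3_def idx_def)
  then have "idx3 n k x y = idx3 n k' x' y' \<longleftrightarrow> k * n + x = k' * n + x' \<and> y = y'"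
    using assms by (simp add: idx_inject)
  moreover have "k * n + x = k' * n + x' \<longleftrightarrow> idx n k x = idx n k' x'"
    unfolding idx_def of_nat_mult[symmetric] of_nat_add[symmetric] by (simp only: of_nat_eq_iff)
  ultimately show ?thesis using assms by (auto simp: idx_inject)
qed

text \<open>Folds evaluated index expressions back into \<open>idx\<close> and \<open>idx3\<close>,
  so that the injectivity lemmas can decide which writes touch which entries.\<close>

lemma idx_fold:
  "int x * int n + int y = idx n x y"
  "(int x + 1) * int n + int y = idx n (Suc x) y"
  "idx n k x * int n + int y = idx3 n k x y"
  "idx3 n 0 x y = idx n x y"
  by (simp_all add: idx_def idx3_def algebra_simps)

abbreviation "vn \<equiv> Var ''n''"
abbreviation "at1 a x \<equiv> Elem a (Var x)"
abbreviation "at2 a x y \<equiv> Elem a (Plus (Times (Var x) vn) (Var y))"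
abbreviation "ix3 k x y \<equiv> Plus (Times (Plus (Times k vn) (Var x)) vn) (Var y)"
abbreviation "at3 k x y \<equiv> Elem ''D'' (ix3 k x y)"
abbreviation "upd2 a x y e \<equiv> LUpdate a (Plus (Times (Var x) vn) (Var y)) e"
abbreviation "Or b c \<equiv> Neg (And (Neg b) (Neg c))"

definition input_ok :: "itype set \<Rightarrow> nat \<Rightarrow> (nat \<Rightarrow> nat \<Rightarrow> bool) \<Rightarrow> state \<Rightarrow> bool" where
  "input_ok S n r s \<longleftrightarrow> vars s ''n'' = int n \<and> vars s ''m'' = 4 * int n + 4 \<and>
     (\<forall>x<n. \<forall>y<n. arrs s ''P'' (idx n x y) = of_bool (r x y)) \<and>
     (\<forall>\<tau>. arrs s ''S'' (type_code \<tau>) = of_bool (\<tau> \<in> S))"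

lemma input_okD:
  assumes "input_ok S n r s"
  shows "vars s ''n'' = int n" "vars s ''m'' = 4 * int n + 4"
    "x < n \<Longrightarrow> y < n \<Longrightarrow> arrs s ''P'' (idx n x y) = of_bool (r x y)"
    "arrs s ''S'' 0 = of_bool (TA \<in> S)" "arrs s ''S'' 1 = of_bool (TB \<in> S)"
    "arrs s ''S'' 2 = of_bool (TC \<in> S)" "arrs s ''S'' 3 = of_bool (TD \<in> S)"
proof -
  have "arrs s ''S'' (type_code \<tau>) = of_bool (\<tau> \<in> S)" for \<tau>
    using assms by (simp add: input_ok_def)
  from this[of TA] this[of TB] this[of TC] this[of TD]
  show "arrs s ''S'' 0 = of_bool (TA \<in> S)" "arrs s ''S'' 1 = of_bool (TB \<in> S)"
    "arrs s ''S'' 2 = of_bool (TC \<in> S)" "arrs s ''S'' 3 = of_bool (TD \<in> S)" by simp_all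
qed (use assms in \<open>auto simp: input_ok_def\<close>)

lemma input_ok_cong:
  assumes "vars t ''n'' = vars s ''n''" "vars t ''m'' = vars s ''m''"
    "arrs t ''P'' = arrs s ''P''" "arrs t ''S'' = arrs s ''S''"
  shows "input_ok S n r t = input_ok S n r s"
  unfolding input_ok_def assms ..

lemma input_ok_set_var [simp]:
  "x \<noteq> ''n'' \<Longrightarrow> x \<noteq> ''m'' \<Longrightarrow> input_ok S n r (set_var x k s) = input_ok S n r s"
  by (rule input_ok_cong) auto

lemma input_ok_sem:
  assumes "well_formed p" "''P'' \<notin> warrs p" "''S'' \<notin> warrs p"
  shows "input_ok S n r (sem p s) = input_ok S n r s"
  using assms well_formed_wvars[OF assms(1)] by (intro input_ok_cong) (auto simp: vars_sem arrs_sem)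

section \<open>Tables of longest walks\<close>

definition dist_init :: lprog where
  "dist_init = LFor ''x'' ''n'' (LFor ''y'' ''n''
     (LCond (Equal (Var ''x'') (Var ''y''))
       (LUpdate ''D'' (ix3 (Const 0) ''x'' ''y'') (Const 0))
       (LUpdate ''D'' (ix3 (Const 0) ''x'' ''y'') (Minus (Minus (Const (-1)) vn) vn))))"

lemma dist_init:
  assumes "input_ok S n r s"
  shows "\<forall>x<n. \<forall>y<n. arrs (sem dist_init s) ''D'' (idx3 n 0 x y) = longest n r 0 x y"
  unfolding dist_init_def
proof (rule sem_for_fill2[where J = "\<lambda>_. True", THEN conjunct2])
  show "vars s ''n'' = int n" using assms by (rule input_okD)
  then show "vars s ''n'' = int n" .
qed (use input_okD(1)[OF assms] in \<open>auto simp: idx_fold idx_inject longest_base_def\<close>)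

definition dist_relax_body :: lprog where
  "dist_relax_body =
     (LCond (Equal (at2 ''P'' ''x'' ''z'') (Const 1))
       (LCond (Less (at3 (Plus (Var ''k'') (Const 1)) ''x'' ''y'') (Plus (at3 (Var ''k'') ''z'' ''y'') (Const 1)))
         (LUpdate ''D'' (ix3 (Plus (Var ''k'') (Const 1)) ''x'' ''y'') (Plus (at3 (Var ''k'') ''z'' ''y'') (Const 1)))
         LSkip)
       (LCond (And (Equal (at2 ''P'' ''z'' ''x'') (Const 0))
           (And (Neg (Equal (Var ''x'') (Var ''z'')))
             (Less (at3 (Plus (Var ''k'') (Const 1)) ''x'' ''y'') (Minus (at3 (Var ''k'') ''z'' ''y'') (Const 1)))))
         (LUpdate ''D'' (ix3 (Plus (Var ''k'') (Const 1)) ''x'' ''y'') (Minus (at3 (Var ''k'') ''z'' ''y'') (Const 1)))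
         LSkip))"

definition dist_relax :: lprog where
  "dist_relax = LFor ''z'' ''n'' dist_relax_body"

definition dist_step :: lprog where
  "dist_step = LFor ''x'' ''n'' (LFor ''y'' ''n''
     (LSeq (LUpdate ''D'' (ix3 (Plus (Var ''k'') (Const 1)) ''x'' ''y'') (at3 (Var ''k'') ''x'' ''y''))
       dist_relax))"

text \<open>The entry after the first \<open>j\<close> candidate successors have been tried, which
  is the invariant of the relaxation loop.\<close>

definition partial_max :: "nat \<Rightarrow> (nat \<Rightarrow> nat \<Rightarrow> bool) \<Rightarrow> nat \<Rightarrow> nat \<Rightarrow> nat \<Rightarrow> nat \<Rightarrow> int" where
  "partial_max n r k x y j =
     Max (insert (longest n r k x y) ((\<lambda>z. wgt r x z + longest n r k z y) ` {z. z < j \<and> arc r x z}))"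

lemma partial_max_simps:
  "partial_max n r k x y 0 = longest n r k x y"
  "partial_max n r k x y (Suc j) = (if arc r x j
     then max (partial_max n r k x y j) (wgt r x j + longest n r k j y) else partial_max n r k x y j)"
  "partial_max n r k x y n = longest n r (Suc k) x y"
proof -
  have "{z. z < Suc j \<and> arc r x z} = (if arc r x j then insert j {z. z < j \<and> arc r x z} else {z. z < j \<and> arc r x z})"
    by (auto simp: less_Suc_eq)
  then show "partial_max n r k x y (Suc j) = (if arc r x j
     then max (partial_max n r k x y j) (wgt r x j + longest n r k j y) else partial_max n r k x y j)"
    by (simp add: partial_max_def insert_commute[of "longest n r k x y"] Max_insert[symmetric]
        max.commute[of "Max _"] del: Max_insert)
qed (simp_all add: partial_max_def longest.simps)

lemma dist_relax:
  assumes inp: "input_ok S n r s" and x: "x < n" "y < n"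
    and v: "vars s ''x'' = int x" "vars s ''y'' = int y" "vars s ''k'' = int k"
    and D: "\<forall>x<n. \<forall>y<n. arrs s ''D'' (idx3 n k x y) = longest n r k x y"
    and D': "arrs s ''D'' (idx3 n (Suc k) x y) = longest n r k x y"
  shows "arrs (sem dist_relax s) ''D'' = (arrs s ''D'')(idx3 n (Suc k) x y := longest n r (Suc k) x y)"
proof -
  have "arrs (sem dist_relax s) ''D'' =
      (arrs s ''D'')(idx3 n (Suc k) x y := partial_max n r k x y (nat (vars s ''n'')))"
    unfolding dist_relax_def
  proof (rule sem_for[where P = "\<lambda>j t. arrs t ''D'' =
      (arrs s ''D'')(idx3 n (Suc k) x y := partial_max n r k x y j)"], goal_cases)
    case 1
    then show ?case by (simp add: dist_relax_body_def)
  next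
    case 2
    then show ?case using D' by (auto simp: partial_max_simps)
  next
    case (3 j t)
    have j: "j < n" using 3(1) input_okD(1)[OF inp] by simp
    have tv: "vars t ''n'' = int n" "vars t ''x'' = int x" "vars t ''y'' = int y"
      "vars t ''k'' = int k" "vars t ''z'' = int j"
      using 3(2,3) input_okD(1)[OF inp] v by (simp_all add: dist_relax_body_def)
    have P: "arrs t ''P'' (idx n x j) = of_bool (r x j)" "arrs t ''P'' (idx n j x) = of_bool (r j x)"
      using 3(4)[of "''P''"] input_okD(3)[OF inp] j x by (simp_all add: dist_relax_body_def)
    have Dj: "arrs t ''D'' (idx3 n k j y) = longest n r k j y"
      "arrs t ''D'' (idx3 n (Suc k) x y) = partial_max n r k x y j"
      unfolding 3(5) using D j x by (simp_all add: idx3_inject)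
    \<comment> \<open>Needed in the branch where \<open>x\<close> and \<open>j\<close> coincide and
      the entry is addressed through \<open>j\<close>.\<close>
    have Dx: "x = j \<Longrightarrow> arrs t ''D'' (idx3 n (Suc k) j y) = partial_max n r k j y j" using Dj by auto
    let ?A = "arrs t ''D''"
    let ?i = "idx3 n (Suc k) x y"
    have "arrs (set_var ''z'' (int (Suc j)) (sem dist_relax_body t)) ''D'' = ?A(?i := partial_max n r k x y (Suc j))"
      by (auto simp: dist_relax_body_def fun_eq_iff tv idx_fold P Dj Dx partial_max_simps arc_def incomparable_def wgt_def)
    then show ?case unfolding 3(5) by simp
  qed
  then show ?thesis using input_okD(1)[OF inp] by (simp add: partial_max_simps)
qed

lemma dist_step:
  assumes inp: "input_ok S n r s" and k: "vars s ''k'' = int k"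
    and D: "\<forall>j\<le>k. \<forall>x<n. \<forall>y<n. arrs s ''D'' (idx3 n j x y) = longest n r j x y"
  shows "\<forall>j\<le>Suc k. \<forall>x<n. \<forall>y<n. arrs (sem dist_step s) ''D'' (idx3 n j x y) = longest n r j x y"
proof -
  let ?J = "\<lambda>t. \<forall>j\<le>k. \<forall>x<n. \<forall>y<n. arrs t ''D'' (idx3 n j x y) = longest n r j x y"
  let ?Q = "\<lambda>x y t. arrs t ''D'' (idx3 n (Suc k) x y) = longest n r (Suc k) x y"
  have "?J (sem dist_step s) \<and> (\<forall>x<n. \<forall>y<n. ?Q x y (sem dist_step s))"
    unfolding dist_step_def
  proof (rule sem_for_fill2[where J = ?J and Q = ?Q], goal_cases)
    case (7 x y t)
    let ?u = "set_arr ''D'' (idx3 n (Suc k) x y) (longest n r k x y) t"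
    have tv: "vars t ''n'' = int n" "vars t ''x'' = int x" "vars t ''y'' = int y" "vars t ''k'' = int k"
      using 7(3-5) input_okD(1)[OF inp] k by (simp_all add: dist_relax_def dist_relax_body_def)
    have "input_ok S n r t" using inp
      by (subst input_ok_cong[of t s]) (auto simp: 7(5,6) dist_relax_def dist_relax_body_def)
    then have i: "input_ok S n r ?u" by (subst input_ok_cong[of ?u t]) auto
    have u: "arrs ?u ''D'' (idx3 n j x' y') = longest n r j x' y'" if "j \<le> k" "x' < n" "y' < n" for j x' y'
      using 7 that by (simp add: idx3_inject)
    have "arrs (sem dist_relax ?u) ''D'' = (arrs ?u ''D'')(idx3 n (Suc k) x y := longest n r (Suc k) x y)"
      by (rule dist_relax[OF i 7(1,2)]) (use tv u in auto)
    moreover have "sem (LUpdate ''D'' (ix3 (Plus (Var ''k'') (Const 1)) ''x'' ''y'') (at3 (Var ''k'') ''x'' ''y'')) t = ?u"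
      using 7 tv by (simp add: idx_fold)
    ultimately show ?case using u 7 by (simp add: idx3_inject)
  qed (use D input_okD(1)[OF inp] in \<open>auto simp: dist_relax_def dist_relax_body_def\<close>)
  then show ?thesis by (auto simp: le_Suc_eq)
qed

definition dist_prog :: lprog where
  "dist_prog = LSeq dist_init (LFor ''k'' ''n'' dist_step)"

definition dist_ok :: "nat \<Rightarrow> (nat \<Rightarrow> nat \<Rightarrow> bool) \<Rightarrow> state \<Rightarrow> bool" where
  "dist_ok n r s \<longleftrightarrow> (\<forall>j\<le>n. \<forall>x<n. \<forall>y<n. arrs s ''D'' (idx3 n j x y) = longest n r j x y)"

lemma dist_prog:
  assumes inp: "input_ok S n r s"
  shows "dist_ok n r (sem dist_prog s)"
proof -
  let ?s = "sem dist_init s"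
  let ?P = "\<lambda>k t. \<forall>j\<le>k. \<forall>x<n. \<forall>y<n. arrs t ''D'' (idx3 n j x y) = longest n r j x y"
  have inp': "input_ok S n r ?s" using inp by (subst input_ok_sem) (auto simp: dist_init_def)
  have "?P (nat (vars ?s ''n'')) (sem (LFor ''k'' ''n'' dist_step) ?s)"
  proof (rule sem_for[where P = ?P], goal_cases)
    case 2
    then show ?case using dist_init[OF inp] by auto
  next
    case (3 k t)
    have "input_ok S n r t" using inp'
      by (subst input_ok_cong[of t ?s]) (auto simp: 3(3,4) dist_relax_def dist_relax_body_def dist_step_def)
    from dist_step[OF this 3(2) 3(5)] show ?case by simp
  qed (auto simp: dist_step_def dist_relax_def dist_relax_body_def)
  then show ?thesis using input_okD(1)[OF inp'] by (simp add: dist_prog_def dist_ok_def)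
qed

lemma dist_ok_cong: "arrs t ''D'' = arrs s ''D'' \<Longrightarrow> dist_ok n r t = dist_ok n r s"
  by (simp add: dist_ok_def)

lemma dist_okD: "dist_ok n r s \<Longrightarrow> x < n \<Longrightarrow> y < n \<Longrightarrow> arrs s ''D'' (idx3 n n x y) = longest n r n x y"
  by (simp add: dist_ok_def)

section \<open>Positive closed walks and the constraint table\<close>

definition positive_prog :: lprog where
  "positive_prog = LSeq (LAssign ''pos'' (Const 0)) (LFor ''x'' ''n''
     (LCond (Less (Const 0) (at3 vn ''x'' ''x''))
       (LSeq (LAssign ''pos'' (Const 1)) (LAssign ''root'' (Var ''x''))) LSkip))"

lemma positive_prog:
  assumes inp: "input_ok S n r s" and D: "dist_ok n r s"
  defines "t \<equiv> sem positive_prog s"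
  shows "(vars t ''pos'' = 0 \<and> no_positive n r) \<or>
    (vars t ''pos'' = 1 \<and> (\<exists>x<n. vars t ''root'' = int x \<and> longest n r n x x > 0))"
proof -
  let ?P = "\<lambda>k t. (vars t ''pos'' = 0 \<and> (\<forall>x<k. longest n r n x x \<le> 0)) \<or>
    (vars t ''pos'' = 1 \<and> (\<exists>x<n. vars t ''root'' = int x \<and> longest n r n x x > 0))"
  have "?P (nat (vars (set_var ''pos'' 0 s) ''n'')) t"
    unfolding t_def positive_prog_def sem.simps(4) sem.simps(2) aval.simps
  proof (rule sem_for[where P = ?P], goal_cases)
    case (3 k t)
    have k: "k < n" using 3(1) input_okD(1)[OF inp] by simp
    have "vars t ''n'' = int n" "arrs t ''D'' (idx3 n n k k) = longest n r n k k"
      using 3(3)[of "''n''"] 3(4)[of "''D''"] input_okD(1)[OF inp] dist_okD[OF D k k] by simp_all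
    then show ?case using 3(2,5) k by (auto simp: idx_fold less_Suc_eq)
  qed auto
  then show ?thesis using input_okD(1)[OF inp] by (simp add: no_positive_def)
qed

abbreviation adj_test :: "string \<Rightarrow> string \<Rightarrow> bexp" where
  "adj_test x y \<equiv> And (Equal (at3 vn x y) (Const 1)) (Equal (at3 vn y x) (Const (-1)))"

definition tcon_prog :: lprog where
  "tcon_prog = LFor ''x'' ''n'' (LFor ''y'' ''n''
     (LCond (adj_test ''x'' ''y'')
       (LCond (Equal (at2 ''P'' ''x'' ''y'') (Const 1)) (upd2 ''G'' ''x'' ''y'' (Const 1)) (upd2 ''G'' ''x'' ''y'' (Const 2)))
       (LCond (adj_test ''y'' ''x'')
         (LCond (Equal (at2 ''P'' ''y'' ''x'') (Const 1)) (upd2 ''G'' ''x'' ''y'' (Const 1)) (upd2 ''G'' ''x'' ''y'' (Const 2)))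
         (upd2 ''G'' ''x'' ''y'' (Const 0)))))"

lemma tcon_prog:
  assumes inp: "input_ok S n r s" and D: "dist_ok n r s"
  shows "\<forall>x<n. \<forall>y<n. arrs (sem tcon_prog s) ''G'' (idx n x y) = tcon n r x y"
  unfolding tcon_prog_def
proof (rule sem_for_fill2[where J = "\<lambda>_. True", THEN conjunct2], goal_cases)
  case (7 x y t)
  have "vars t ''n'' = int n" using 7(5) input_okD(1)[OF inp] by simp
  moreover have "arrs t ''P'' (idx n x y) = of_bool (r x y)" "arrs t ''P'' (idx n y x) = of_bool (r y x)"
    using 7(6)[of "''P''"] input_okD(3)[OF inp] 7(1,2) by simp_all
  moreover have "arrs t ''D'' (idx3 n n x y) = longest n r n x y" "arrs t ''D'' (idx3 n n y x) = longest n r n y x"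
    using 7(6)[of "''D''"] dist_okD[OF D] 7(1,2) by simp_all
  ultimately show ?case using 7(1-4)
    by (auto simp: idx_fold idx_inject tcon_def adj_def)
qed (use input_okD(1)[OF inp] in auto)

definition tcon_ok :: "nat \<Rightarrow> (nat \<Rightarrow> nat \<Rightarrow> bool) \<Rightarrow> state \<Rightarrow> bool" where
  "tcon_ok n r s \<longleftrightarrow> (\<forall>x<n. \<forall>y<n. arrs s ''G'' (idx n x y) = tcon n r x y)"

text \<open>The test must not depend on the flag it clears; hypothesis \<open>c\<close> says so by
  ranging over all states that differ from \<open>s\<close> in \<open>i\<close> and \<open>f\<close>
  only.\<close>

lemma flag_loop:
  assumes i: "i \<noteq> ''n''" "i \<noteq> ''m''" "i \<noteq> f" "f \<noteq> ''n''" "f \<noteq> ''m''" and n: "vars s ''n'' = int n"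
    and c: "\<And>j t. j < n \<Longrightarrow> vars t i = int j \<Longrightarrow> (\<And>x. x \<noteq> i \<Longrightarrow> x \<noteq> f \<Longrightarrow> vars t x = vars s x) \<Longrightarrow>
      arrs t = arrs s \<Longrightarrow> bval c t \<longleftrightarrow> C j"
  shows "vars (sem (LFor i ''n'' (LCond c (LAssign f (Const 0)) LSkip)) s) f =
    (if \<exists>j<n. C j then 0 else vars s f)"
proof -
  have "vars (sem (LFor i ''n'' (LCond c (LAssign f (Const 0)) LSkip)) s) f =
    (if \<exists>j<nat (vars s ''n''). C j then 0 else vars s f)"
  proof (rule sem_for[where P = "\<lambda>k t. vars t f = (if \<exists>j<k. C j then 0 else vars s f)"], goal_cases)
    case (3 k t)
    have "bval c t \<longleftrightarrow> C k"
      using 3 n by (intro c) auto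
    then show ?case using 3(5) i by (auto simp: less_Suc_eq)
  qed (use i in auto)
  then show ?thesis using n by simp
qed

section \<open>Elements of type B and A\<close>

definition beta_prog :: lprog where
  "beta_prog = LFor ''x'' ''n'' (LSeq (LAssign ''ok'' (Elem ''S'' (Const 1)))
     (LSeq (LFor ''y'' ''n'' (LCond (Equal (at2 ''G'' ''x'' ''y'') (Const 2)) (LAssign ''ok'' (Const 0)) LSkip))
       (LUpdate ''b'' (Var ''x'') (Var ''ok''))))"

lemma beta_prog:
  assumes inp: "input_ok S n r s" and G: "tcon_ok n r s"
  shows "\<forall>x<n. arrs (sem beta_prog s) ''b'' (int x) = of_bool (beta n r S x)"
  unfolding beta_prog_def
proof (rule sem_for_fill[where J = "\<lambda>_. True", THEN conjunct2], goal_cases)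
  case (6 x t)
  let ?l = "LFor ''y'' ''n'' (LCond (Equal (at2 ''G'' ''x'' ''y'') (Const 2)) (LAssign ''ok'' (Const 0)) LSkip)"
  let ?t = "set_var ''ok'' (arrs t ''S'' 1) t"
  have n: "vars t ''n'' = int n" and S: "arrs t ''S'' 1 = of_bool (TB \<in> S)"
    using 6(3) 6(4)[of "''S''"] input_okD[OF inp] by simp_all
  have "vars (sem ?l ?t) ''ok'' = (if \<exists>j<n. tcon n r x j = 2 then 0 else vars ?t ''ok'')"
  proof (rule flag_loop, goal_cases)
    case (7 j u)
    have "arrs u ''G'' (idx n x j) = tcon n r x j"
      using 7(1,4) 6(1) 6(4)[of "''G''"] G by (simp add: tcon_ok_def)
    moreover have "vars u ''x'' = int x" "vars u ''n'' = int n" using 7(3) 6(2) n by simp_all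
    ultimately show ?case using 7(2) by (simp add: idx_fold)
  qed (use n in auto)
  then have ok: "vars (sem ?l ?t) ''ok'' = of_bool (beta n r S x)" using S by (auto simp: beta_def)
  have "vars (sem ?l ?t) ''x'' = int x" "arrs (sem ?l ?t) = arrs t"
    using 6(2) by (auto simp: vars_sem arrs_sem fun_eq_iff simp del: sem.simps)
  then show ?case using ok by (simp del: sem.simps(6))
qed (use input_okD(1)[OF inp] in auto)

definition alpha_prog :: lprog where
  "alpha_prog = LFor ''x'' ''n''
     (LSeq (LCond (Equal (at1 ''b'' ''x'') (Const 1)) (LAssign ''ok'' (Const 0)) (LAssign ''ok'' (Elem ''S'' (Const 0))))
     (LSeq (LFor ''y'' ''n'' (LCond (And (Equal (at1 ''b'' ''y'') (Const 0)) (Equal (at2 ''G'' ''x'' ''y'') (Const 1))) (LAssign ''ok'' (Const 0)) LSkip))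
       (LUpdate ''a'' (Var ''x'') (Var ''ok''))))"

lemma alpha_prog:
  assumes inp: "input_ok S n r s" and G: "tcon_ok n r s"
    and b: "\<forall>x<n. arrs s ''b'' (int x) = of_bool (beta n r S x)"
  shows "\<forall>x<n. arrs (sem alpha_prog s) ''a'' (int x) = of_bool (alpha n r S x)"
  unfolding alpha_prog_def
proof (rule sem_for_fill[where J = "\<lambda>_. True", THEN conjunct2], goal_cases)
  case (6 x t)
  let ?l = "LFor ''y'' ''n'' (LCond (And (Equal (at1 ''b'' ''y'') (Const 0)) (Equal (at2 ''G'' ''x'' ''y'') (Const 1))) (LAssign ''ok'' (Const 0)) LSkip)"
  let ?c = "LCond (Equal (at1 ''b'' ''x'') (Const 1)) (LAssign ''ok'' (Const 0)) (LAssign ''ok'' (Elem ''S'' (Const 0)))"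
  let ?t = "set_var ''ok'' (of_bool (TA \<in> S \<and> \<not> beta n r S x)) t"
  have n: "vars t ''n'' = int n" and S: "arrs t ''S'' 0 = of_bool (TA \<in> S)"
    and bx: "arrs t ''b'' (int x) = of_bool (beta n r S x)"
    using 6(1,3) 6(4)[of "''S''"] 6(4)[of "''b''"] input_okD[OF inp] b by simp_all
  have c: "sem ?c t = ?t" using S bx 6(2) by auto
  have "vars (sem ?l ?t) ''ok'' = (if \<exists>j<n. \<not> beta n r S j \<and> tcon n r x j = 1 then 0 else vars ?t ''ok'')"
  proof (rule flag_loop, goal_cases)
    case (7 j u)
    have "arrs u ''G'' (idx n x j) = tcon n r x j" "arrs u ''b'' (int j) = of_bool (beta n r S j)"
      using 7(1,4) 6(1) 6(4)[of "''G''"] 6(4)[of "''b''"] G b by (simp_all add: tcon_ok_def)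
    moreover have "vars u ''x'' = int x" "vars u ''n'' = int n" using 7(3) 6(2) n by simp_all
    ultimately show ?case using 7(2) by (simp add: idx_fold)
  qed (use n in auto)
  then have ok: "vars (sem ?l ?t) ''ok'' = of_bool (alpha n r S x)" by (auto simp: alpha_def)
  have "vars (sem ?l ?t) ''x'' = int x" "arrs (sem ?l ?t) = arrs t"
    using 6(2) by (auto simp: vars_sem arrs_sem fun_eq_iff simp del: sem.simps)
  then show ?case using ok unfolding sem.simps(4) c by (simp del: sem.simps(6))
qed (use input_okD(1)[OF inp] in auto)

section \<open>Choice between C and D by merging components\<close>

definition class_ok :: "itype set \<Rightarrow> nat \<Rightarrow> (nat \<Rightarrow> nat \<Rightarrow> bool) \<Rightarrow> state \<Rightarrow> bool" where
  "class_ok S n r s \<longleftrightarrow> (\<forall>x<n. arrs s ''b'' (int x) = of_bool (beta n r S x) \<and>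
     arrs s ''a'' (int x) = of_bool (alpha n r S x))"

text \<open>Union by relabelling. The colours inside a component are correct up to a global flip, so
  merging two components flips one of them if their joining constraint demands it.\<close>

definition merge_prog :: lprog where
  "merge_prog = LFor ''x'' ''n''
     (LCond (Equal (at1 ''comp'' ''x'') (Var ''cz''))
       (LSeq (LUpdate ''comp'' (Var ''x'') (Var ''cy''))
         (LCond (Equal (Var ''flip'') (Const 1))
           (LCond (Equal (at1 ''col'' ''x'') (Const 0)) (LUpdate ''col'' (Var ''x'') (Const 1)) (LUpdate ''col'' (Var ''x'') (Const 0)))
           LSkip))
       LSkip)"

lemma merge_prog:
  assumes n: "vars s ''n'' = int n" and c: "vars s ''cy'' \<noteq> vars s ''cz''"
  shows "\<forall>u<n. arrs (sem merge_prog s) ''comp'' (int u) =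
        (if arrs s ''comp'' (int u) = vars s ''cz'' then vars s ''cy'' else arrs s ''comp'' (int u)) \<and>
      arrs (sem merge_prog s) ''col'' (int u) =
        (if arrs s ''comp'' (int u) = vars s ''cz'' \<and> vars s ''flip'' = 1
         then of_bool (arrs s ''col'' (int u) = 0) else arrs s ''col'' (int u))"
proof -
  let ?comp = "\<lambda>u. if arrs s ''comp'' (int u) = vars s ''cz'' then vars s ''cy'' else arrs s ''comp'' (int u)"
  let ?col = "\<lambda>u. if arrs s ''comp'' (int u) = vars s ''cz'' \<and> vars s ''flip'' = 1
         then of_bool (arrs s ''col'' (int u) = 0) else arrs s ''col'' (int u)"
  let ?P = "\<lambda>k t. \<forall>u<n. arrs t ''comp'' (int u) = (if u < k then ?comp u else arrs s ''comp'' (int u)) \<and>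
     arrs t ''col'' (int u) = (if u < k then ?col u else arrs s ''col'' (int u))"
  have "?P (nat (vars s ''n'')) (sem merge_prog s)"
    unfolding merge_prog_def
  proof (rule sem_for[where P = ?P], goal_cases)
    case (3 k t)
    have k: "k < n" using 3(1) n by simp
    have tv: "vars t ''cy'' = vars s ''cy''" "vars t ''cz'' = vars s ''cz''" "vars t ''flip'' = vars s ''flip''"
      using 3(3) by simp_all
    have e: "arrs t ''comp'' (int k) = arrs s ''comp'' (int k)" "arrs t ''col'' (int k) = arrs s ''col'' (int k)"
      using 3(5) k by simp_all
    show ?case using 3(2,5) by (simp add: tv e less_Suc_eq)
  qed auto
  then show ?thesis using n by simp
qed

definition union_body :: lprog where
  "union_body = LCond (And (Equal (at1 ''b'' ''y'') (Const 0)) (And (Equal (at1 ''a'' ''y'') (Const 0))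
       (And (Equal (at1 ''b'' ''z'') (Const 0)) (And (Equal (at1 ''a'' ''z'') (Const 0))
       (And (Neg (Equal (at2 ''G'' ''y'' ''z'') (Const 0))) (Neg (Equal (at1 ''comp'' ''y'') (at1 ''comp'' ''z''))))))))
     (LSeq (LSeq (LAssign ''cy'' (at1 ''comp'' ''y'')) (LSeq (LAssign ''cz'' (at1 ''comp'' ''z''))
       (LCond (Equal (at1 ''col'' ''y'') (at1 ''col'' ''z''))
         (LCond (Equal (at2 ''G'' ''y'' ''z'') (Const 1)) (LAssign ''flip'' (Const 0)) (LAssign ''flip'' (Const 1)))
         (LCond (Equal (at2 ''G'' ''y'' ''z'') (Const 1)) (LAssign ''flip'' (Const 1)) (LAssign ''flip'' (Const 0))))))
       merge_prog)
     LSkip"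

lemma union_body:
  assumes inp: "input_ok S n r s" and G: "tcon_ok n r s" and cl: "class_ok S n r s"
    and y: "y < n" "vars s ''y'' = int y" and z: "z < n" "vars s ''z'' = int z"
  defines "m \<equiv> rest n r S y \<and> rest n r S z \<and> tcon n r y z \<noteq> 0 \<and>
      arrs s ''comp'' (int y) \<noteq> arrs s ''comp'' (int z)"
  shows "\<forall>u<n. arrs (sem union_body s) ''comp'' (int u) =
        (if m \<and> arrs s ''comp'' (int u) = arrs s ''comp'' (int z) then arrs s ''comp'' (int y) else arrs s ''comp'' (int u)) \<and>
      arrs (sem union_body s) ''col'' (int u) =
        (if m \<and> arrs s ''comp'' (int u) = arrs s ''comp'' (int z) \<and>
            (arrs s ''col'' (int y) = arrs s ''col'' (int z)) \<noteq> (tcon n r y z = 1)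
         then of_bool (arrs s ''col'' (int u) = 0) else arrs s ''col'' (int u))"
proof -
  have n: "vars s ''n'' = int n" and g: "arrs s ''G'' (idx n y z) = tcon n r y z"
    using input_okD[OF inp] G y z by (simp_all add: tcon_ok_def)
  have e: "arrs s ''b'' (int y) = of_bool (beta n r S y)" "arrs s ''a'' (int y) = of_bool (alpha n r S y)"
    "arrs s ''b'' (int z) = of_bool (beta n r S z)" "arrs s ''a'' (int z) = of_bool (alpha n r S z)"
    using cl y z by (auto simp: class_ok_def)
  define t where "t = set_var ''flip'' (of_bool ((arrs s ''col'' (int y) = arrs s ''col'' (int z)) \<noteq> (tcon n r y z = 1)))
    (set_var ''cz'' (arrs s ''comp'' (int z)) (set_var ''cy'' (arrs s ''comp'' (int y)) s))"
  have s: "sem union_body s = (if m then sem merge_prog t else s)"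
    unfolding union_body_def t_def m_def rest_def by (simp add: y z n g e idx_fold)
  show ?thesis
  proof (cases m)
    case True
    have "vars t ''n'' = int n" "vars t ''cy'' \<noteq> vars t ''cz''" using True n by (auto simp: t_def m_def)
    from merge_prog[OF this] show ?thesis using True s by (simp add: t_def)
  next
    case False
    then show ?thesis using s by simp
  qed
qed

definition union_prog :: lprog where
  "union_prog = LSeq (LFor ''x'' ''n'' (LSeq (LUpdate ''comp'' (Var ''x'') (Var ''x'')) (LUpdate ''col'' (Var ''x'') (Const 0))))
     (LFor ''y'' ''n'' (LFor ''z'' ''n'' union_body))"

text \<open>Here \<open>f\<close> is any valid colouring of a constraint-closed set
  \<open>K\<close>, not a computed one: inside each component the stored colours equal
  \<open>f\<close> up to a flip. For a class without valid colouring nothing is claimed, as the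
  program does not know which classes are solvable.\<close>

definition colour_inv :: "nat \<Rightarrow> nat set \<Rightarrow> (nat \<Rightarrow> bool) \<Rightarrow> state \<Rightarrow> bool" where
  "colour_inv n K f t \<longleftrightarrow> (\<forall>u<n. arrs t ''col'' (int u) = 0 \<or> arrs t ''col'' (int u) = 1) \<and>
     (\<forall>u<n. \<forall>v<n. arrs t ''comp'' (int u) = arrs t ''comp'' (int v) \<longrightarrow>
        (u \<in> K \<longleftrightarrow> v \<in> K) \<and>
        (u \<in> K \<longrightarrow> (f u = f v) = (arrs t ''col'' (int u) = arrs t ''col'' (int v))))"

lemma colour_inv_union_body:
  assumes K: "K \<subseteq> {..<n}" "\<And>u v. u \<in> K \<Longrightarrow> v < n \<Longrightarrow> tcon n r u v \<noteq> 0 \<Longrightarrow> v \<in> K"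
    and f: "valid_colouring n r S K f"
    and inp: "input_ok S n r s" and G: "tcon_ok n r s" and cl: "class_ok S n r s"
    and y: "y < n" "vars s ''y'' = int y" and z: "z < n" "vars s ''z'' = int z"
    and inv: "colour_inv n K f s"
  shows "colour_inv n K f (sem union_body s)"
proof -
  let ?c = "\<lambda>u. arrs s ''comp'' (int u)" and ?d = "\<lambda>u. arrs s ''col'' (int u)"
  let ?c' = "\<lambda>u. arrs (sem union_body s) ''comp'' (int u)" and ?d' = "\<lambda>u. arrs (sem union_body s) ''col'' (int u)"
  define m where "m \<longleftrightarrow> rest n r S y \<and> rest n r S z \<and> tcon n r y z \<noteq> 0 \<and> ?c y \<noteq> ?c z"
  define fl where "fl \<longleftrightarrow> (?d y = ?d z) \<noteq> (tcon n r y z = 1)"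
  have b: "?c' u = (if m \<and> ?c u = ?c z then ?c y else ?c u)"
    "?d' u = (if m \<and> ?c u = ?c z \<and> fl then of_bool (?d u = 0) else ?d u)" if "u < n" for u
    using union_body[OF inp G cl y z] that unfolding m_def fl_def by auto
  have d01: "?d u = 0 \<or> ?d u = 1" if "u < n" for u using inv that by (simp add: colour_inv_def)
  have i: "(u \<in> K \<longleftrightarrow> v \<in> K) \<and> (u \<in> K \<longrightarrow> (f u = f v) = (?d u = ?d v))"
    if "u < n" "v < n" "?c u = ?c v" for u v
    using inv that unfolding colour_inv_def by blast
  have d': "?d' u = 0 \<or> ?d' u = 1" if "u < n" for u using d01[OF that] b(2)[OF that] by auto
  \<comment> \<open>Parity argument: \<open>u\<close> is compared with \<open>z\<close> and
    \<open>v\<close> with \<open>y\<close> inside the old components, the constraint relates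
    \<open>f y\<close> to \<open>f z\<close>, and the flip \<open>fl\<close> corrects exactly a
    mismatch with the stored colours of \<open>y\<close> and \<open>z\<close>.\<close>
  have cross: "(u \<in> K \<longleftrightarrow> v \<in> K) \<and> (u \<in> K \<longrightarrow> (f u = f v) = (?d' u = ?d' v))"
    if m and u: "u < n" "?c u = ?c z" and v: "v < n" "?c v = ?c y" for u v
  proof -
    have t: "tcon n r y z \<noteq> 0" "tcon n r z y \<noteq> 0" "?c y \<noteq> ?c z"
      using \<open>m\<close> tcon_commute[of n r y z] by (auto simp: m_def)
    have yz: "y \<in> K \<longleftrightarrow> z \<in> K" using K(2)[of y z] K(2)[of z y] t y z by blast
    note uz = i[OF u(1) z(1) u(2)] and vy = i[OF v(1) y(1) v(2)]
    have "(f u = f v) = (?d' u = ?d' v)" if "u \<in> K"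
    proof -
      have zy: "z \<in> K" "y \<in> K" using uz yz that by auto
      have "(f y = f z) = (tcon n r y z = 1)"
        using f zy \<open>m\<close> t by (auto simp: valid_colouring_def m_def)
      moreover have "(f u = f z) = (?d u = ?d z)" "(f v = f y) = (?d v = ?d y)" using uz vy zy that by auto
      moreover have "?d' u = (if fl then of_bool (?d u = 0) else ?d u)" "?d' v = ?d v"
        using b[OF u(1)] b[OF v(1)] \<open>m\<close> u v t by auto
      ultimately show ?thesis
        using d01[OF u(1)] d01[OF v(1)] d01[OF y(1)] d01[OF z(1)] unfolding fl_def
        by (elim disjE) auto
    qed
    then show ?thesis using uz vy yz by auto
  qed
  have "(u \<in> K \<longleftrightarrow> v \<in> K) \<and> (u \<in> K \<longrightarrow> (f u = f v) = (?d' u = ?d' v))"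
    if u: "u < n" and v: "v < n" and e: "?c' u = ?c' v" for u v
  proof -
    consider "?c u = ?c v" | "m" "?c u = ?c z" "?c v = ?c y" | "m" "?c u = ?c y" "?c v = ?c z"
      using e b(1)[OF u] b(1)[OF v] by (auto split: if_splits)
    then show ?thesis
    proof cases
      case 1
      have "(?d' u = ?d' v) = (?d u = ?d v)"
        using b(2)[OF u] b(2)[OF v] 1 d01[OF u] d01[OF v] by auto
      then show ?thesis using i[OF u v 1] by simp
    next
      case 2
      then show ?thesis using cross[OF 2(1) u 2(2) v 2(3)] by simp
    next
      case 3
      then show ?thesis using cross[OF 3(1) v 3(3) u 3(2)] by auto
    qed
  qed
  then show ?thesis using d' unfolding colour_inv_def by blast
qed

text \<open>In the end any two remaining elements with a constraint share a component, where stored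
  colours and \<open>f\<close> agree up to a flip. As \<open>f\<close> is arbitrary, this is the
  condition on \<open>col\<close> in \<open>greedy_types_ok\<close>.\<close>

lemma union_prog:
  assumes K: "K \<subseteq> {..<n}" "\<And>u v. u \<in> K \<Longrightarrow> v < n \<Longrightarrow> tcon n r u v \<noteq> 0 \<Longrightarrow> v \<in> K"
    and f: "valid_colouring n r S K f"
    and inp: "input_ok S n r s" and G: "tcon_ok n r s" and cl: "class_ok S n r s"
    and xy: "x \<in> K" "y \<in> K" "rest n r S x" "rest n r S y" "tcon n r x y \<noteq> 0"
  defines "t \<equiv> sem union_prog s"
  shows "((arrs t ''col'' (int x) = 1) = (arrs t ''col'' (int y) = 1)) = (f x = f y)"
proof -
  let ?init = "LFor ''x'' ''n'' (LSeq (LUpdate ''comp'' (Var ''x'') (Var ''x'')) (LUpdate ''col'' (Var ''x'') (Const 0)))"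
  let ?s = "sem ?init s"
  let ?Q = "\<lambda>y z t. rest n r S y \<and> rest n r S z \<and> tcon n r y z \<noteq> 0 \<longrightarrow>
    arrs t ''comp'' (int y) = arrs t ''comp'' (int z)"
  have "\<forall>x<n. arrs ?s ''comp'' (int x) = int x \<and> arrs ?s ''col'' (int x) = 0"
    by (rule sem_for_fill[where J = "\<lambda>_. True", THEN conjunct2]) (use input_okD(1)[OF inp] in auto)
  then have init: "colour_inv n K f ?s" by (auto simp: colour_inv_def)
  have s: "vars ?s x = vars s x" "arrs ?s a = arrs s a" if "x \<noteq> ''x''" "a \<noteq> ''comp''" "a \<noteq> ''col''" for x a
    using that by (simp_all add: vars_sem arrs_sem del: sem.simps)
  have "colour_inv n K f t \<and> (\<forall>y<n. \<forall>z<n. ?Q y z t)"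
    unfolding t_def union_prog_def sem.simps(4)
  proof (rule sem_for_fill2[where J = "colour_inv n K f" and Q = ?Q], goal_cases)
    case 1
    then show ?case by (simp add: union_body_def merge_prog_def)
  next
    case (7 y z t)
    have v: "vars t x = vars s x" if "x \<notin> {''x'', ''y'', ''z'', ''cy'', ''cz'', ''flip''}" for x
      using 7(5)[of x] s(1)[of x "''a''"] that by (simp add: union_body_def merge_prog_def)
    have a: "arrs t a = arrs s a" if "a \<noteq> ''comp''" "a \<noteq> ''col''" for a
      using 7(6)[of a] s(2)[of "''a''" a] that by (simp add: union_body_def merge_prog_def)
    have inp': "input_ok S n r t" using inp by (subst input_ok_cong[of t s]) (auto simp: v a)
    have G': "tcon_ok n r t" using G by (simp add: tcon_ok_def a)
    have cl': "class_ok S n r t" using cl by (simp add: class_ok_def a)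
    note ub = union_body[OF inp' G' cl' 7(1,3) 7(2,4)]
    have "?Q y z (sem union_body t)" using ub 7(1,2) by auto
    \<comment> \<open>Merging only coarsens the partition, so pairs joined earlier stay
      joined.\<close>
    moreover have "\<forall>x'<n. \<forall>y'<n. x' \<noteq> y \<or> y' \<noteq> z \<longrightarrow> ?Q x' y' t \<longrightarrow> ?Q x' y' (sem union_body t)"
      using ub by auto
    moreover have "colour_inv n K f (sem union_body t)"
      by (rule colour_inv_union_body[OF K f inp' G' cl' 7(1,3) 7(2,4) 7(7)])
    ultimately show ?case by blast
  next
    case 2
    show ?case using s(1)[of "''n''" "''a''"] input_okD(1)[OF inp] by (simp del: sem.simps)
  next
    case 3
    show ?case using s(1)[of "''n''" "''a''"] input_okD(1)[OF inp] by (simp del: sem.simps)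
  next
    case 4
    show ?case by (rule init)
  qed (simp_all add: colour_inv_def)
  moreover have "x < n" "y < n" using xy K(1) by auto
  ultimately have "colour_inv n K f t" "arrs t ''comp'' (int x) = arrs t ''comp'' (int y)"
    using xy by auto
  then have "(f x = f y) = (arrs t ''col'' (int x) = arrs t ''col'' (int y))"
    "arrs t ''col'' (int x) = 0 \<or> arrs t ''col'' (int x) = 1"
    "arrs t ''col'' (int y) = 0 \<or> arrs t ''col'' (int y) = 1"
    using xy(1) \<open>x < n\<close> \<open>y < n\<close> unfolding colour_inv_def by blast+
  then show ?thesis by auto
qed

section \<open>Assignment of types and its check\<close>

definition type_prog :: lprog where
  "type_prog = LFor ''x'' ''n''
     (LCond (Equal (at1 ''b'' ''x'') (Const 1)) (LUpdate ''type'' (Var ''x'') (Const 1))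
     (LCond (Equal (at1 ''a'' ''x'') (Const 1)) (LUpdate ''type'' (Var ''x'') (Const 0))
     (LCond (Equal (Elem ''S'' (Const 2)) (Const 1))
       (LCond (And (Equal (Elem ''S'' (Const 3)) (Const 1)) (Equal (at1 ''col'' ''x'') (Const 1)))
         (LUpdate ''type'' (Var ''x'') (Const 3)) (LUpdate ''type'' (Var ''x'') (Const 2)))
     (LCond (Equal (Elem ''S'' (Const 3)) (Const 1)) (LUpdate ''type'' (Var ''x'') (Const 3))
     (LCond (Equal (Elem ''S'' (Const 0)) (Const 1)) (LUpdate ''type'' (Var ''x'') (Const 0))
       (LUpdate ''type'' (Var ''x'') (Const 1)))))))"

lemma type_prog:
  assumes inp: "input_ok S n r s" and cl: "class_ok S n r s"
  shows "\<forall>x<n. arrs (sem type_prog s) ''type'' (int x) =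
    type_code (greedy n r S (\<lambda>x. arrs s ''col'' (int x) = 1) x)"
  unfolding type_prog_def
proof (rule sem_for_fill[where J = "\<lambda>_. True", THEN conjunct2], goal_cases)
  case (6 x t)
  have "arrs t ''b'' (int x) = of_bool (beta n r S x)" "arrs t ''a'' (int x) = of_bool (alpha n r S x)"
    using 6(1) 6(4)[of "''a''"] 6(4)[of "''b''"] cl by (auto simp: class_ok_def)
  moreover have "arrs t ''S'' = arrs s ''S''" "arrs t ''col'' = arrs s ''col''" by (simp_all add: 6(4))
  ultimately show ?case using 6(1,2) input_okD[OF inp] by (auto simp: greedy_def)
qed (use input_okD(1)[OF inp] in auto)

definition compat_test :: bexp where
  "compat_test = Or (Or (Equal (at1 ''type'' ''x'') (Const 1)) (Equal (at1 ''type'' ''y'') (Const 1)))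
     (And (Equal (at1 ''type'' ''x'') (at1 ''type'' ''y'')) (Neg (Equal (at1 ''type'' ''x'') (Const 0))))"

text \<open>All constraints are tested afresh instead of watching for contradictions during the
  merging. A positive answer then rests on this test alone; the properties of the colouring only
  serve to show that a violated pair lies in an unsolvable class.\<close>

definition check_prog :: lprog where
  "check_prog = LFor ''x'' ''n'' (LFor ''y'' ''n''
     (LCond (Or (And (Equal (at2 ''G'' ''x'' ''y'') (Const 1)) (Neg compat_test))
                (And (Equal (at2 ''G'' ''x'' ''y'') (Const 2)) compat_test))
       (LSeq (LAssign ''vio'' (Const 1)) (LAssign ''root'' (Var ''x''))) LSkip))"

lemma type_code_compatible:
  "compatible \<sigma> \<tau> \<longleftrightarrow> type_code \<sigma> = 1 \<or> type_code \<tau> = 1 \<or> type_code \<sigma> = type_code \<tau> \<and> type_code \<sigma> \<noteq> 0"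
  by (cases \<sigma>; cases \<tau>) (auto simp: compatible_def)

lemma check_prog:
  assumes inp: "input_ok S n r s" and G: "tcon_ok n r s"
    and ty: "\<forall>x<n. arrs s ''type'' (int x) = type_code (ty x)" and vio: "vars s ''vio'' = 0"
  defines "t \<equiv> sem check_prog s"
  shows "(vars t ''vio'' = 0 \<and> types_ok n r {..<n} ty) \<or>
    (vars t ''vio'' = 1 \<and> (\<exists>x<n. \<exists>y<n. vars t ''root'' = int x \<and> tcon n r x y \<noteq> 0 \<and> \<not> types_ok n r {x, y} ty))"
proof -
  let ?bad = "\<lambda>x y. tcon n r x y = 1 \<and> \<not> compatible (ty x) (ty y) \<or> tcon n r x y = 2 \<and> compatible (ty x) (ty y)"
  let ?J = "\<lambda>t. vars t ''vio'' = 0 \<or> vars t ''vio'' = 1 \<and> (\<exists>x<n. \<exists>y<n. vars t ''root'' = int x \<and> ?bad x y)"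
  let ?Q = "\<lambda>x y t. vars t ''vio'' = 0 \<longrightarrow> \<not> ?bad x y"
  have "?J t \<and> (\<forall>x<n. \<forall>y<n. ?Q x y t)"
    unfolding t_def check_prog_def
  proof (rule sem_for_fill2[where J = ?J and Q = ?Q], goal_cases)
    case (7 x y t)
    have "vars t ''n'' = int n" using 7(5) input_okD(1)[OF inp] by simp
    moreover have "arrs t ''G'' (idx n x y) = tcon n r x y" using G 7(1,2) 7(6)[of "''G''"] by (simp add: tcon_ok_def)
    moreover have cmp: "bval compat_test t \<longleftrightarrow> compatible (ty x) (ty y)"
    proof -
      have "arrs t ''type'' (int x) = type_code (ty x)" "arrs t ''type'' (int y) = type_code (ty y)"
        using ty 7(1,2) 7(6)[of "''type''"] by simp_all
      then show ?thesis using 7(3,4) by (auto simp: compat_test_def type_code_compatible)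
    qed
    ultimately have "sem (LCond (Or (And (Equal (at2 ''G'' ''x'' ''y'') (Const 1)) (Neg compat_test))
                (And (Equal (at2 ''G'' ''x'' ''y'') (Const 2)) compat_test))
       (LSeq (LAssign ''vio'' (Const 1)) (LAssign ''root'' (Var ''x''))) LSkip) t =
       (if ?bad x y then set_var ''root'' (int x) (set_var ''vio'' 1 t) else t)"
      using 7(3,4) cmp by (simp add: idx_fold)
    moreover have "?J (set_var ''root'' (int x) (set_var ''vio'' 1 t))" if "?bad x y"
      using 7(1,2) that by auto
    ultimately show ?case using 7(7) by auto
  qed (use vio input_okD(1)[OF inp] in auto)
  then have J: "?J t" and Q: "\<forall>x<n. \<forall>y<n. ?Q x y t" by blast+
  show ?thesis
  proof (cases "vars t ''vio'' = 0")
    case True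
    then show ?thesis using Q by (auto simp: types_ok_def)
  next
    case False
    then obtain x y where h: "vars t ''vio'' = 1" "x < n" "y < n" "vars t ''root'' = int x" "?bad x y"
      using J by blast
    then have "tcon n r x y \<noteq> 0" by auto
    moreover have "\<not> types_ok n r {x, y} ty" using h(5) unfolding types_ok_def by blast
    ultimately show ?thesis using h(1-4) by blast
  qed
qed

text \<open>The centers are summed up in unary, since a right-hand side must be \<^const>\<open>additive\<close>.\<close>

definition interval_prog :: lprog where
  "interval_prog = LFor ''x'' ''n'' (LSeq (LAssign ''s'' (Const 0))
     (LSeq (LFor ''y'' ''n'' (LFor ''j'' ''m''
         (LCond (Less (Plus (Var ''j'') (at3 vn ''x'' ''y'')) vn) (LAssign ''s'' (Plus (Var ''s'') (Const 1))) LSkip)))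
     (LSeq (LSeq (LUpdate ''Lnum'' (Var ''x'') (Minus (Var ''s'') vn)) (LUpdate ''Lden'' (Var ''x'') (Const 1)))
       (LSeq (LUpdate ''Rnum'' (Var ''x'') (Plus (Var ''s'') vn)) (LUpdate ''Rden'' (Var ''x'') (Const 1))))))"

text \<open>The loop counts the \<open>j < m\<close> with \<open>j < n - longest n r n x y\<close>.
  Entries lie between \<open>- 2n - 1\<close> and \<open>n\<close>, so the difference is nonnegative
  and below \<open>m\<close>, and the count is exact.\<close>

lemma add_loop:
  assumes inp: "input_ok S n r s" and D: "dist_ok n r s" and x: "x < n" "vars s ''x'' = int x"
    and y: "y < n" "vars s ''y'' = int y"
  shows "vars (sem (LFor ''j'' ''m'' (LCond (Less (Plus (Var ''j'') (at3 vn ''x'' ''y'')) vn)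
      (LAssign ''s'' (Plus (Var ''s'') (Const 1))) LSkip)) s) ''s'' =
    vars s ''s'' + (int n - longest n r n x y)" (is "vars ?t _ = _")
proof -
  let ?d = "nat (int n - longest n r n x y)"
  have "vars ?t ''s'' = vars s ''s'' + int (min (nat (vars s ''m'')) ?d)"
  proof (rule sem_for[where P = "\<lambda>k t. vars t ''s'' = vars s ''s'' + int (min k ?d)"], goal_cases)
    case (3 k t)
    have "vars t ''n'' = int n" "vars t ''x'' = int x" "vars t ''y'' = int y"
      "arrs t ''D'' (idx3 n n x y) = longest n r n x y"
      using 3(3) 3(4)[of "''D''"] input_okD(1)[OF inp] x y dist_okD[OF D x(1) y(1)] by simp_all
    then show ?case using 3(2,5) by (auto simp: idx_fold min_def)
  qed auto
  moreover have "?d \<le> nat (vars s ''m'')"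
    using longest_lower[OF x(1), of r y] input_okD(2)[OF inp] by simp
  ultimately show ?thesis using longest_upper[OF x(1), of r y] by (simp add: min_absorb2)
qed

lemma interval_prog:
  assumes inp: "input_ok S n r s" and D: "dist_ok n r s"
  shows "\<forall>x<n. arrs (sem interval_prog s) ''Lnum'' (int x) = centre n r x - int n \<and>
    arrs (sem interval_prog s) ''Lden'' (int x) = 1 \<and>
    arrs (sem interval_prog s) ''Rnum'' (int x) = centre n r x + int n \<and>
    arrs (sem interval_prog s) ''Rden'' (int x) = 1"
  unfolding interval_prog_def
proof (rule sem_for_fill[where J = "\<lambda>_. True", THEN conjunct2], goal_cases)
  case (6 x t)
  let ?in = "LFor ''j'' ''m''
         (LCond (Less (Plus (Var ''j'') (at3 vn ''x'' ''y'')) vn) (LAssign ''s'' (Plus (Var ''s'') (Const 1))) LSkip)"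
  let ?l = "LFor ''y'' ''n'' ?in"
  let ?t = "set_var ''s'' 0 t"
  have inp': "input_ok S n r t" using inp by (subst input_ok_cong[of t s]) (auto simp: 6(3,4))
  have D': "dist_ok n r t" using D by (subst dist_ok_cong[of t s]) (auto simp: 6(4))
  have "vars (sem ?l ?t) ''s'' = (\<Sum>y<nat (vars ?t ''n''). int n - longest n r n x y)"
  proof (rule sem_for[where P = "\<lambda>k u. vars u ''s'' = (\<Sum>y<k. int n - longest n r n x y)"], goal_cases)
    case (3 k u)
    have inu: "input_ok S n r u" using inp' by (subst input_ok_cong[of u t]) (auto simp: 3(3,4))
    have Du: "dist_ok n r u" using D' by (subst dist_ok_cong[of u t]) (auto simp: 3(4))
    have k: "k < n" using 3(1) input_okD(1)[OF inp'] by simp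
    have xu: "vars u ''x'' = int x" using 3(3) 6(2) by simp
    show ?case using add_loop[OF inu Du 6(1) xu k 3(2)] 3(5) by (simp del: sem.simps)
  qed auto
  then have "vars (sem ?l ?t) ''s'' = centre n r x" using input_okD(1)[OF inp'] by (simp add: centre_def)
  moreover have "vars (sem ?l ?t) ''x'' = int x" "vars (sem ?l ?t) ''n'' = int n" "arrs (sem ?l ?t) = arrs t"
    using 6(2) input_okD(1)[OF inp'] by (auto simp: vars_sem arrs_sem fun_eq_iff simp del: sem.simps)
  ultimately show ?case by (simp del: sem.simps(6))
qed (use input_okD(1)[OF inp] in auto)

section \<open>Reading off longest walks and the certificate\<close>

definition find_test :: bexp where
  "find_test = Or
     (And (Equal (at2 ''P'' ''cur'' ''z'') (Const 1))
       (Equal (at3 (Plus (Var ''k'') (Const 1)) ''cur'' ''tgt'') (Plus (Const 1) (at3 (Var ''k'') ''z'' ''tgt''))))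
     (And (And (Equal (at2 ''P'' ''cur'' ''z'') (Const 0)) (Equal (at2 ''P'' ''z'' ''cur'') (Const 0)))
       (And (Neg (Equal (Var ''cur'') (Var ''z'')))
         (Equal (at3 (Plus (Var ''k'') (Const 1)) ''cur'' ''tgt'') (Plus (Const (-1)) (at3 (Var ''k'') ''z'' ''tgt'')))))"

text \<open>The result \<open>nz = cur\<close> encodes that no successor attains the entry, which
  was then inherited from layer \<open>k\<close>. The encoding is unambiguous because no element has
  an arc to itself (\<open>arc_irrefl\<close>).\<close>

definition find_prog :: lprog where
  "find_prog = LSeq (LAssign ''nz'' (Var ''cur''))
     (LFor ''z'' ''n'' (LCond find_test (LAssign ''nz'' (Var ''z'')) LSkip))"

definition next_vertex :: "nat \<Rightarrow> (nat \<Rightarrow> nat \<Rightarrow> bool) \<Rightarrow> nat \<Rightarrow> nat \<Rightarrow> nat \<Rightarrow> nat \<Rightarrow> bool" where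
  "next_vertex n r k b c z \<longleftrightarrow> z < n \<and> arc r c z \<and> longest n r (Suc k) c b = wgt r c z + longest n r k z b"

lemma find_test:
  assumes inp: "input_ok S n r s" and D: "dist_ok n r s"
    and c: "c < n" "vars s ''cur'' = int c" and b: "b < n" "vars s ''tgt'' = int b"
    and k: "k < n" "vars s ''k'' = int k" and z: "z < n" "vars s ''z'' = int z"
  shows "bval find_test s \<longleftrightarrow> next_vertex n r k b c z"
proof -
  have "arrs s ''D'' (idx3 n (Suc k) c b) = longest n r (Suc k) c b"
    "arrs s ''D'' (idx3 n k z b) = longest n r k z b"
    using D c b k z by (simp_all add: dist_ok_def)
  then show ?thesis
    using input_okD(1)[OF inp] input_okD(3)[OF inp] c b k z
    by (auto simp: find_test_def idx_fold next_vertex_def arc_def incomparable_def wgt_def)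
qed

lemma find_prog:
  assumes inp: "input_ok S n r s" and D: "dist_ok n r s"
    and c: "c < n" "vars s ''cur'' = int c" and b: "b < n" "vars s ''tgt'' = int b"
    and k: "k < n" "vars s ''k'' = int k"
  shows "(vars (sem find_prog s) ''nz'' = int c \<and> longest n r (Suc k) c b = longest n r k c b) \<or>
    (\<exists>z. vars (sem find_prog s) ''nz'' = int z \<and> next_vertex n r k b c z)"
proof -
  let ?P = "\<lambda>j t. (vars t ''nz'' = int c \<and> (\<forall>z<j. \<not> next_vertex n r k b c z)) \<or>
    (\<exists>z. vars t ''nz'' = int z \<and> next_vertex n r k b c z)"
  have "?P (nat (vars (set_var ''nz'' (int c) s) ''n'')) (sem find_prog s)"
    unfolding find_prog_def sem.simps(4) sem.simps(2) aval.simps c(2)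
  proof (rule sem_for[where P = ?P], goal_cases)
    case (3 j t)
    have j: "j < n" using 3(1) input_okD(1)[OF inp] by simp
    have inp': "input_ok S n r t" using inp by (subst input_ok_cong[of t s]) (auto simp: 3(3,4))
    have D': "dist_ok n r t" using D by (subst dist_ok_cong[of t s]) (auto simp: 3(4))
    have "bval find_test t \<longleftrightarrow> next_vertex n r k b c j"
      by (rule find_test[OF inp' D' c(1) _ b(1) _ k(1) _ j 3(2)]) (use 3(3) c b k in simp_all)
    then show ?case using 3(2,5) by (auto simp: less_Suc_eq)
  qed auto
  moreover have "longest n r (Suc k) c b = longest n r k c b" if "\<forall>z<n. \<not> next_vertex n r k b c z"
    by (cases rule: longest_Suc_cases[of n r k c b]) (use that in \<open>auto simp: next_vertex_def\<close>)
  ultimately show ?thesis using input_okD(1)[OF inp] by auto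
qed

definition emit_body :: lprog where
  "emit_body = LSeq (LAssign ''k'' (Minus (Var ''k'') (Const 1))) (LSeq find_prog
     (LCond (Equal (Var ''nz'') (Var ''cur'')) LSkip
       (LSeq (LUpdate ''cycle'' (Var ''length'') (Var ''nz''))
         (LSeq (LAssign ''length'' (Plus (Var ''length'') (Const 1))) (LAssign ''cur'' (Var ''nz''))))))"

lemma emit_body_sem:
  "sem emit_body s = (let t = sem find_prog (set_var ''k'' (vars s ''k'' - 1) s) in
     if vars t ''nz'' = vars t ''cur'' then t
     else set_var ''cur'' (vars t ''nz'') (set_var ''length'' (vars t ''length'' + 1)
       (set_arr ''cycle'' (vars t ''length'') (vars t ''nz'') t)))"
  by (simp add: emit_body_def Let_def)

lemma emit_body_writes:
  "wvars emit_body = {''k'', ''nz'', ''z'', ''length'', ''cur''}" "warrs emit_body = {''cycle''}"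
  "wvars find_prog = {''nz'', ''z''}" "warrs find_prog = {}"
  "well_formed emit_body" "well_formed find_prog"
  by (auto simp: emit_body_def find_prog_def)

lemma arc_irrefl: "strict_poset {..<n} r \<Longrightarrow> x < n \<Longrightarrow> \<not> arc r x x"
  by (auto simp: strict_poset_def arc_def incomparable_def irreflp_on_def)

lemma outputs_sequence_snoc:
  assumes "outputs_sequence s xs" "vars t ''length'' = vars s ''length'' + 1"
    "arrs t ''cycle'' = (arrs s ''cycle'')(vars s ''length'' := int z)"
  shows "outputs_sequence t (xs @ [z])"
  using assms by (auto simp: outputs_sequence_def nth_append less_Suc_eq)

lemma emit_body:
  assumes po: "strict_poset {..<n} r" and inp: "input_ok S n r s" and D: "dist_ok n r s"
    and c: "c < n" "vars s ''cur'' = int c" and b: "b < n" "vars s ''tgt'' = int b"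
    and k: "k < n" "vars s ''k'' = int (Suc k)" and out: "outputs_sequence s xs"
  shows "vars (sem emit_body s) ''k'' = int k \<and>
    (outputs_sequence (sem emit_body s) xs \<and> vars (sem emit_body s) ''cur'' = int c \<and>
       longest n r (Suc k) c b = longest n r k c b \<or>
     (\<exists>z. outputs_sequence (sem emit_body s) (xs @ [z]) \<and> vars (sem emit_body s) ''cur'' = int z \<and>
       next_vertex n r k b c z))"
proof -
  let ?s = "set_var ''k'' (vars s ''k'' - 1) s"
  let ?t = "sem find_prog ?s"
  have sk: "vars ?s ''k'' = int k" using k by simp
  have inp': "input_ok S n r ?s" using inp by simp
  have D': "dist_ok n r ?s" using D by (subst dist_ok_cong[of ?s s]) auto
  have f: "(vars ?t ''nz'' = int c \<and> longest n r (Suc k) c b = longest n r k c b) \<or>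
    (\<exists>z. vars ?t ''nz'' = int z \<and> next_vertex n r k b c z)"
    by (rule find_prog[OF inp' D' c(1) _ b(1) _ k(1) sk]) (use c b in simp_all)
  have t: "vars ?t ''cur'' = int c" "vars ?t ''length'' = vars s ''length''" "vars ?t ''k'' = int k"
    "arrs ?t = arrs s"
    using c sk by (auto simp: vars_sem arrs_sem emit_body_writes fun_eq_iff)
  from f show ?thesis
  proof (elim disjE conjE exE)
    assume "vars ?t ''nz'' = int c" "longest n r (Suc k) c b = longest n r k c b"
    then show ?thesis using t out by (simp add: emit_body_sem Let_def outputs_sequence_def)
  next
    fix z assume z: "vars ?t ''nz'' = int z" "next_vertex n r k b c z"
    then have zc: "z \<noteq> c" using arc_irrefl[OF po c(1)] by (auto simp: next_vertex_def)
    have "outputs_sequence (sem emit_body s) (xs @ [z])"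
      by (rule outputs_sequence_snoc[OF out]) (use z zc t in \<open>auto simp: emit_body_sem Let_def fun_eq_iff\<close>)
    then show ?thesis using z zc t by (auto simp: emit_body_sem Let_def)
  qed
qed

text \<open>Every round descends one layer of the table, whether or not it emits a vertex, so
  \<open>n\<close> rounds end in layer 0. Following arcs that are tight in layer \<open>n\<close>
  alone could circle forever on a closed walk of weight 0.\<close>

definition emit_prog :: lprog where
  "emit_prog = LSeq (LAssign ''k'' vn) (LFor ''j'' ''n'' emit_body)"

lemma walk_snoc:
  "walk n r xs \<Longrightarrow> z < n \<Longrightarrow> arc r (last xs) z \<Longrightarrow>
   walk n r (xs @ [z]) \<and> walk_weight r (xs @ [z]) = walk_weight r xs + wgt r (last xs) z"
proof -
  assume h: "walk n r xs" "z < n" "arc r (last xs) z"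
  then obtain ys y where xs: "xs = ys @ [y]" by (cases xs rule: rev_cases) (auto simp: walk_def)
  then show ?thesis using h walk_weight_append[of r ys y "[z]"]
    by (auto simp: walk_def successively_append_iff)
qed

text \<open>Invariant: the weight emitted so far plus the entry of the current layer at the current
  vertex equals the entry of layer \<open>n\<close> at \<open>c\<close>.\<close>

lemma emit_prog:
  assumes po: "strict_poset {..<n} r" and inp: "input_ok S n r s" and D: "dist_ok n r s"
    and c: "c < n" "vars s ''cur'' = int c" and b: "b < n" "vars s ''tgt'' = int b"
    and out: "outputs_sequence s xs" and real: "longest n r n c b > - 1 - int n"
  shows "\<exists>zs. outputs_sequence (sem emit_prog s) (xs @ zs) \<and> vars (sem emit_prog s) ''cur'' = int b \<and>
    walk n r (c # zs) \<and> last (c # zs) = b \<and> walk_weight r (c # zs) = longest n r n c b"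
proof -
  let ?s = "set_var ''k'' (int n) s"
  let ?P = "\<lambda>j t. \<exists>zs. outputs_sequence t (xs @ zs) \<and> vars t ''cur'' = int (last (c # zs)) \<and>
    vars t ''k'' = int (n - j) \<and> walk n r (c # zs) \<and> length zs \<le> j \<and>
    walk_weight r (c # zs) + longest n r (n - j) (last (c # zs)) b = longest n r n c b"
  have "?P (nat (vars ?s ''n'')) (sem emit_prog s)"
    unfolding emit_prog_def sem.simps(4) sem.simps(2) aval.simps input_okD(1)[OF inp]
  proof (rule sem_for[where P = ?P], goal_cases)
    case 1
    then show ?case by (simp add: emit_body_writes)
  next
    case 2
    show ?case using out c by (intro exI[of _ "[]"]) (auto simp: walk_def outputs_sequence_def)
  next
    case (3 j t)
    from 3(5) obtain zs where zs: "outputs_sequence t (xs @ zs)" "vars t ''cur'' = int (last (c # zs))"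
      "vars t ''k'' = int (n - j)" "walk n r (c # zs)" "length zs \<le> j"
      "walk_weight r (c # zs) + longest n r (n - j) (last (c # zs)) b = longest n r n c b" by blast
    define l where "l = last (c # zs)"
    define k where "k = n - Suc j"
    have j: "j < n" using 3(1) input_okD(1)[OF inp] by simp
    have k: "k < n" "n - j = Suc k" using j by (auto simp: k_def)
    have l: "l < n" using zs(4) last_in_set[of "c # zs"] unfolding l_def walk_def by blast
    have inp': "input_ok S n r t" using inp
      by (subst input_ok_cong[of t s]) (auto simp: 3(3,4) emit_body_writes)
    have D': "dist_ok n r t" using D by (subst dist_ok_cong[of t s]) (auto simp: 3(4) emit_body_writes)
    have tb: "vars t ''tgt'' = int b" using 3(3)[of "''tgt''"] b by (simp add: emit_body_writes)
    have cur: "vars t ''cur'' = int l" and tk: "vars t ''k'' = int (Suc k)"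
      using zs(2,3) k by (simp_all add: l_def)
    note eb = emit_body[OF po inp' D' l cur b(1) tb k(1) tk zs(1)]
    let ?u = "set_var ''j'' (int (Suc j)) (sem emit_body t)"
    have out': "outputs_sequence ?u ys = outputs_sequence (sem emit_body t) ys" for ys
      by (simp add: outputs_sequence_def)
    have uk: "vars ?u ''k'' = int (n - Suc j)" using eb by (simp add: k_def)
    from eb[THEN conjunct2] show ?case
    proof (elim disjE conjE exE)
      assume h: "outputs_sequence (sem emit_body t) (xs @ zs)" "vars (sem emit_body t) ''cur'' = int l"
        "longest n r (Suc k) l b = longest n r k l b"
      have "walk_weight r (c # zs) + longest n r (n - Suc j) (last (c # zs)) b = longest n r n c b"
        using zs(6) h(3) unfolding k(2) k_def[symmetric] l_def[symmetric] by simp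
      then show ?thesis using h(1,2) zs(4,5) uk out' by (intro exI[of _ zs]) (simp add: l_def)
    next
      fix z
      assume h: "outputs_sequence (sem emit_body t) ((xs @ zs) @ [z])" "vars (sem emit_body t) ''cur'' = int z"
        "next_vertex n r k b l z"
      have z: "z < n" "arc r l z" "longest n r (Suc k) l b = wgt r l z + longest n r k z b"
        using h(3) by (auto simp: next_vertex_def)
      have w: "walk n r ((c # zs) @ [z])" "walk_weight r ((c # zs) @ [z]) = walk_weight r (c # zs) + wgt r l z"
        using walk_snoc[OF zs(4) z(1)] z(2) unfolding l_def by auto
      have "walk_weight r ((c # zs) @ [z]) + longest n r (n - Suc j) z b = longest n r n c b"
        using zs(6) z(3) w(2) unfolding k(2) k_def[symmetric] l_def[symmetric] by simp
      then show ?thesis using h(1,2) w(1) zs(5) uk out' by (intro exI[of _ "zs @ [z]"]) simp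
    qed
  qed
  then obtain zs where zs: "outputs_sequence (sem emit_prog s) (xs @ zs)"
    "vars (sem emit_prog s) ''cur'' = int (last (c # zs))" "walk n r (c # zs)" "length zs \<le> n"
    "walk_weight r (c # zs) + longest_base n (last (c # zs)) b = longest n r n c b"
    using input_okD(1)[OF inp] by auto
  \<comment> \<open>Ending elsewhere would leave at most \<open>n - (2n + 1)\<close>, contrary to
    \<open>real\<close>.\<close>
  have "last (c # zs) = b"
    using zs(4,5) real walk_weight_le[of r "c # zs"] by (auto simp: longest_base_def split: if_splits)
  then show ?thesis using zs by (intro exI[of _ zs]) (simp add: longest_base_def)
qed

definition cycle_prog :: lprog where
  "cycle_prog = LSeq (LUpdate ''cycle'' (Const 0) (Var ''root'')) (LSeq (LAssign ''length'' (Const 1))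
     (LSeq (LAssign ''cur'' (Var ''root''))
       (LFor ''y'' ''n'' (LCond (Neg (Less (Plus (at3 vn ''root'' ''y'') (at3 vn ''y'' ''root'')) (Const 0)))
         (LSeq (LAssign ''tgt'' (Var ''y'')) (LSeq emit_prog (LSeq (LAssign ''tgt'' (Var ''root'')) emit_prog)))
         LSkip))))"

lemma walk_append:
  assumes "walk n r xs" "walk n r (last xs # zs)"
  shows "walk n r (xs @ zs)" "walk_weight r (xs @ zs) = walk_weight r xs + walk_weight r (last xs # zs)"
    "last (xs @ zs) = last (last xs # zs)"
proof -
  obtain ys y where xs: "xs = ys @ [y]" using assms by (cases xs rule: rev_cases) (auto simp: walk_def)
  show "walk n r (xs @ zs)" using assms xs successively_append_Cons[of "arc r" ys y zs]
    by (auto simp: walk_def)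
  show "walk_weight r (xs @ zs) = walk_weight r xs + walk_weight r (last xs # zs)"
    using xs walk_weight_append[of r ys y zs] by simp
  show "last (xs @ zs) = last (last xs # zs)" using xs by simp
qed

text \<open>The walk must stay inside \<open>X\<close>, because the representation to be refuted is
  only defined on the elements of the cycle; this is the form in which
  \<open>representation_types_ok\<close> asks for walks.\<close>

definition joined :: "nat \<Rightarrow> (nat \<Rightarrow> nat \<Rightarrow> bool) \<Rightarrow> nat set \<Rightarrow> nat \<Rightarrow> nat \<Rightarrow> bool" where
  "joined n r X x y \<longleftrightarrow> (\<exists>xs. xs \<noteq> [] \<and> set xs \<subseteq> X \<and> successively (arc r) xs \<and> hd xs = x \<and> last xs = y \<and>
     walk_weight r xs = longest n r n x y)"

lemma joined_mono: "joined n r X x y \<Longrightarrow> X \<subseteq> Y \<Longrightarrow> joined n r Y x y"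
  unfolding joined_def by (elim exE, rule exI) auto

lemma joinedD: "joined n r X x y \<Longrightarrow> y \<in> X"
  unfolding joined_def using last_in_set by fastforce

text \<open>The cycle is the concatenation of the walks \<open>x \<rightarrow> y \<rightarrow> x\<close> over the class of \<open>x\<close>. It has
  positive weight if \<open>x\<close> lies on a short positive cycle, and if there is no positive cycle it has
  weight 0 and fixes all centers of the class.\<close>

definition covers :: "nat \<Rightarrow> (nat \<Rightarrow> nat \<Rightarrow> bool) \<Rightarrow> nat \<Rightarrow> nat \<Rightarrow> nat list \<Rightarrow> bool" where
  "covers n r x k xs \<longleftrightarrow> walk n r xs \<and> hd xs = x \<and> last xs = x \<and>
     walk_weight r xs = (\<Sum>y\<in>tight_class n r x \<inter> {..<k}. longest n r n x y + longest n r n y x) \<and>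
     (\<forall>y\<in>tight_class n r x \<inter> {..<k}. joined n r (set xs) x y \<and> joined n r (set xs) y x)"

lemma covers_Suc:
  assumes c: "covers n r x k xs" and k: "k \<in> tight_class n r x"
    and z1: "walk n r (x # zs)" "last (x # zs) = k" "walk_weight r (x # zs) = longest n r n x k"
    and z2: "walk n r (k # zs')" "last (k # zs') = x" "walk_weight r (k # zs') = longest n r n k x"
  shows "covers n r x (Suc k) (xs @ zs @ zs')"
proof -
  let ?ys = "(xs @ zs) @ zs'"
  have xs: "walk n r xs" "hd xs = x" "last xs = x" "xs \<noteq> []" using c by (auto simp: covers_def walk_def)
  have w1: "walk n r (xs @ zs)" "walk_weight r (xs @ zs) = walk_weight r xs + longest n r n x k" "last (xs @ zs) = k"
    using walk_append[OF xs(1), of zs] xs z1 by auto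
  have w2: "walk n r ?ys" "walk_weight r ?ys = walk_weight r (xs @ zs) + longest n r n k x" "last ?ys = x"
    using walk_append[OF w1(1), of zs'] w1 z2 by auto
  have x_in: "x \<in> set xs" using xs(2,4) by (metis hd_in_set)
  have k_in: "k \<in> set (xs @ zs)" using w1 by (metis last_in_set walk_def)
  have j1: "joined n r (set ?ys) x k"
    unfolding joined_def by (rule exI[of _ "x # zs"]) (use z1 x_in in \<open>auto simp: walk_def\<close>)
  have j2: "joined n r (set ?ys) k x"
    unfolding joined_def by (rule exI[of _ "k # zs'"]) (use z2 k_in in \<open>auto simp: walk_def\<close>)
  have old: "joined n r (set ?ys) x y \<and> joined n r (set ?ys) y x" if "y \<in> tight_class n r x \<inter> {..<k}" for y
  proof -
    have "joined n r (set xs) x y" "joined n r (set xs) y x" using c that unfolding covers_def by blast+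
    then show ?thesis using joined_mono[of n r "set xs" _ _ "set ?ys"] by auto
  qed
  have e: "tight_class n r x \<inter> {..<Suc k} = insert k (tight_class n r x \<inter> {..<k})" using k by auto
  have "hd ?ys = x" using xs by simp
  moreover have "walk_weight r ?ys = (\<Sum>y\<in>tight_class n r x \<inter> {..<Suc k}. longest n r n x y + longest n r n y x)"
    unfolding e using w1 w2 c by (simp add: covers_def)
  ultimately show ?thesis using w2 j1 j2 old unfolding covers_def e by auto
qed

lemma covers_skip: "covers n r x k xs \<Longrightarrow> k \<notin> tight_class n r x \<Longrightarrow> covers n r x (Suc k) xs"
proof -
  assume h: "covers n r x k xs" "k \<notin> tight_class n r x"
  have e: "tight_class n r x \<inter> {..<Suc k} = tight_class n r x \<inter> {..<k}"
    using h(2) by (auto simp: less_Suc_eq)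
  show ?thesis using h(1) unfolding covers_def e .
qed

lemma emit_prog_writes:
  "wvars emit_prog = {''j'', ''k'', ''nz'', ''z'', ''length'', ''cur''}" "warrs emit_prog = {''cycle''}"
  "well_formed emit_prog"
  by (auto simp: emit_prog_def emit_body_writes)

lemma cycle_prog:
  assumes po: "strict_poset {..<n} r" and inp: "input_ok S n r s" and D: "dist_ok n r s"
    and x: "x < n" "vars s ''root'' = int x"
  shows "\<exists>xs. outputs_sequence (sem cycle_prog s) xs \<and> covers n r x n xs"
proof -
  let ?s = "set_var ''cur'' (int x) (set_var ''length'' 1 (set_arr ''cycle'' 0 (int x) s))"
  let ?P = "\<lambda>k t. vars t ''cur'' = int x \<and> (\<exists>xs. outputs_sequence t xs \<and> covers n r x k xs)"
  let ?emit = "LSeq (LAssign ''tgt'' (Var ''y'')) (LSeq emit_prog (LSeq (LAssign ''tgt'' (Var ''root'')) emit_prog))"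
  let ?test = "Neg (Less (Plus (at3 vn ''root'' ''y'') (at3 vn ''y'' ''root'')) (Const 0))"
  have s: "sem cycle_prog s = sem (LFor ''y'' ''n'' (LCond ?test ?emit LSkip)) ?s"
    unfolding cycle_prog_def using x(2) by (simp del: sem.simps(6))
  have "?P (nat (vars ?s ''n'')) (sem cycle_prog s)"
    unfolding s
  proof (rule sem_for[where P = ?P], goal_cases)
    case 1
    then show ?case by (simp add: emit_prog_writes)
  next
    case 2
    have "covers n r x 0 [x]" using x by (simp add: covers_def walk_def)
    then show ?case by (auto simp: outputs_sequence_def intro!: exI[of _ "[x]"])
  next
    case (3 k t)
    from 3(5) obtain xs where xs: "outputs_sequence t xs" "covers n r x k xs" "vars t ''cur'' = int x" by blast
    have k: "k < n" using 3(1) input_okD(1)[OF inp] by simp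
    have inp': "input_ok S n r t" using inp
      by (subst input_ok_cong[of t s]) (auto simp: 3(3,4) emit_prog_writes)
    have D': "dist_ok n r t" using D by (subst dist_ok_cong[of t s]) (auto simp: 3(4) emit_prog_writes)
    have tr: "vars t ''root'' = int x" using 3(3)[of "''root''"] x by (simp add: emit_prog_writes)
    have out': "outputs_sequence (set_var ''y'' i u) ys = outputs_sequence u ys"
      "outputs_sequence (set_var ''tgt'' i u) ys = outputs_sequence u ys" for i u ys
      by (simp_all add: outputs_sequence_def)
    have test: "bval ?test t \<longleftrightarrow> k \<in> tight_class n r x"
      using input_okD(1)[OF inp'] 3(2) tr dist_okD[OF D' x(1) k] dist_okD[OF D' k x(1)] k
      by (auto simp: idx_fold tight_class_def)
    show ?case
    proof (cases "k \<in> tight_class n r x")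
      case False
      then show ?thesis using test xs covers_skip[OF xs(2) False] out' by auto
    next
      case True
      then have sum: "longest n r n x k + longest n r n k x \<ge> 0" by (simp add: tight_class_def)
      note g = longest_gt_if_sum_nonneg[OF x(1) k sum]
      let ?t1 = "set_var ''tgt'' (int k) t"
      let ?t2 = "sem emit_prog ?t1"
      let ?t3 = "set_var ''tgt'' (int x) ?t2"
      let ?t4 = "sem emit_prog ?t3"
      have D1: "dist_ok n r ?t1" using D' by (simp add: dist_ok_def)
      have "\<exists>zs. outputs_sequence ?t2 (xs @ zs) \<and> vars ?t2 ''cur'' = int k \<and>
          walk n r (x # zs) \<and> last (x # zs) = k \<and> walk_weight r (x # zs) = longest n r n x k"
        by (rule emit_prog[OF po _ D1 x(1) _ k _ _ g(1)]) (use inp' xs out' in auto)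
      then obtain zs where zs: "outputs_sequence ?t2 (xs @ zs)" "vars ?t2 ''cur'' = int k"
          "walk n r (x # zs)" "last (x # zs) = k" "walk_weight r (x # zs) = longest n r n x k" by blast
      have inp3: "input_ok S n r ?t3" using inp' by (simp add: input_ok_sem emit_prog_writes)
      have D3: "dist_ok n r ?t3" using D' by (simp add: dist_ok_def arrs_sem emit_prog_writes)
      have "\<exists>zs'. outputs_sequence ?t4 ((xs @ zs) @ zs') \<and> vars ?t4 ''cur'' = int x \<and>
          walk n r (k # zs') \<and> last (k # zs') = x \<and> walk_weight r (k # zs') = longest n r n k x"
        by (rule emit_prog[OF po inp3 D3 k _ x(1) _ _ g(2)]) (use zs out' in auto)
      then obtain zs' where zs': "outputs_sequence ?t4 ((xs @ zs) @ zs')" "vars ?t4 ''cur'' = int x"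
          "walk n r (k # zs')" "last (k # zs') = x" "walk_weight r (k # zs') = longest n r n k x" by blast
      have "vars ?t2 ''root'' = int x" using tr by (simp add: vars_sem emit_prog_writes)
      then have "sem (LCond ?test ?emit LSkip) t = ?t4"
        unfolding sem.simps(5) using test True 3(2) by simp
      moreover have "covers n r x (Suc k) (xs @ zs @ zs')"
        by (rule covers_Suc[OF xs(2) True zs(3-5) zs'(3-5)])
      ultimately show ?thesis using zs'(1,2) out' by auto
    qed
  qed
  then show ?thesis using input_okD(1)[OF inp] by auto
qed

section \<open>The whole algorithm\<close>

text \<open>The check is skipped when a positive closed walk was found, since it could overwrite the
  \<open>root\<close> recorded for that walk.\<close>

definition analysis_prog :: lprog where
  "analysis_prog = LSeq dist_prog (LSeq positive_prog (LSeq tcon_prog (LSeq beta_prog (LSeq alpha_prog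
     (LSeq union_prog (LSeq type_prog (LSeq (LAssign ''vio'' (Const 0))
       (LCond (Equal (Var ''pos'') (Const 0)) check_prog LSkip))))))))"

definition main_prog :: lprog where
  "main_prog = LSeq analysis_prog
     (LCond (And (Equal (Var ''pos'') (Const 0)) (Equal (Var ''vio'') (Const 0)))
       (LSeq (LAssign ''verdict'' (Const 1)) interval_prog)
       (LSeq (LAssign ''verdict'' (Const 0)) cycle_prog))"

lemmas prog_defs = main_prog_def analysis_prog_def dist_prog_def dist_init_def dist_step_def
  dist_relax_def dist_relax_body_def positive_prog_def tcon_prog_def beta_prog_def alpha_prog_def
  union_prog_def union_body_def merge_prog_def type_prog_def check_prog_def interval_prog_def
  cycle_prog_def emit_prog_def emit_body_def find_prog_def

lemma main_prog_well_formed: "well_formed main_prog"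
  unfolding prog_defs by simp

lemma main_prog_depth: "depth main_prog \<le> 4"
  unfolding prog_defs by simp

text \<open>A representation of the cycle's elements would give the class admissible types, and by
  \<open>greedy_types_ok\<close> the greedy types would then be admissible too. The violated pair
  \<open>x\<close>, \<open>y\<close> lies in the class of \<open>x\<close> and contradicts
  this.\<close>

lemma not_types_ok_class:
  assumes cl: "x < n" "y < n" "tcon n r x y \<noteq> 0" "\<not> types_ok n r {x, y} (greedy n r S col)"
    and np: "no_positive n r"
    and col: "\<And>g u v. valid_colouring n r S (tight_class n r x) g \<Longrightarrow> u \<in> tight_class n r x \<Longrightarrow>
      v \<in> tight_class n r x \<Longrightarrow> rest n r S u \<Longrightarrow> rest n r S v \<Longrightarrow> tcon n r u v \<noteq> 0 \<Longrightarrow>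
      (col u = col v) = (g u = g v)"
    and cov: "covers n r x n xs"
  shows "\<not> S_order S (set xs) r"
proof
  let ?K = "tight_class n r x"
  assume "S_order S (set xs) r"
  then obtain I where I: "S_representation S (set xs) r I" by (auto simp: S_order_def)
  have j: "joined n r (set xs) x u \<and> joined n r (set xs) u x" if "u \<in> ?K" for u
    using cov that by (auto simp: covers_def tight_class_def)
  have sub: "?K \<subseteq> set xs" using j joinedD by blast
  have ok: "types_ok n r ?K (\<lambda>u. itype (I u))"
    by (rule representation_types_ok[OF np cl(1) I sub]) (use j in \<open>auto simp: joined_def\<close>)
  have xK: "x \<in> ?K" using cl(1) longest_refl[OF np cl(1)] by (simp add: tight_class_def)
  have yK: "y \<in> ?K" by (rule tight_class_tcon[OF np cl(1) xK cl(2,3)])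
  have "types_ok n r ?K (greedy n r S col)"
  proof (rule greedy_types_ok[OF _ _ ok])
    show "?K \<subseteq> {..<n}" by (auto simp: tight_class_def)
    show "v \<in> ?K" if "u \<in> ?K" "v < n" "tcon n r u v \<noteq> 0" for u v
      by (rule tight_class_tcon[OF np cl(1) that])
    show "itype (I u) \<in> S" if "u \<in> ?K" for u
      using I sub that by (auto simp: S_representation_def)
  qed (rule col)
  then show False using cl(4) xK yK unfolding types_ok_def by blast
qed

text \<open>In the positive case \<open>x\<close> itself contributes twice its positive diagonal
  entry and no other summand is negative, by the definition of the class. Without positive closed
  walks all summands vanish, and the second class member \<open>y\<close> ensures that the cycle has
  an arc.\<close>

lemma covers_certificate:
  assumes x: "x < n" and cov: "covers n r x n xs"
    and c: "longest n r n x x > 0 \<or>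
      no_positive n r \<and> (\<exists>y<n. y \<noteq> x \<and> y \<in> tight_class n r x) \<and> \<not> S_order S (set xs) r"
  shows "certificate S {..<n} r xs"
proof -
  have w: "walk n r xs" "hd xs = x" "last xs = x" and
    ww: "walk_weight r xs = (\<Sum>y\<in>tight_class n r x. longest n r n x y + longest n r n y x)"
    using cov by (auto simp: covers_def tight_class_def intro!: sum.cong)
  have v: "cycle_value r xs = walk_weight r xs"
    using w(1) by (intro cycle_value_eq_walk_weight) (simp add: walk_def)
  have fin: "finite (tight_class n r x)" by (simp add: tight_class_def)
  have "length xs \<ge> 2 \<and> (cycle_value r xs > 0 \<or> cycle_value r xs = 0 \<and> \<not> S_order S (set xs) r)"
    using c
  proof (elim disjE conjE exE)
    assume p: "longest n r n x x > 0"
    have "0 < (\<Sum>y\<in>tight_class n r x. longest n r n x y + longest n r n y x)"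
      by (rule sum_pos2[OF fin, of x]) (use p x in \<open>auto simp: tight_class_def\<close>)
    then have "cycle_value r xs > 0" using v ww by simp
    moreover have "length xs \<ge> 2" using walk_weight_le[of r xs] calculation v by simp
    ultimately show ?thesis by simp
  next
    fix y assume np: "no_positive n r" and y: "y < n" "y \<noteq> x" "y \<in> tight_class n r x"
      and no: "\<not> S_order S (set xs) r"
    have "walk_weight r xs = 0" unfolding ww
      by (rule sum.neutral) (use tight_class_sum[OF np x] in blast)
    moreover have "y \<in> set xs" using cov y joinedD[of n r "set xs" x y] by (auto simp: covers_def)
    then have "length xs \<ge> 2" using w y(2) by (cases xs; cases "tl xs") (auto simp: walk_def)
    ultimately show ?thesis using no v by simp
  qed
  then show ?thesis using w by (auto simp: certificate_def forcing_cycle_iff walk_def)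
qed

text \<open>Unsolvability is stated for every list with \<open>covers\<close>, because the cycle is
  computed only afterwards.\<close>

lemma analysis_prog:
  assumes inp: "input_ok S n r s" and S: "S \<noteq> {}"
  defines "t \<equiv> sem analysis_prog s"
  shows "input_ok S n r t \<and> dist_ok n r t \<and>
    (vars t ''pos'' = 1 \<and> (\<exists>x<n. vars t ''root'' = int x \<and> longest n r n x x > 0) \<or>
     vars t ''pos'' = 0 \<and> no_positive n r \<and>
     (vars t ''vio'' = 0 \<and> (\<exists>ty. (\<forall>x<n. arrs t ''type'' (int x) = type_code (ty x) \<and> ty x \<in> S) \<and>
         types_ok n r {..<n} ty) \<or>
      vars t ''vio'' = 1 \<and> (\<exists>x<n. \<exists>y<n. vars t ''root'' = int x \<and> tcon n r x y \<noteq> 0 \<and>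
         (\<forall>xs. covers n r x n xs \<longrightarrow> \<not> S_order S (set xs) r))))"
proof -
  define s1 where "s1 = sem dist_prog s"
  define s2 where "s2 = sem positive_prog s1"
  define s3 where "s3 = sem tcon_prog s2"
  define s4 where "s4 = sem beta_prog s3"
  define s5 where "s5 = sem alpha_prog s4"
  define s6 where "s6 = sem union_prog s5"
  define s7 where "s7 = sem type_prog s6"
  define s8 where "s8 = set_var ''vio'' 0 s7"
  have t: "t = (if vars s8 ''pos'' = 0 then sem check_prog s8 else s8)"
    unfolding t_def analysis_prog_def sem.simps(2,4,5) by (simp add: s1_def s2_def s3_def s4_def s5_def s6_def s7_def s8_def)
  have wf: "well_formed dist_prog" "well_formed positive_prog" "well_formed tcon_prog" "well_formed beta_prog"
    "well_formed alpha_prog" "well_formed union_prog" "well_formed type_prog" "well_formed check_prog"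
    unfolding prog_defs by simp_all
  have wa: "warrs dist_prog = {''D''}" "warrs positive_prog = {}" "warrs tcon_prog = {''G''}"
    "warrs beta_prog = {''b''}" "warrs alpha_prog = {''a''}" "warrs union_prog = {''comp'', ''col''}"
    "warrs type_prog = {''type''}" "warrs check_prog = {}"
    unfolding prog_defs by auto
  have wv: "wvars tcon_prog = {''x'', ''y''}" "wvars beta_prog = {''x'', ''y'', ''ok''}"
    "wvars alpha_prog = {''x'', ''y'', ''ok''}" "wvars union_prog = {''x'', ''y'', ''z'', ''cy'', ''cz'', ''flip''}"
    "wvars type_prog = {''x''}" "wvars check_prog = {''x'', ''y'', ''vio'', ''root''}"
    unfolding prog_defs by auto
  have i1: "input_ok S n r s1" unfolding s1_def by (simp add: input_ok_sem wf wa inp)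
  have i2: "input_ok S n r s2" unfolding s2_def by (simp add: input_ok_sem wf wa i1)
  have i3: "input_ok S n r s3" unfolding s3_def by (simp add: input_ok_sem wf wa i2)
  have i4: "input_ok S n r s4" unfolding s4_def by (simp add: input_ok_sem wf wa i3)
  have i5: "input_ok S n r s5" unfolding s5_def by (simp add: input_ok_sem wf wa i4)
  have i6: "input_ok S n r s6" unfolding s6_def by (simp add: input_ok_sem wf wa i5)
  have i7: "input_ok S n r s7" unfolding s7_def by (simp add: input_ok_sem wf wa i6)
  have i8: "input_ok S n r s8" unfolding s8_def using i7 by simp
  have d1: "dist_ok n r s1" unfolding s1_def by (rule dist_prog[OF inp])
  have d2: "dist_ok n r s2" unfolding s2_def using d1 by (simp add: dist_ok_def arrs_sem wa)
  have d8: "dist_ok n r s8"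
    unfolding s8_def s7_def s6_def s5_def s4_def s3_def using d2 by (simp add: dist_ok_def arrs_sem wa)
  have g3: "tcon_ok n r s3" unfolding s3_def tcon_ok_def by (rule tcon_prog[OF i2 d2])
  have g4: "tcon_ok n r s4" unfolding s4_def using g3 by (simp add: tcon_ok_def arrs_sem wa)
  have g5: "tcon_ok n r s5" unfolding s5_def using g4 by (simp add: tcon_ok_def arrs_sem wa)
  have g8: "tcon_ok n r s8" unfolding s8_def s7_def s6_def using g5 by (simp add: tcon_ok_def arrs_sem wa)
  have b4: "\<forall>x<n. arrs s4 ''b'' (int x) = of_bool (beta n r S x)" unfolding s4_def by (rule beta_prog[OF i3 g3])
  have b5: "arrs s5 ''b'' = arrs s4 ''b''" unfolding s5_def by (simp add: arrs_sem wa)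
  have c5: "class_ok S n r s5"
    using alpha_prog[OF i4 g4 b4] b4 b5 by (simp add: class_ok_def s5_def)
  have c6: "class_ok S n r s6" unfolding s6_def using c5 by (simp add: class_ok_def arrs_sem wa)
  define col where "col = (\<lambda>x. arrs s6 ''col'' (int x) = 1)"
  define ty where "ty = greedy n r S col"
  have ty8: "\<forall>x<n. arrs s8 ''type'' (int x) = type_code (ty x)"
    using type_prog[OF i6 c6] by (simp add: s8_def s7_def ty_def col_def)
  have pos: "vars s8 ''pos'' = vars s2 ''pos''" "vars s8 ''root'' = vars s2 ''root''"
    unfolding s8_def s7_def s6_def s5_def s4_def s3_def by (simp_all add: vars_sem wv)
  \<comment> \<open>The array \<open>col\<close> is fixed by the run, while \<open>g\<close> ranges
    over all valid colourings of the class.\<close>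
  have colour: "(col u = col v) = (g u = g v)"
    if x: "x < n" and np: "no_positive n r" and "valid_colouring n r S (tight_class n r x) g"
      "u \<in> tight_class n r x" "v \<in> tight_class n r x" "rest n r S u" "rest n r S v" "tcon n r u v \<noteq> 0"
    for x g u v
    unfolding col_def s6_def
    by (rule union_prog[OF _ tight_class_tcon[OF np x] that(3) i5 g5 c5 that(4-8)])
      (auto simp: tight_class_def)
  from positive_prog[OF i1 d1, folded s2_def] show ?thesis
  proof (elim disjE)
    assume p: "vars s2 ''pos'' = 1 \<and> (\<exists>x<n. vars s2 ''root'' = int x \<and> longest n r n x x > 0)"
    then have "t = s8" using t pos by simp
    then show ?thesis using p pos i8 d8 by simp
  next
    assume p: "vars s2 ''pos'' = 0 \<and> no_positive n r"
    then have te: "t = sem check_prog s8" using t pos by simp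
    have it: "input_ok S n r t" unfolding te by (simp add: input_ok_sem wf wa i8)
    have dt: "dist_ok n r t" unfolding te using d8 by (simp add: dist_ok_def arrs_sem wa)
    have pt: "vars t ''pos'' = 0" unfolding te using pos p by (simp add: vars_sem wv)
    have tt: "\<forall>x<n. arrs t ''type'' (int x) = type_code (ty x) \<and> ty x \<in> S"
      unfolding te using ty8 greedy_in[OF S] by (simp add: arrs_sem wa ty_def)
    have v8: "vars s8 ''vio'' = 0" by (simp add: s8_def)
    from check_prog[OF i8 g8 ty8 v8, folded te] show ?thesis
    proof (elim disjE conjE exE)
      assume "vars t ''vio'' = 0" "types_ok n r {..<n} ty"
      then show ?thesis using it dt pt p tt by blast
    next
      fix x y
      assume h: "vars t ''vio'' = 1" "x < n" "y < n" "vars t ''root'' = int x" "tcon n r x y \<noteq> 0"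
        "\<not> types_ok n r {x, y} ty"
      have "\<not> S_order S (set xs) r" if "covers n r x n xs" for xs
        using p colour[OF h(2)]
        by (intro not_types_ok_class[OF h(2,3,5) h(6)[unfolded ty_def] _ _ that]) auto
      then show ?thesis using it dt pt p h by blast
    qed
  qed
qed

text \<open>A correct witness settles the verdict: a representation proves the order property, and
  by \<open>certificate_not_S_order\<close> a certificate excludes it.\<close>

lemma main_prog:
  assumes inp: "input_ok S n r s" and S: "S \<noteq> {}" and po: "strict_poset {..<n} r"
  shows "correct_output S n r (sem main_prog s)"
proof -
  define t where "t = sem analysis_prog s"
  let ?u = "sem main_prog s"
  note an = analysis_prog[OF inp S, folded t_def]
  have it: "input_ok S n r t" and dt: "dist_ok n r t" using an by auto
  have ok: "correct_output S n r ?u"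
    if v: "vars t ''pos'' = 0" "vars t ''vio'' = 0" and np: "no_positive n r"
      and ty: "\<forall>x<n. arrs t ''type'' (int x) = type_code (ty x) \<and> ty x \<in> S" "types_ok n r {..<n} ty" for ty
  proof -
    let ?t = "set_var ''verdict'' 1 t"
    have u: "?u = sem interval_prog ?t" unfolding main_prog_def t_def using v[unfolded t_def] by simp
    have i: "input_ok S n r ?t" and d: "dist_ok n r ?t" using it dt by (auto simp: dist_ok_def)
    have rep: "S_representation S {..<n} r (canonical_rep n r ty)"
      using ty by (intro canonical_rep_correct[OF po np]) auto
    have "arrs ?u ''type'' = arrs t ''type''" "vars ?u ''verdict'' = 1"
      unfolding u by (simp_all add: arrs_sem vars_sem interval_prog_def del: sem.simps)
    then show ?thesis
      using interval_prog[OF i d, folded u] rep ty(1)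
      by (auto simp: correct_output_def S_order_def outputs_intervals_def canonical_rep_def
          intro!: exI[of _ "canonical_rep n r ty"])
  qed
  have bad: "correct_output S n r ?u"
    if v: "vars t ''pos'' \<noteq> 0 \<or> vars t ''vio'' \<noteq> 0" and x: "x < n" "vars t ''root'' = int x"
      and c: "\<And>xs. covers n r x n xs \<Longrightarrow> certificate S {..<n} r xs" for x
  proof -
    let ?t = "set_var ''verdict'' 0 t"
    have u: "?u = sem cycle_prog ?t" unfolding main_prog_def t_def using v[unfolded t_def] by auto
    have i: "input_ok S n r ?t" and d: "dist_ok n r ?t" and rt: "vars ?t ''root'' = int x"
      using it dt x by (auto simp: dist_ok_def)
    obtain xs where xs: "outputs_sequence ?u xs" "covers n r x n xs"
      using cycle_prog[OF po i d x(1) rt] unfolding u by blast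
    have "vars ?u ''verdict'' = 0"
      unfolding u by (simp add: vars_sem cycle_prog_def emit_prog_writes del: sem.simps)
    then show ?thesis using xs c[OF xs(2)] certificate_not_S_order[OF c[OF xs(2)]]
      by (auto simp: correct_output_def)
  qed
  from an consider
    x where "vars t ''pos'' = 1" "x < n" "vars t ''root'' = int x" "longest n r n x x > 0"
  | ty where "vars t ''pos'' = 0" "no_positive n r" "vars t ''vio'' = 0"
      "\<forall>x<n. arrs t ''type'' (int x) = type_code (ty x) \<and> ty x \<in> S" "types_ok n r {..<n} ty"
  | x y where "no_positive n r" "vars t ''vio'' = 1" "x < n" "y < n" "vars t ''root'' = int x"
      "tcon n r x y \<noteq> 0" "\<forall>xs. covers n r x n xs \<longrightarrow> \<not> S_order S (set xs) r"
    by blast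
  then show ?thesis
  proof cases
    case (1 x)
    then show ?thesis using covers_certificate[of x n r _ S] by (intro bad[of x]) auto
  next
    case (2 ty)
    then show ?thesis by (intro ok[of ty])
  next
    case (3 x y)
    have xK: "x \<in> tight_class n r x" using 3(3) longest_refl[OF 3(1,3)] by (simp add: tight_class_def)
    have yK: "y \<in> tight_class n r x" by (rule tight_class_tcon[OF 3(1,3) xK 3(4,6)])
    \<comment> \<open>A constraint needs distance 1 in one direction, whereas the distance from
      \<open>x\<close> to itself is 0.\<close>
    have "y \<noteq> x" using 3(6) longest_refl[OF 3(1,3)] by (auto simp: tcon_def adj_def)
    then show ?thesis using 3 yK covers_certificate[of x n r _ S] by (intro bad[of x]) auto
  qed
qed

lemma input_state_ok: "input_ok S n r (set_var ''m'' (4 * int n + 4) (input_state S n r))"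
proof -
  have "(\<exists>x'<n. \<exists>y'<n. idx n x y = int (x' * n + y') \<and> r x' y') \<longleftrightarrow> r x y" if "x < n" "y < n" for x y
  proof -
    have "int (x' * n + y') = idx n x' y'" for x' y' by (simp add: idx_def)
    then show ?thesis using that by (auto simp: idx_inject)
  qed
  moreover have "(\<exists>\<sigma>\<in>S. type_code \<tau> = type_code \<sigma>) \<longleftrightarrow> \<tau> \<in> S" for \<tau>
  proof -
    have "type_code \<tau> = type_code \<sigma> \<longleftrightarrow> \<tau> = \<sigma>" for \<sigma> by (cases \<tau>; cases \<sigma>) auto
    then show ?thesis by auto
  qed
  ultimately show ?thesis by (simp add: input_ok_def input_state_def)
qed

text \<open>The memory contains only \<open>n\<close> and bits; the summand 1 is for the bits when
  \<open>n = 0\<close>.\<close>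

lemma input_state_bounded: "bounded_state (n + 1) (input_state S n r)"
  by (auto simp: bounded_state_def input_state_def)

theorem theorem27:
  "\<exists>(prog :: com) (T :: nat \<Rightarrow> nat).
     (\<lambda>n. real (T n)) \<in> O(\<lambda>n. real n ^ 5) \<and>
     (\<forall>(S :: itype set) (n :: nat) (r :: nat \<Rightarrow> nat \<Rightarrow> bool).
        S \<noteq> {} \<longrightarrow> strict_poset {..<n} r \<longrightarrow> twin_free {..<n} r \<longrightarrow> \<not> separable {..<n} r \<longrightarrow>
        (\<exists>t s. exec prog (input_state S n r) t s \<and> t \<le> T n \<and> correct_output S n r s))"
proof -
  obtain C where C: "\<And>n s. bounded_state (n + 1) s \<Longrightarrow> vars s ''n'' = int n \<Longrightarrow>
    \<exists>t. exec (loop_program main_prog) s t (sem main_prog (set_var ''m'' (4 * int n + 4) s)) \<and>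
      t \<le> C * (4 * n + 5) ^ 5"
    using exec_loop_program[OF main_prog_well_formed main_prog_depth] by blast
  have "\<exists>t s. exec (loop_program main_prog) (input_state S n r) t s \<and> t \<le> C * (4 * n + 5) ^ 5 \<and>
      correct_output S n r s" if "S \<noteq> {}" "strict_poset {..<n} r" for S n r
    using C[OF input_state_bounded[of n S r]] main_prog[OF input_state_ok that]
    by (auto simp: input_state_def)
  then show ?thesis
    by (intro exI[of _ "loop_program main_prog"] exI[of _ "\<lambda>n. C * (4 * n + 5) ^ 5"] conjI allI impI
        poly_bigo)
qed

end
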